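(* Let $k$ be a field, let $H$ be a coquasitriangular Hopf algebra over $k$ and let $A$ be a Hopf algebra in the braided category $\mathcal{M}^{H}$ of right $H$-comodules. If the trivial module ${}_\varepsilon k$ is of type FP in ${}_A\mathcal{M}^H$, then $A$ is a smooth algebra.
   Context: A coquasitriangular Hopf algebra is a Hopf algebra $H$ with a convolution-invertible linear form $\mathbf{r}:H\otimes H\to k$ such that $yx=\mathbf{r}(x_{(1)},y_{(1)})x_{(2)}y_{(2)}\mathbf{r}^{-1}(x_{(3)},y_{(3)})$, $\mathbf{r}(xy,z)=\mathbf{r}(x,z_{(1)})\mathbf{r}(y,z_{(2)})$ and $\mathbf{r}(x,yz)=\mathbf{r}(x_{(1)},z)\mathbf{r}(x_{(2)},y)$. The category $\mathcal{M}^H$ of right $H$-comodules is braided by $c_{V,W}(v\otimes w)=\mathbf{r}(v_{(1)},w_{(1)})\,w_{(0)}\otimes v_{(0)}$. A Hopf algebra in a braided category $\mathcal{C}$ is an object $A$ with an algebra structure $(m,\eta)$ and a coalgebra structure $(\Delta,\varepsilon)$ in $\mathcal{C}$ such that $\Delta:A\to A\otimes_c A$ and $\varepsilon:A\to I$ are algebra morphisms, where $A\otimes_c A$ has multiplication $(m\otimes m)\circ(\mathrm{id}\otimes c_{A,A}\otimes \mathrm{id})$, together with an antipode $S:A\to A$ in $\mathcal{C}$, a convolution inverse of $\mathrm{id}_A$. ${}_A\mathcal{M}^H$ is the category of left $A$-modules in $\mathcal{M}^H$, i.e. vector spaces $V$ that are left $A$-modules and right $H$-comodules with $(a\cdot v)_{(0)}\otimes(a\cdot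 v)_{(1)}=a_{(0)}\cdot v_{(0)}\otimes a_{(1)}v_{(1)}$; morphisms are $A$-linear $H$-colinear maps. ${}_\varepsilon k$ is $k$ with the trivial comodule structure and $A$ acting via $\varepsilon$. An object of ${}_A\mathcal{M}^H$ is finite relative projective if it is isomorphic in ${}_A\mathcal{M}^H$ to a direct summand of $A\otimes V$ (left multiplication action, tensor product coaction) with $V$ an $H$-comodule having a left dual (i.e. a finite-dimensional comodule). An object $M$ is of type FP in ${}_A\mathcal{M}^H$ if there is an exact sequence $0\to P_n\to\cdots\to P_0\to M\to 0$ in ${}_A\mathcal{M}^H$ with all $P_i$ finite relative projective. An ordinary $k$-algebra $A$ is smooth if $A$ admits, as an $A$-bimodule, a finite-length resolution by finitely generated projective $A$-bimodules. *)

theory Defs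
  imports Complex_Main "HOL-Library.Poly_Mapping"
begin

text \<open>
  A vector space is a subspace (the carrier) of an ambient type carrying a vector space structure
  in the sense of \<^locale>\<open>vector_space\<close>.  The carrier is needed because a resolution is a
  sequence of spaces of varying size inside one type.  Accordingly, maps are total functions of
  which only the restriction to the carrier matters.
\<close>

record ('k, 'v) vs =
  carr :: "'v set"
  scl :: "'k \<Rightarrow> 'v \<Rightarrow> 'v"

definition is_vs :: "('k::field, 'v::ab_group_add, 'z) vs_scheme \<Rightarrow> bool" where
  "is_vs V \<longleftrightarrow> vector_space (scl V) \<and> module.subspace (scl V) (carr V)"

definition lin ::
  "('k::field, 'v::ab_group_add, 'z) vs_scheme \<Rightarrow> ('k, 'w::ab_group_add, 'y) vs_scheme \<Rightarrow> ('v \<Rightarrow> 'w) \<Rightarrow> bool"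
where
  "lin V W f \<longleftrightarrow>
     (\<forall>x\<in>carr V. f x \<in> carr W) \<and>
     (\<forall>x\<in>carr V. \<forall>y\<in>carr V. f (x + y) = f x + f y) \<and>
     (\<forall>c. \<forall>x\<in>carr V. f (scl V c x) = scl W c (f x))"

definition bilin ::
  "('k::field, 'u::ab_group_add, 'x) vs_scheme \<Rightarrow> ('k, 'v::ab_group_add, 'z) vs_scheme \<Rightarrow>
   ('k, 'w::ab_group_add, 'y) vs_scheme \<Rightarrow> ('u \<Rightarrow> 'v \<Rightarrow> 'w) \<Rightarrow> bool"
where
  "bilin U V W f \<longleftrightarrow>
     (\<forall>x\<in>carr U. lin V W (f x)) \<and> (\<forall>y\<in>carr V. lin U W (\<lambda>x. f x y))"

definition base_field :: "('k::field, 'k) vs" where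
  "base_field = \<lparr>carr = UNIV, scl = (*)\<rparr>"

definition finite_dim :: "('k::field, 'v::ab_group_add, 'z) vs_scheme \<Rightarrow> bool" where
  "finite_dim V \<longleftrightarrow> (\<exists>B. finite B \<and> B \<subseteq> carr V \<and> module.span (scl V) B = carr V)"

text \<open>
  Tensor products are taken in the model given by chosen bases: with \<open>B\<close>, \<open>C\<close> the chosen bases of
  \<open>V\<close>, \<open>W\<close>, the space \<open>V \<otimes> W\<close> consists of the finitely supported functions on \<open>B \<times> C\<close>, and
  \<open>tens V W v w\<close> is the pure tensor of \<open>v\<close> and \<open>w\<close>.  For a bilinear \<open>f\<close> into \<open>Z\<close>,
  \<open>tlift Z f\<close> is the induced linear map on the tensor product.  So if \<open>t\<close> is a tensor
  \<open>\<Sum> x \<otimes> y\<close> (for instance \<open>\<Delta>(h) = h\<^sub>1 \<otimes> h\<^sub>2\<close> in Sweedler notation), then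
  \<open>tlift Z (\<lambda>x y. f x y) t\<close> is \<open>\<Sum> f x y\<close>.  The universal property is proved below
  (\<open>tens_bilin\<close>, \<open>tlift_lin\<close>, \<open>tlift_tens\<close>, \<open>tensor_map_unique\<close>).
\<close>

definition vbasis :: "('k::field, 'v::ab_group_add, 'z) vs_scheme \<Rightarrow> 'v set" where
  "vbasis V = (SOME B. B \<subseteq> carr V \<and> \<not> module.dependent (scl V) B \<and>
                       module.span (scl V) B = carr V)"

definition coord :: "('k::field, 'v::ab_group_add, 'z) vs_scheme \<Rightarrow> 'v \<Rightarrow> 'v \<Rightarrow> 'k" where
  "coord V x = module.representation (scl V) (vbasis V) x"

definition tensor ::
  "('k::field, 'v::ab_group_add, 'z) vs_scheme \<Rightarrow> ('k, 'w::ab_group_add, 'y) vs_scheme \<Rightarrow>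
   ('k, ('v \<times> 'w) \<Rightarrow>\<^sub>0 'k) vs"  (infixr \<open>\<otimes>\<^sub>v\<close> 70)
where
  "V \<otimes>\<^sub>v W = \<lparr>carr = {t. Poly_Mapping.keys t \<subseteq> vbasis V \<times> vbasis W},
              scl = (\<lambda>c. Poly_Mapping.map ((*) c))\<rparr>"

definition tens ::
  "('k::field, 'v::ab_group_add, 'z) vs_scheme \<Rightarrow> ('k, 'w::ab_group_add, 'y) vs_scheme \<Rightarrow>
   'v \<Rightarrow> 'w \<Rightarrow> ('v \<times> 'w) \<Rightarrow>\<^sub>0 'k"
where
  "tens V W v w = Abs_poly_mapping (\<lambda>(b, c). coord V v b * coord W w c)"

definition tlift ::
  "('k::field, 'u::ab_group_add, 'z) vs_scheme \<Rightarrow> ('v \<Rightarrow> 'w \<Rightarrow> 'u) \<Rightarrow> (('v \<times> 'w) \<Rightarrow>\<^sub>0 'k) \<Rightarrow> 'u"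
where
  "tlift Z f t = (\<Sum>p\<in>Poly_Mapping.keys t. scl Z (Poly_Mapping.lookup t p) (f (fst p) (snd p)))"

definition tmap ::
  "('k::field, 'v'::ab_group_add, 'z) vs_scheme \<Rightarrow> ('k, 'w'::ab_group_add, 'y) vs_scheme \<Rightarrow>
   ('v \<Rightarrow> 'v') \<Rightarrow> ('w \<Rightarrow> 'w') \<Rightarrow> (('v \<times> 'w) \<Rightarrow>\<^sub>0 'k) \<Rightarrow> (('v' \<times> 'w') \<Rightarrow>\<^sub>0 'k)"
where
  "tmap V' W' f g = tlift (V' \<otimes>\<^sub>v W') (\<lambda>v w. tens V' W' (f v) (g w))"

text \<open>The associativity isomorphism \<open>(U \<otimes> V) \<otimes> W \<rightarrow> U \<otimes> (V \<otimes> W)\<close>.\<close>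

definition tassoc ::
  "('k::field, 'u::ab_group_add, 'x) vs_scheme \<Rightarrow> ('k, 'v::ab_group_add, 'y) vs_scheme \<Rightarrow>
   ('k, 'w::ab_group_add, 'z) vs_scheme \<Rightarrow>
   (((('u \<times> 'v) \<Rightarrow>\<^sub>0 'k) \<times> 'w) \<Rightarrow>\<^sub>0 'k) \<Rightarrow> (('u \<times> (('v \<times> 'w) \<Rightarrow>\<^sub>0 'k)) \<Rightarrow>\<^sub>0 'k)"
where
  "tassoc U V W =
     (let T = U \<otimes>\<^sub>v (V \<otimes>\<^sub>v W) in
      tlift T (\<lambda>t w. tlift T (\<lambda>u v. tens U (V \<otimes>\<^sub>v W) u (tens V W v w)) t))"

lemma vbasis:
  assumes "is_vs V"
  shows "vbasis V \<subseteq> carr V" "\<not> module.dependent (scl V) (vbasis V)"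
    "module.span (scl V) (vbasis V) = carr V"
proof -
  interpret vector_space "scl V" using assms by (simp add: is_vs_def)
  have s: "subspace (carr V)" using assms by (simp add: is_vs_def)
  obtain B where B: "B \<subseteq> carr V" "independent B" "carr V \<subseteq> span B"
    by (rule basis_exists)
  have "span B = carr V" using B span_minimal[OF B(1) s] by blast
  with B have "\<exists>B. B \<subseteq> carr V \<and> \<not> dependent B \<and> span B = carr V" by blast
  from someI_ex[OF this] show "vbasis V \<subseteq> carr V" "\<not> dependent (vbasis V)"
    "span (vbasis V) = carr V"
    unfolding vbasis_def by blast+
qed

lemma coord_finite:
  assumes "is_vs V" shows "finite {b. coord V x b \<noteq> 0}"
proof -
  interpret vector_space "scl V" using assms by (simp add: is_vs_def)
  show ?thesis unfolding coord_def by (rule finite_representation)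
qed

lemma coord_basis:
  assumes "is_vs V" "coord V x b \<noteq> 0" shows "b \<in> vbasis V"
proof -
  interpret vector_space "scl V" using assms by (simp add: is_vs_def)
  show ?thesis using assms(2) unfolding coord_def by (rule representation_ne_zero)
qed

lemma coord_add:
  assumes "is_vs V" "x \<in> carr V" "y \<in> carr V"
  shows "coord V (x + y) b = coord V x b + coord V y b"
proof -
  interpret vector_space "scl V" using assms by (simp add: is_vs_def)
  show ?thesis unfolding coord_def
    using representation_add[OF vbasis(2)[OF assms(1)], of y x] assms(2,3) vbasis(3)[OF assms(1)]
    by simp
qed

lemma coord_scl:
  assumes "is_vs V" "x \<in> carr V"
  shows "coord V (scl V c x) b = c * coord V x b"
proof -
  interpret vector_space "scl V" using assms by (simp add: is_vs_def)
  show ?thesis unfolding coord_def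
    using representation_scale[OF vbasis(2)[OF assms(1)], of x c] assms(2) vbasis(3)[OF assms(1)]
    by simp
qed

lemma coord_of_basis:
  assumes "is_vs V" "x \<in> vbasis V"
  shows "coord V x b = (if b = x then 1 else 0)"
proof -
  interpret vector_space "scl V" using assms by (simp add: is_vs_def)
  show ?thesis unfolding coord_def
    using representation_basis[OF vbasis(2)[OF assms(1)] assms(2)] by simp
qed

lemma coord_expand:
  assumes "is_vs V" "x \<in> carr V"
  shows "(\<Sum>b | coord V x b \<noteq> 0. scl V (coord V x b) b) = x"
proof -
  interpret vector_space "scl V" using assms by (simp add: is_vs_def)
  show ?thesis unfolding coord_def
    by (rule sum_nonzero_representation_eq[OF vbasis(2)[OF assms(1)]])
      (use assms(2) vbasis(3)[OF assms(1)] in simp)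
qed

lemma lookup_tens:
  assumes "is_vs V" "is_vs W"
  shows "Poly_Mapping.lookup (tens V W v w) (b, c) = coord V v b * coord W w c"
proof -
  have "{p. (\<lambda>(b, c). coord V v b * coord W w c) p \<noteq> 0}
      \<subseteq> {b. coord V v b \<noteq> 0} \<times> {c. coord W w c \<noteq> 0}" by auto
  then have "finite {p. (\<lambda>(b, c). coord V v b * coord W w c) p \<noteq> 0}"
    using coord_finite[OF assms(1), of v] coord_finite[OF assms(2), of w]
    by (rule finite_subset[OF _ finite_cartesian_product])
  then show ?thesis unfolding tens_def by (subst Abs_poly_mapping_inverse) auto
qed

lemma keys_tens:
  assumes "is_vs V" "is_vs W"
  shows "Poly_Mapping.keys (tens V W v w) = {b. coord V v b \<noteq> 0} \<times> {c. coord W w c \<noteq> 0}"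
  by (auto simp: lookup_tens[OF assms] in_keys_iff)

lemma lookup_smult: "Poly_Mapping.lookup (Poly_Mapping.map ((*) (c::'k::field)) t) p = c * Poly_Mapping.lookup t p"
  by (simp add: Poly_Mapping.map.rep_eq when_def)

lemma tensor_is_vs: "is_vs (V \<otimes>\<^sub>v W)"
proof -
  have v: "vector_space (\<lambda>c. Poly_Mapping.map ((*) (c::'k::field)) :: (('v \<times> 'w) \<Rightarrow>\<^sub>0 'k) \<Rightarrow> _)"
    by unfold_locales
      (auto intro!: poly_mapping_eqI simp: lookup_smult lookup_add algebra_simps)
  then interpret vector_space "\<lambda>c. Poly_Mapping.map ((*) (c::'k::field)) :: (('v \<times> 'w) \<Rightarrow>\<^sub>0 'k) \<Rightarrow> _" .
  show ?thesis unfolding is_vs_def tensor_def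
    using v
    by (auto simp: subspace_def in_keys_iff lookup_smult
        dest!: subsetD[OF keys_add] subsetD)
qed

lemma tens_in:
  assumes "is_vs V" "is_vs W" shows "tens V W v w \<in> carr (V \<otimes>\<^sub>v W)"
  by (auto simp: tensor_def keys_tens[OF assms] dest: coord_basis[OF assms(1)] coord_basis[OF assms(2)])

lemma keys_tensor:
  assumes "t \<in> carr (V \<otimes>\<^sub>v W)" "p \<in> Poly_Mapping.keys t"
  shows "fst p \<in> vbasis V" "snd p \<in> vbasis W"
  using assms by (cases p; auto simp: tensor_def)+

lemma tens_bilin:
  assumes "is_vs V" "is_vs W"
  shows "bilin V W (V \<otimes>\<^sub>v W) (tens V W)"
proof -
  have s: "scl (V \<otimes>\<^sub>v W) = (\<lambda>c. Poly_Mapping.map ((*) c))" by (simp add: tensor_def)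
  have 1: "tens V W (x + y) w = tens V W x w + tens V W y w" if "x \<in> carr V" "y \<in> carr V" for x y w
    by (rule poly_mapping_eqI) (use that assms in \<open>force simp: lookup_add lookup_tens coord_add algebra_simps\<close>)
  have 2: "tens V W v (x + y) = tens V W v x + tens V W v y" if "x \<in> carr W" "y \<in> carr W" for v x y
    by (rule poly_mapping_eqI) (use that assms in \<open>force simp: lookup_add lookup_tens coord_add algebra_simps\<close>)
  have 3: "tens V W (scl V c x) w = Poly_Mapping.map ((*) c) (tens V W x w)" if "x \<in> carr V" for c x w
    by (rule poly_mapping_eqI) (use that assms in \<open>force simp: lookup_smult lookup_tens coord_scl\<close>)
  have 4: "tens V W v (scl W c y) = Poly_Mapping.map ((*) c) (tens V W v y)" if "y \<in> carr W" for c v y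
    by (rule poly_mapping_eqI) (use that assms in \<open>force simp: lookup_smult lookup_tens coord_scl\<close>)
  show ?thesis unfolding bilin_def lin_def s using 1 2 3 4 tens_in[OF assms] by blast
qed

lemma lin_sum:
  assumes "is_vs V" "is_vs W" "lin V W f" "finite I" "\<And>i. i \<in> I \<Longrightarrow> g i \<in> carr V"
  shows "f (\<Sum>i\<in>I. scl V (a i) (g i)) = (\<Sum>i\<in>I. scl W (a i) (f (g i)))"
    and "(\<Sum>i\<in>I. scl V (a i) (g i)) \<in> carr V"
proof -
  interpret V: vector_space "scl V" using assms by (simp add: is_vs_def)
  interpret W: vector_space "scl W" using assms by (simp add: is_vs_def)
  have s: "V.subspace (carr V)" using assms by (simp add: is_vs_def)
  have z: "0 \<in> carr V" by (rule V.subspace_0[OF s])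
  have "f (0 + 0) = f 0 + f 0" using assms(3) z unfolding lin_def by blast
  then have f0: "f 0 = 0" by simp
  have "f (\<Sum>i\<in>I. scl V (a i) (g i)) = (\<Sum>i\<in>I. scl W (a i) (f (g i))) \<and>
        (\<Sum>i\<in>I. scl V (a i) (g i)) \<in> carr V"
    using assms(4,5)
  proof (induction I rule: finite_induct)
    case empty then show ?case using f0 z by simp
  next
    case (insert i I)
    have "scl V (a i) (g i) \<in> carr V" using insert.prems V.subspace_scale[OF s] by blast
    moreover have "f (scl V (a i) (g i)) = scl W (a i) (f (g i))"
      using assms(3) insert.prems unfolding lin_def by blast
    ultimately show ?case
      using insert assms(3) V.subspace_add[OF s] unfolding lin_def by simp
  qed
  then show "f (\<Sum>i\<in>I. scl V (a i) (g i)) = (\<Sum>i\<in>I. scl W (a i) (f (g i)))"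
    and "(\<Sum>i\<in>I. scl V (a i) (g i)) \<in> carr V" by auto
qed

lemma tlift_superset:
  assumes "is_vs Z" "finite S" "Poly_Mapping.keys t \<subseteq> S"
  shows "tlift Z f t = (\<Sum>p\<in>S. scl Z (Poly_Mapping.lookup t p) (f (fst p) (snd p)))"
proof -
  interpret vector_space "scl Z" using assms by (simp add: is_vs_def)
  show ?thesis unfolding tlift_def
    using assms(2,3) by (intro sum.mono_neutral_left) (auto simp: in_keys_iff)
qed

lemma tlift_lin:
  assumes "is_vs V" "is_vs W" "is_vs Z" "bilin V W Z f"
  shows "lin (V \<otimes>\<^sub>v W) Z (tlift Z f)"
proof -
  interpret vector_space "scl Z" using assms by (simp add: is_vs_def)
  have s: "subspace (carr Z)" using assms by (simp add: is_vs_def)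
  have 1: "tlift Z f t \<in> carr Z" if "t \<in> carr (V \<otimes>\<^sub>v W)" for t
    unfolding tlift_def
  proof (intro subspace_sum[OF s] subspace_scale[OF s])
    fix p assume "p \<in> Poly_Mapping.keys t"
    then have "fst p \<in> carr V" "snd p \<in> carr W"
      using keys_tensor[OF that] vbasis(1)[OF assms(1)] vbasis(1)[OF assms(2)] by blast+
    then show "f (fst p) (snd p) \<in> carr Z" using assms(4) unfolding bilin_def lin_def by blast
  qed
  have 2: "tlift Z f (t + u) = tlift Z f t + tlift Z f u" for t u
  proof -
    let ?S = "Poly_Mapping.keys t \<union> Poly_Mapping.keys u"
    show ?thesis
      using tlift_superset[OF assms(3), of ?S t f] tlift_superset[OF assms(3), of ?S u f]
        tlift_superset[OF assms(3), of ?S "t + u" f] Poly_Mapping.keys_add[of t u]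
      by (simp add: lookup_add scale_left_distrib sum.distrib)
  qed
  have 3: "tlift Z f (Poly_Mapping.map ((*) c) t) = scl Z c (tlift Z f t)" for c t
  proof -
    have "Poly_Mapping.keys (Poly_Mapping.map ((*) c) t) \<subseteq> Poly_Mapping.keys t"
      by (auto simp: in_keys_iff lookup_smult)
    then show ?thesis
      using tlift_superset[OF assms(3), of "Poly_Mapping.keys t" "Poly_Mapping.map ((*) c) t" f]
      by (simp add: lookup_smult tlift_def scale_sum_right)
  qed
  show ?thesis unfolding lin_def using 1 2 3 by (simp add: tensor_def)
qed

lemma tlift_tens:
  assumes "is_vs V" "is_vs W" "is_vs Z" "bilin V W Z f" "v \<in> carr V" "w \<in> carr W"
  shows "tlift Z f (tens V W v w) = f v w"
proof -
  interpret vector_space "scl Z" using assms by (simp add: is_vs_def)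
  let ?B = "{b. coord V v b \<noteq> 0}" and ?C = "{c. coord W w c \<noteq> 0}"
  have B: "b \<in> carr V" if "b \<in> ?B" for b
    using that coord_basis[OF assms(1)] vbasis(1)[OF assms(1)] by blast
  have C: "c \<in> carr W" if "c \<in> ?C" for c
    using that coord_basis[OF assms(2)] vbasis(1)[OF assms(2)] by blast
  have "tlift Z f (tens V W v w)
      = (\<Sum>b\<in>?B. \<Sum>c\<in>?C. scl Z (coord V v b * coord W w c) (f b c))"
    unfolding tlift_def keys_tens[OF assms(1,2)]
    by (subst sum.cartesian_product) (auto intro!: sum.cong simp: lookup_tens[OF assms(1,2)])
  also have "\<dots> = (\<Sum>b\<in>?B. scl Z (coord V v b) (\<Sum>c\<in>?C. scl Z (coord W w c) (f b c)))"
    by (simp add: scale_sum_right)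
  also have "\<dots> = (\<Sum>b\<in>?B. scl Z (coord V v b) (f b w))"
  proof (intro sum.cong refl)
    fix b assume b: "b \<in> ?B"
    then have l: "lin W Z (f b)" using assms(4) B unfolding bilin_def by blast
    have "f b w = f b (\<Sum>c\<in>?C. scl W (coord W w c) c)"
      by (simp add: coord_expand[OF assms(2,6)])
    also have "\<dots> = (\<Sum>c\<in>?C. scl Z (coord W w c) (f b c))"
      by (rule lin_sum(1)[OF assms(2,3) l coord_finite[OF assms(2)]]) (use C in auto)
    finally show "scl Z (coord V v b) (\<Sum>c\<in>?C. scl Z (coord W w c) (f b c))
        = scl Z (coord V v b) (f b w)" by simp
  qed
  also have "\<dots> = f (\<Sum>b\<in>?B. scl V (coord V v b) b) w"
  proof -
    have l: "lin V Z (\<lambda>x. f x w)" using assms(4,6) unfolding bilin_def by blast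
    show ?thesis
      by (rule lin_sum(1)[OF assms(1,3) l coord_finite[OF assms(1)], symmetric]) (use B in auto)
  qed
  also have "\<dots> = f v w" by (simp add: coord_expand[OF assms(1,5)])
  finally show ?thesis .
qed

lemma tensor_expand:
  assumes "is_vs V" "is_vs W" "t \<in> carr (V \<otimes>\<^sub>v W)"
  shows "t = (\<Sum>p\<in>Poly_Mapping.keys t.
           scl (V \<otimes>\<^sub>v W) (Poly_Mapping.lookup t p) (tens V W (fst p) (snd p)))"
proof (rule poly_mapping_eqI)
  fix q :: "'b \<times> 'd"
  obtain b c where q: "q = (b, c)" by force
  have "Poly_Mapping.lookup (\<Sum>p\<in>Poly_Mapping.keys t.
           scl (V \<otimes>\<^sub>v W) (Poly_Mapping.lookup t p) (tens V W (fst p) (snd p))) q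
      = (\<Sum>p\<in>Poly_Mapping.keys t. if p = q then Poly_Mapping.lookup t p else 0)"
    unfolding Poly_Mapping.lookup_sum
  proof (intro sum.cong refl)
    fix p assume "p \<in> Poly_Mapping.keys t"
    with keys_tensor[OF assms(3)] have "fst p \<in> vbasis V" "snd p \<in> vbasis W" by blast+
    then show "Poly_Mapping.lookup
         (scl (V \<otimes>\<^sub>v W) (Poly_Mapping.lookup t p) (tens V W (fst p) (snd p))) q
      = (if p = q then Poly_Mapping.lookup t p else 0)"
      by (auto simp: tensor_def lookup_smult q lookup_tens[OF assms(1,2)]
          coord_of_basis[OF assms(1)] coord_of_basis[OF assms(2)] prod_eq_iff)
  qed
  also have "\<dots> = Poly_Mapping.lookup t q" by (simp add: in_keys_iff)
  finally show "Poly_Mapping.lookup t q = Poly_Mapping.lookup (\<Sum>p\<in>Poly_Mapping.keys t.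
           scl (V \<otimes>\<^sub>v W) (Poly_Mapping.lookup t p) (tens V W (fst p) (snd p))) q" by simp
qed

lemma tensor_map_unique:
  assumes "is_vs V" "is_vs W" "is_vs Z" "lin (V \<otimes>\<^sub>v W) Z f" "lin (V \<otimes>\<^sub>v W) Z g"
    and "\<And>v w. v \<in> carr V \<Longrightarrow> w \<in> carr W \<Longrightarrow> f (tens V W v w) = g (tens V W v w)"
    and t: "t \<in> carr (V \<otimes>\<^sub>v W)"
  shows "f t = g t"
proof -
  have k: "fst p \<in> carr V" "snd p \<in> carr W" if "p \<in> Poly_Mapping.keys t" for p
    using keys_tensor[OF t that] vbasis(1)[OF assms(1)] vbasis(1)[OF assms(2)] by blast+
  note e = tensor_expand[OF assms(1,2) t]
  have "f t = (\<Sum>p\<in>Poly_Mapping.keys t.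
           scl Z (Poly_Mapping.lookup t p) (f (tens V W (fst p) (snd p))))"
    by (subst e, rule lin_sum(1)[OF tensor_is_vs assms(3,4)])
      (auto intro: tens_in[OF assms(1,2)])
  also have "\<dots> = (\<Sum>p\<in>Poly_Mapping.keys t.
           scl Z (Poly_Mapping.lookup t p) (g (tens V W (fst p) (snd p))))"
    using k assms(6) by simp
  also have "\<dots> = g t"
    by (subst (2) e, rule lin_sum(1)[OF tensor_is_vs assms(3,5), symmetric])
      (auto intro: tens_in[OF assms(1,2)])
  finally show ?thesis .
qed

record ('k, 'v) alg = "('k, 'v) vs" +
  mul :: "'v \<Rightarrow> 'v \<Rightarrow> 'v"
  one :: "'v"

record (overloaded) ('k::zero, 'v) bialg = "('k, 'v) alg" +
  comul :: "'v \<Rightarrow> ('v \<times> 'v) \<Rightarrow>\<^sub>0 'k"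
  counit :: "'v \<Rightarrow> 'k"

definition is_algebra :: "('k::field, 'v::ab_group_add, 'z) alg_scheme \<Rightarrow> bool" where
  "is_algebra A \<longleftrightarrow> is_vs A \<and> bilin A A A (mul A) \<and> one A \<in> carr A \<and>
     (\<forall>x\<in>carr A. \<forall>y\<in>carr A. \<forall>z\<in>carr A. mul A (mul A x y) z = mul A x (mul A y z)) \<and>
     (\<forall>x\<in>carr A. mul A (one A) x = x \<and> mul A x (one A) = x)"

definition is_coalgebra :: "('k::field, 'v::ab_group_add, 'z) bialg_scheme \<Rightarrow> bool" where
  "is_coalgebra C \<longleftrightarrow> is_vs C \<and> lin C (C \<otimes>\<^sub>v C) (comul C) \<and> lin C base_field (counit C) \<and>
     (\<forall>x\<in>carr C.
        tassoc C C C (tmap (C \<otimes>\<^sub>v C) C (comul C) id (comul C x))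
          = tmap C (C \<otimes>\<^sub>v C) id (comul C) (comul C x)) \<and>
     (\<forall>x\<in>carr C.
        tlift C (\<lambda>x1 x2. scl C (counit C x1) x2) (comul C x) = x \<and>
        tlift C (\<lambda>x1 x2. scl C (counit C x2) x1) (comul C x) = x)"

definition is_bialgebra :: "('k::field, 'h::ab_group_add, 'z) bialg_scheme \<Rightarrow> bool" where
  "is_bialgebra H \<longleftrightarrow> is_algebra H \<and> is_coalgebra H \<and>
     (\<forall>x\<in>carr H. \<forall>y\<in>carr H. comul H (mul H x y) =
        tlift (H \<otimes>\<^sub>v H) (\<lambda>x1 x2. tlift (H \<otimes>\<^sub>v H) (\<lambda>y1 y2.
          tens H H (mul H x1 y1) (mul H x2 y2)) (comul H y)) (comul H x)) \<and>
     comul H (one H) = tens H H (one H) (one H) \<and>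
     (\<forall>x\<in>carr H. \<forall>y\<in>carr H. counit H (mul H x y) = counit H x * counit H y) \<and>
     counit H (one H) = 1"

definition is_antipode :: "('k::field, 'h::ab_group_add, 'z) bialg_scheme \<Rightarrow> ('h \<Rightarrow> 'h) \<Rightarrow> bool" where
  "is_antipode H S \<longleftrightarrow> lin H H S \<and>
     (\<forall>x\<in>carr H.
        tlift H (\<lambda>x1 x2. mul H (S x1) x2) (comul H x) = scl H (counit H x) (one H) \<and>
        tlift H (\<lambda>x1 x2. mul H x1 (S x2)) (comul H x) = scl H (counit H x) (one H))"

definition hopf_algebra :: "('k::field, 'h::ab_group_add, 'z) bialg_scheme \<Rightarrow> bool" where
  "hopf_algebra H \<longleftrightarrow> is_bialgebra H \<and> (\<exists>S. is_antipode H S)"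

text \<open>
  Linear forms on \<open>H \<otimes> H\<close> are given as bilinear forms.  \<open>conv_inverse H r r'\<close> says that \<open>r'\<close> is
  inverse to \<open>r\<close> in the convolution algebra of linear forms on the coalgebra \<open>H \<otimes> H\<close>.
\<close>

definition conv2 ::
  "('k::field, 'h::ab_group_add, 'z) bialg_scheme \<Rightarrow> ('h \<Rightarrow> 'h \<Rightarrow> 'k) \<Rightarrow> ('h \<Rightarrow> 'h \<Rightarrow> 'k) \<Rightarrow> 'h \<Rightarrow> 'h \<Rightarrow> 'k"
where
  "conv2 H r s x y =
     tlift base_field (\<lambda>x1 x2. tlift base_field (\<lambda>y1 y2. r x1 y1 * s x2 y2) (comul H y)) (comul H x)"

definition conv_inverse ::
  "('k::field, 'h::ab_group_add, 'z) bialg_scheme \<Rightarrow> ('h \<Rightarrow> 'h \<Rightarrow> 'k) \<Rightarrow> ('h \<Rightarrow> 'h \<Rightarrow> 'k) \<Rightarrow> bool"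
where
  "conv_inverse H r r' \<longleftrightarrow> bilin H H base_field r' \<and>
     (\<forall>x\<in>carr H. \<forall>y\<in>carr H.
        conv2 H r r' x y = counit H x * counit H y \<and> conv2 H r' r x y = counit H x * counit H y)"

text \<open>
  In the first identity, \<open>x12\<close> stands for the left leg of \<open>\<Delta>(x)\<close>, which is expanded further to
  \<open>x1 \<otimes> x2\<close>.
\<close>

definition coquasitriangular ::
  "('k::field, 'h::ab_group_add, 'z) bialg_scheme \<Rightarrow> ('h \<Rightarrow> 'h \<Rightarrow> 'k) \<Rightarrow> bool"
where
  "coquasitriangular H r \<longleftrightarrow> hopf_algebra H \<and> bilin H H base_field r \<and>
     (\<exists>r'. conv_inverse H r r' \<and>
        (\<forall>x\<in>carr H. \<forall>y\<in>carr H. mul H y x =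
           tlift H (\<lambda>x12 x3. tlift H (\<lambda>x1 x2.
             tlift H (\<lambda>y12 y3. tlift H (\<lambda>y1 y2.
               scl H (r x1 y1 * r' x3 y3) (mul H x2 y2))
             (comul H y12)) (comul H y))
           (comul H x12)) (comul H x))) \<and>
     (\<forall>x\<in>carr H. \<forall>y\<in>carr H. \<forall>z\<in>carr H.
        r (mul H x y) z = tlift base_field (\<lambda>z1 z2. r x z1 * r y z2) (comul H z) \<and>
        r x (mul H y z) = tlift base_field (\<lambda>x1 x2. r x1 z * r x2 y) (comul H x))"

record (overloaded) ('k::zero, 'v, 'h) comod = "('k, 'v) vs" +
  coact :: "'v \<Rightarrow> ('v \<times> 'h) \<Rightarrow>\<^sub>0 'k"

definition is_comodule ::
  "('k::field, 'h::ab_group_add, 'z) bialg_scheme \<Rightarrow> ('k, 'v::ab_group_add, 'h, 'y) comod_scheme \<Rightarrow> bool"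
where
  "is_comodule H V \<longleftrightarrow> is_vs V \<and> lin V (V \<otimes>\<^sub>v H) (coact V) \<and>
     (\<forall>v\<in>carr V.
        tassoc V H H (tmap (V \<otimes>\<^sub>v H) H (coact V) id (coact V v))
          = tmap V (H \<otimes>\<^sub>v H) id (comul H) (coact V v)) \<and>
     (\<forall>v\<in>carr V. tlift V (\<lambda>v0 v1. scl V (counit H v1) v0) (coact V v) = v)"

definition colinear ::
  "('k::field, 'h::ab_group_add, 'z) bialg_scheme \<Rightarrow> ('k, 'v::ab_group_add, 'h, 'y) comod_scheme \<Rightarrow>
   ('k, 'w::ab_group_add, 'h, 'x) comod_scheme \<Rightarrow> ('v \<Rightarrow> 'w) \<Rightarrow> bool"
where
  "colinear H V W f \<longleftrightarrow> lin V W f \<and>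
     (\<forall>v\<in>carr V. coact W (f v) = tmap W H f id (coact V v))"

definition unit_comod :: "('k::field, 'h::ab_group_add, 'z) bialg_scheme \<Rightarrow> ('k, 'k, 'h) comod" where
  "unit_comod H = \<lparr>carr = carr base_field, scl = scl base_field,
     coact = (\<lambda>c. tens base_field H c (one H))\<rparr>"

definition tensor_comod ::
  "('k::field, 'h::ab_group_add, 'z) bialg_scheme \<Rightarrow> ('k, 'v::ab_group_add, 'h, 'y) comod_scheme \<Rightarrow>
   ('k, 'w::ab_group_add, 'h, 'x) comod_scheme \<Rightarrow> ('k, ('v \<times> 'w) \<Rightarrow>\<^sub>0 'k, 'h) comod"
where
  "tensor_comod H V W =
     (let T = (V \<otimes>\<^sub>v W) \<otimes>\<^sub>v H in
      \<lparr>carr = carr (V \<otimes>\<^sub>v W), scl = scl (V \<otimes>\<^sub>v W),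
       coact = tlift T (\<lambda>v w. tlift T (\<lambda>v0 v1. tlift T (\<lambda>w0 w1.
         tens (V \<otimes>\<^sub>v W) H (tens V W v0 w0) (mul H v1 w1)) (coact W w)) (coact V v))\<rparr>)"

definition braiding ::
  "('h \<Rightarrow> 'h \<Rightarrow> 'k::field) \<Rightarrow> ('k, 'v::ab_group_add, 'h, 'y) comod_scheme \<Rightarrow>
   ('k, 'w::ab_group_add, 'h, 'x) comod_scheme \<Rightarrow> (('v \<times> 'w) \<Rightarrow>\<^sub>0 'k) \<Rightarrow> (('w \<times> 'v) \<Rightarrow>\<^sub>0 'k)"
where
  "braiding r V W =
     (let T = W \<otimes>\<^sub>v V in
      tlift T (\<lambda>v w. tlift T (\<lambda>v0 v1. tlift T (\<lambda>w0 w1.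
        scl T (r v1 w1) (tens W V w0 v0)) (coact W w)) (coact V v)))"

text \<open>
  An algebra and coalgebra together with a coaction; \<open>comod_of\<close> is its underlying comodule.
\<close>

record (overloaded) ('k::zero, 'v, 'h) cobialg = "('k, 'v) bialg" +
  coaction :: "'v \<Rightarrow> ('v \<times> 'h) \<Rightarrow>\<^sub>0 'k"

definition comod_of :: "('k::zero, 'v, 'h, 'z) cobialg_scheme \<Rightarrow> ('k, 'v, 'h) comod" where
  "comod_of A = \<lparr>carr = carr A, scl = scl A, coact = coaction A\<rparr>"

text \<open>
  Multiplication of \<open>A \<otimes>\<^sub>c A\<close>, i.e. \<open>(m \<otimes> m) \<circ> (id \<otimes> c \<otimes> id)\<close>: here \<open>p \<otimes> q\<close> runs through the
  tensor \<open>c(b \<otimes> a')\<close>.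
\<close>

definition braided_mul ::
  "('h \<Rightarrow> 'h \<Rightarrow> 'k::field) \<Rightarrow> ('k, 'a::ab_group_add, 'h, 'z) cobialg_scheme \<Rightarrow>
   (('a \<times> 'a) \<Rightarrow>\<^sub>0 'k) \<Rightarrow> (('a \<times> 'a) \<Rightarrow>\<^sub>0 'k) \<Rightarrow> (('a \<times> 'a) \<Rightarrow>\<^sub>0 'k)"
where
  "braided_mul r A s t =
     tlift (A \<otimes>\<^sub>v A) (\<lambda>a b. tlift (A \<otimes>\<^sub>v A) (\<lambda>a' b'. tlift (A \<otimes>\<^sub>v A) (\<lambda>p q.
       tens A A (mul A a p) (mul A q b'))
     (braiding r (comod_of A) (comod_of A) (tens A A b a'))) t) s"

definition braided_hopf_algebra ::
  "('k::field, 'h::ab_group_add, 'z) bialg_scheme \<Rightarrow> ('h \<Rightarrow> 'h \<Rightarrow> 'k) \<Rightarrow>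
   ('k, 'a::ab_group_add, 'h, 'y) cobialg_scheme \<Rightarrow> bool"
where
  "braided_hopf_algebra H r A \<longleftrightarrow>
     (let C = comod_of A; I = unit_comod H in
      is_comodule H C \<and>
      is_algebra A \<and> colinear H (tensor_comod H C C) C (tlift A (mul A)) \<and>
      colinear H I C (\<lambda>c. scl A c (one A)) \<and>
      is_coalgebra A \<and> colinear H C (tensor_comod H C C) (comul A) \<and>
      colinear H C I (counit A) \<and>
      (\<forall>x\<in>carr A. \<forall>y\<in>carr A. comul A (mul A x y) = braided_mul r A (comul A x) (comul A y)) \<and>
      comul A (one A) = tens A A (one A) (one A) \<and>
      (\<forall>x\<in>carr A. \<forall>y\<in>carr A. counit A (mul A x y) = counit A x * counit A y) \<and>
      counit A (one A) = 1 \<and>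
      (\<exists>S. is_antipode A S \<and> colinear H C C S))"

text \<open>Objects and morphisms of the category of left \<open>A\<close>-modules in right \<open>H\<close>-comodules.\<close>

record (overloaded) ('k::zero, 'v, 'h, 'a) rmod = "('k, 'v, 'h) comod" +
  act :: "'a \<Rightarrow> 'v \<Rightarrow> 'v"

definition is_rmod ::
  "('k::field, 'h::ab_group_add, 'z) bialg_scheme \<Rightarrow> ('k, 'a::ab_group_add, 'h, 'y) cobialg_scheme \<Rightarrow>
   ('k, 'v::ab_group_add, 'h, 'a) rmod \<Rightarrow> bool"
where
  "is_rmod H A M \<longleftrightarrow> is_comodule H M \<and> bilin A M M (act M) \<and>
     (\<forall>a\<in>carr A. \<forall>b\<in>carr A. \<forall>v\<in>carr M. act M (mul A a b) v = act M a (act M b v)) \<and>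
     (\<forall>v\<in>carr M. act M (one A) v = v) \<and>
     (\<forall>a\<in>carr A. \<forall>v\<in>carr M. coact M (act M a v) =
        tlift (M \<otimes>\<^sub>v H) (\<lambda>a0 a1. tlift (M \<otimes>\<^sub>v H) (\<lambda>v0 v1.
          tens M H (act M a0 v0) (mul H a1 v1)) (coact M v)) (coaction A a))"

definition rmod_hom ::
  "('k::field, 'h::ab_group_add, 'z) bialg_scheme \<Rightarrow> ('k, 'a::ab_group_add, 'h, 'y) cobialg_scheme \<Rightarrow>
   ('k, 'v::ab_group_add, 'h, 'a) rmod \<Rightarrow> ('k, 'w::ab_group_add, 'h, 'a) rmod \<Rightarrow> ('v \<Rightarrow> 'w) \<Rightarrow> bool"
where
  "rmod_hom H A M N f \<longleftrightarrow> colinear H M N f \<and>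
     (\<forall>a\<in>carr A. \<forall>v\<in>carr M. f (act M a v) = act N a (f v))"

definition rmod_iso ::
  "('k::field, 'h::ab_group_add, 'z) bialg_scheme \<Rightarrow> ('k, 'a::ab_group_add, 'h, 'y) cobialg_scheme \<Rightarrow>
   ('k, 'v::ab_group_add, 'h, 'a) rmod \<Rightarrow> ('k, 'w::ab_group_add, 'h, 'a) rmod \<Rightarrow> bool"
where
  "rmod_iso H A M N \<longleftrightarrow> (\<exists>f g. rmod_hom H A M N f \<and> rmod_hom H A N M g \<and>
     (\<forall>x\<in>carr M. g (f x) = x) \<and> (\<forall>y\<in>carr N. f (g y) = y))"

definition internal_direct_sum :: "'v::ab_group_add set \<Rightarrow> 'v set \<Rightarrow> 'v set \<Rightarrow> bool" where
  "internal_direct_sum X Y M \<longleftrightarrow> X \<inter> Y = {0} \<and> M = {x + y | x y. x \<in> X \<and> y \<in> Y}"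

text \<open>A subobject is an object for which the inclusion is a morphism.\<close>

definition rmod_summand ::
  "('k::field, 'h::ab_group_add, 'z) bialg_scheme \<Rightarrow> ('k, 'a::ab_group_add, 'h, 'y) cobialg_scheme \<Rightarrow>
   ('k, 'v::ab_group_add, 'h, 'a) rmod \<Rightarrow> ('k, 'v, 'h, 'a) rmod \<Rightarrow> bool"
where
  "rmod_summand H A N M \<longleftrightarrow> is_rmod H A N \<and> rmod_hom H A N M id \<and>
     (\<exists>N'. is_rmod H A N' \<and> rmod_hom H A N' M id \<and>
           internal_direct_sum (carr N) (carr N') (carr M))"

text \<open>The object \<open>A \<otimes> V\<close>: tensor product coaction, left multiplication on the factor \<open>A\<close>.\<close>

definition free_rmod ::
  "('k::field, 'h::ab_group_add, 'z) bialg_scheme \<Rightarrow> ('k, 'a::ab_group_add, 'h, 'y) cobialg_scheme \<Rightarrow>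
   ('k, 'v::ab_group_add, 'h) comod \<Rightarrow> ('k, ('a \<times> 'v) \<Rightarrow>\<^sub>0 'k, 'h, 'a) rmod"
where
  "free_rmod H A V =
     (let F = tensor_comod H (comod_of A) V in
      \<lparr>carr = carr F, scl = scl F, coact = coact F,
       act = (\<lambda>a. tmap A V (mul A a) id)\<rparr>)"

definition trivial_rmod ::
  "('k::field, 'h::ab_group_add, 'z) bialg_scheme \<Rightarrow> ('k, 'a::ab_group_add, 'h, 'y) cobialg_scheme \<Rightarrow>
   ('k, 'k, 'h, 'a) rmod"
where
  "trivial_rmod H A =
     \<lparr>carr = carr (unit_comod H), scl = scl (unit_comod H), coact = coact (unit_comod H),
      act = (\<lambda>a x. counit A a * x)\<rparr>"

text \<open>
  The comodule \<open>V\<close> is sought in the type passed as a type token.  A theorem with this as a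
  hypothesis and \<open>'v\<close> as a type variable covers all comodules; the same holds for the type \<open>'p\<close>
  of the terms of the resolution in \<open>type_FP\<close>.
\<close>

definition finite_rel_projective ::
  "'v::ab_group_add itself \<Rightarrow> ('k::field, 'h::ab_group_add, 'z) bialg_scheme \<Rightarrow>
   ('k, 'a::ab_group_add, 'h, 'y) cobialg_scheme \<Rightarrow> ('k, 'p::ab_group_add, 'h, 'a) rmod \<Rightarrow> bool"
where
  "finite_rel_projective _ H A P \<longleftrightarrow> is_rmod H A P \<and>
     (\<exists>(V :: ('k, 'v, 'h) comod) Q. is_comodule H V \<and> finite_dim V \<and>
        rmod_summand H A Q (free_rmod H A V) \<and> rmod_iso H A P Q)"

text \<open>
  Exactness of \<open>0 \<rightarrow> P\<^sub>n \<rightarrow> \<dots> \<rightarrow> P\<^sub>0 \<rightarrow> M \<rightarrow> 0\<close>, for additive maps \<open>d i\<close> from \<open>P (Suc i)\<close> to \<open>P i\<close>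
  (\<open>i < n\<close>) and \<open>e\<close> from \<open>P 0\<close> to \<open>M\<close>.
\<close>

definition exact_sequence ::
  "nat \<Rightarrow> (nat \<Rightarrow> 'p::ab_group_add set) \<Rightarrow> (nat \<Rightarrow> 'p \<Rightarrow> 'p) \<Rightarrow> ('p \<Rightarrow> 'm::ab_group_add) \<Rightarrow> 'm set \<Rightarrow> bool"
where
  "exact_sequence n P d e M \<longleftrightarrow>
     e ` P 0 = M \<and>
     {x \<in> P 0. e x = 0} = (if n = 0 then {0} else d 0 ` P 1) \<and>
     (\<forall>i<n. {x \<in> P (Suc i). d i x = 0} =
              (if Suc i = n then {0} else d (Suc i) ` P (Suc (Suc i))))"

definition type_FP ::
  "'p::ab_group_add itself \<Rightarrow> 'v::ab_group_add itself \<Rightarrow> ('k::field, 'h::ab_group_add, 'z) bialg_scheme \<Rightarrow>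
   ('k, 'a::ab_group_add, 'h, 'y) cobialg_scheme \<Rightarrow> ('k, 'm::ab_group_add, 'h, 'a) rmod \<Rightarrow> bool"
where
  "type_FP _ v H A M \<longleftrightarrow> is_rmod H A M \<and>
     (\<exists>n (P :: nat \<Rightarrow> ('k, 'p, 'h, 'a) rmod) d e.
        (\<forall>i\<le>n. finite_rel_projective v H A (P i)) \<and>
        (\<forall>i<n. rmod_hom H A (P (Suc i)) (P i) (d i)) \<and>
        rmod_hom H A (P 0) M e \<and>
        exact_sequence n (\<lambda>i. carr (P i)) d e (carr M))"

record ('k, 'v, 'a) bimod = "('k, 'v) vs" +
  lact :: "'a \<Rightarrow> 'v \<Rightarrow> 'v"
  ract :: "'v \<Rightarrow> 'a \<Rightarrow> 'v"

definition is_bimod ::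
  "('k::field, 'a::ab_group_add, 'z) alg_scheme \<Rightarrow> ('k, 'v::ab_group_add, 'a) bimod \<Rightarrow> bool"
where
  "is_bimod A M \<longleftrightarrow> is_vs M \<and> bilin A M M (lact M) \<and> bilin M A M (ract M) \<and>
     (\<forall>a\<in>carr A. \<forall>b\<in>carr A. \<forall>v\<in>carr M.
        lact M (mul A a b) v = lact M a (lact M b v) \<and>
        ract M v (mul A a b) = ract M (ract M v a) b \<and>
        ract M (lact M a v) b = lact M a (ract M v b)) \<and>
     (\<forall>v\<in>carr M. lact M (one A) v = v \<and> ract M v (one A) = v)"

definition bimod_hom ::
  "('k::field, 'a::ab_group_add, 'z) alg_scheme \<Rightarrow> ('k, 'v::ab_group_add, 'a) bimod \<Rightarrow>
   ('k, 'w::ab_group_add, 'a) bimod \<Rightarrow> ('v \<Rightarrow> 'w) \<Rightarrow> bool"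
where
  "bimod_hom A M N f \<longleftrightarrow> lin M N f \<and>
     (\<forall>a\<in>carr A. \<forall>v\<in>carr M. f (lact M a v) = lact N a (f v) \<and> f (ract M v a) = ract N (f v) a)"

definition bimod_iso ::
  "('k::field, 'a::ab_group_add, 'z) alg_scheme \<Rightarrow> ('k, 'v::ab_group_add, 'a) bimod \<Rightarrow>
   ('k, 'w::ab_group_add, 'a) bimod \<Rightarrow> bool"
where
  "bimod_iso A M N \<longleftrightarrow> (\<exists>f g. bimod_hom A M N f \<and> bimod_hom A N M g \<and>
     (\<forall>x\<in>carr M. g (f x) = x) \<and> (\<forall>y\<in>carr N. f (g y) = y))"

definition bimod_summand ::
  "('k::field, 'a::ab_group_add, 'z) alg_scheme \<Rightarrow> ('k, 'v::ab_group_add, 'a) bimod \<Rightarrow>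
   ('k, 'v, 'a) bimod \<Rightarrow> bool"
where
  "bimod_summand A N M \<longleftrightarrow> is_bimod A N \<and> bimod_hom A N M id \<and>
     (\<exists>N'. is_bimod A N' \<and> bimod_hom A N' M id \<and>
           internal_direct_sum (carr N) (carr N') (carr M))"

definition regular_bimod :: "('k, 'a, 'z) alg_scheme \<Rightarrow> ('k, 'a, 'a) bimod" where
  "regular_bimod A = \<lparr>carr = carr A, scl = scl A, lact = mul A, ract = mul A\<rparr>"

text \<open>
  The free bimodule \<open>(A \<otimes> A)\<^sup>m\<close> with the outer actions; its elements are the families of elements
  of \<open>A \<otimes> A\<close> indexed by the natural numbers that vanish outside \<open>{..<m}\<close>.
\<close>

definition free_bimod ::
  "('k::field, 'a::ab_group_add, 'z) alg_scheme \<Rightarrow> nat \<Rightarrow> ('k, nat \<Rightarrow>\<^sub>0 (('a \<times> 'a) \<Rightarrow>\<^sub>0 'k), 'a) bimod"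
where
  "free_bimod A m =
     \<lparr>carr = {f. Poly_Mapping.keys f \<subseteq> {..<m} \<and> (\<forall>i. Poly_Mapping.lookup f i \<in> carr (A \<otimes>\<^sub>v A))},
      scl = (\<lambda>c. Poly_Mapping.map (scl (A \<otimes>\<^sub>v A) c)),
      lact = (\<lambda>a. Poly_Mapping.map (tmap A A (mul A a) id)),
      ract = (\<lambda>f b. Poly_Mapping.map (tmap A A id (\<lambda>y. mul A y b)) f)\<rparr>"

definition fg_projective_bimod ::
  "('k::field, 'a::ab_group_add, 'z) alg_scheme \<Rightarrow> ('k, 'p::ab_group_add, 'a) bimod \<Rightarrow> bool"
where
  "fg_projective_bimod A P \<longleftrightarrow> is_bimod A P \<and>
     (\<exists>m Q. bimod_summand A Q (free_bimod A m) \<and> bimod_iso A P Q)"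

text \<open>
  The terms of the resolution are sought in the ambient type of the bimodules \<open>free_bimod A m\<close>.
  This is no restriction, since every finitely generated projective bimodule is isomorphic to
  one there.
\<close>

definition smooth_algebra :: "('k::field, 'a::ab_group_add, 'z) alg_scheme \<Rightarrow> bool" where
  "smooth_algebra A \<longleftrightarrow> is_algebra A \<and>
     (\<exists>n (P :: nat \<Rightarrow> ('k, nat \<Rightarrow>\<^sub>0 (('a \<times> 'a) \<Rightarrow>\<^sub>0 'k), 'a) bimod) d e.
        (\<forall>i\<le>n. fg_projective_bimod A (P i)) \<and>
        (\<forall>i<n. bimod_hom A (P (Suc i)) (P i) (d i)) \<and>
        bimod_hom A (P 0) (regular_bimod A) e \<and>
        exact_sequence n (\<lambda>i. carr (P i)) d e (carr A))"

end

theory Submission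
  imports Defs
begin

text \<open>
  For an object \<open>M\<close> of the category of \<open>A\<close>-modules in \<open>H\<close>-comodules, the space \<open>M \<otimes> A\<close> is an
  \<open>A\<close>-bimodule: on the right \<open>A\<close> multiplies the second factor, and on the left it acts on the braided
  tensor product \<open>M \<otimes> A\<close> through the comultiplication.  This functor is exact, being a tensor product
  over a field, and it takes the trivial module to \<open>A\<close>.  It takes \<open>A \<otimes> V\<close> to
  \<open>(A \<otimes> V) \<otimes> A\<close>, which is the free bimodule \<open>A \<otimes> V \<otimes> A\<close> with the outer actions: the bimodule map
  \<open>a \<otimes> v \<otimes> c \<mapsto> a (1 \<otimes> v \<otimes> c)\<close> sends \<open>a \<otimes> w\<close> to \<open>a\<^sub>1 \<otimes> a\<^sub>2 w\<close>, where \<open>w = v \<otimes> c\<close> and \<open>A\<close> acts on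
  \<open>V \<otimes> A\<close> by braiding past \<open>V\<close> and multiplying, so that \<open>a \<otimes> w \<mapsto> a\<^sub>1 \<otimes> S(a\<^sub>2) w\<close> is its inverse.
  Hence a finite resolution of the trivial module by finite relative projectives becomes a finite
  resolution of \<open>A\<close> by finitely generated projective bimodules.
\<close>

section \<open>Calculus with tensors\<close>

text \<open>Triple tensor products and their associators are kept out of the computations. A map out
  of A \<otimes> V \<otimes> A is a trilinear F into an arbitrary space, and an identity of tensors
  is stated after applying F. Coassociativity and the braiding then become rearrangements of nested
  finite sums.

  The inverse pair consists of the shears with the identity and with S. They cancel because braiding
  a product past m is braiding its factors one after the other, so two consecutive shears merge into
  one braiding of a convolution product, which the antipode turns into the unit. Left linearity of
  the inverse then comes from that of the forward map by conjugation.

  For a summand P of A \<otimes> V the isomorphism is used in dual basis form: a finite basis of V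
  gives generators of P \<otimes> A and bimodule maps P \<otimes> A \<rightarrow> A \<otimes> A,
  which together exhibit P \<otimes> A as a retract of a finite free bimodule. The retract also
  settles a matter of types: the spaces P \<otimes> A live in a different type from the one in which
  the resolution is sought, and the images of the splittings are copies of them in the right
  one.\<close>

lemma vs_zero: "is_vs V \<Longrightarrow> 0 \<in> carr V"
  unfolding is_vs_def by (metis module.subspace_0 module_iff_vector_space)

lemma vs_add: "is_vs V \<Longrightarrow> x \<in> carr V \<Longrightarrow> y \<in> carr V \<Longrightarrow> x + y \<in> carr V"
  unfolding is_vs_def by (metis module.subspace_add module_iff_vector_space)

lemma vs_scl: "is_vs V \<Longrightarrow> x \<in> carr V \<Longrightarrow> scl V c x \<in> carr V"
  unfolding is_vs_def by (metis module.subspace_scale module_iff_vector_space)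

lemma vs_sum: "is_vs V \<Longrightarrow> (\<And>i. i \<in> I \<Longrightarrow> f i \<in> carr V) \<Longrightarrow> (\<Sum>i\<in>I. f i) \<in> carr V"
  unfolding is_vs_def by (metis module.subspace_sum module_iff_vector_space)

lemma scl_one: "is_vs V \<Longrightarrow> scl V 1 x = x"
  unfolding is_vs_def by (metis module.scale_one module_iff_vector_space)

lemma scl_scl: "is_vs V \<Longrightarrow> scl V a (scl V b x) = scl V (a * b) x"
  unfolding is_vs_def by (metis module.scale_scale module_iff_vector_space)

lemma scl_add_right: "is_vs V \<Longrightarrow> scl V c (x + y) = scl V c x + scl V c y"
  unfolding is_vs_def by (metis module.scale_right_distrib module_iff_vector_space)

lemma scl_add_left: "is_vs V \<Longrightarrow> scl V (c + d) x = scl V c x + scl V d x"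
  unfolding is_vs_def by (metis module.scale_left_distrib module_iff_vector_space)

lemma scl_zero_right: "is_vs V \<Longrightarrow> scl V c 0 = 0"
  unfolding is_vs_def by (metis module.scale_zero_right module_iff_vector_space)

lemma scl_sum_right: "is_vs V \<Longrightarrow> scl V c (\<Sum>i\<in>I. f i) = (\<Sum>i\<in>I. scl V c (f i))"
  unfolding is_vs_def by (metis module.scale_sum_right module_iff_vector_space)

lemma base_field_is_vs: "is_vs base_field"
  unfolding is_vs_def base_field_def
  by (auto simp: vector_space_def algebra_simps module.subspace_def module_def)

lemma base_field_simps [simp]: "carr base_field = UNIV" "scl base_field = (*)"
  by (simp_all add: base_field_def)

section \<open>Linear, bilinear and trilinear maps\<close>

lemma lin_in: "lin V W f \<Longrightarrow> x \<in> carr V \<Longrightarrow> f x \<in> carr W"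
  by (simp add: lin_def)

lemma lin_add: "lin V W f \<Longrightarrow> x \<in> carr V \<Longrightarrow> y \<in> carr V \<Longrightarrow> f (x + y) = f x + f y"
  by (simp add: lin_def)

lemma lin_scl: "lin V W f \<Longrightarrow> x \<in> carr V \<Longrightarrow> f (scl V c x) = scl W c (f x)"
  by (simp add: lin_def)

lemma lin_0: "is_vs V \<Longrightarrow> lin V W f \<Longrightarrow> f 0 = 0"
  by (metis vs_zero add_cancel_right_right lin_add)

lemma lin_setsum:
  assumes "is_vs V" "lin V W f" "finite I" "\<And>i. i \<in> I \<Longrightarrow> g i \<in> carr V"
  shows "f (\<Sum>i\<in>I. g i) = (\<Sum>i\<in>I. f (g i))"
  using assms(3,4)
proof (induction I rule: finite_induct)
  case empty then show ?case using lin_0[OF assms(1,2)] by simp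
next
  case (insert i I)
  then show ?case by (simp add: lin_add[OF assms(2)] vs_sum[OF assms(1)])
qed

lemma lin_ident: "lin V V (\<lambda>x. x)"
  by (simp add: lin_def)

lemma lin_id: "lin V V id"
  by (simp add: lin_def)

lemma lin_comp: "lin V W f \<Longrightarrow> lin U V g \<Longrightarrow> lin U W (\<lambda>x. f (g x))"
  by (simp add: lin_def)

lemma lin_scale: "is_vs Z \<Longrightarrow> lin X Z g \<Longrightarrow> lin X Z (\<lambda>x. scl Z c (g x))"
  by (simp add: lin_def vs_scl scl_add_right scl_scl mult.commute)

lemma lin_scale_left:
  assumes "is_vs Z" "lin X base_field g" "z \<in> carr Z"
  shows "lin X Z (\<lambda>x. scl Z (g x) z)"
  using assms by (simp add: lin_def vs_scl scl_add_left scl_scl)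

lemma bilinI:
  assumes "\<And>u. u \<in> carr U \<Longrightarrow> lin V W (\<lambda>v. f u v)" "\<And>v. v \<in> carr V \<Longrightarrow> lin U W (\<lambda>u. f u v)"
  shows "bilin U V W f"
  using assms by (simp add: bilin_def)

lemma bilin_in: "bilin U V W f \<Longrightarrow> u \<in> carr U \<Longrightarrow> v \<in> carr V \<Longrightarrow> f u v \<in> carr W"
  unfolding bilin_def lin_def by blast

lemma bilin_lin1: "bilin U V W f \<Longrightarrow> lin X U g \<Longrightarrow> v \<in> carr V \<Longrightarrow> lin X W (\<lambda>x. f (g x) v)"
  unfolding bilin_def lin_def by simp

lemma bilin_lin2: "bilin U V W f \<Longrightarrow> u \<in> carr U \<Longrightarrow> lin X V g \<Longrightarrow> lin X W (\<lambda>x. f u (g x))"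
  unfolding bilin_def lin_def by simp

definition trilin ::
  "('k::field, 'u::ab_group_add, 'x) vs_scheme \<Rightarrow> ('k, 'v::ab_group_add, 'z) vs_scheme \<Rightarrow>
   ('k, 'w::ab_group_add, 'y) vs_scheme \<Rightarrow> ('k, 't::ab_group_add, 's) vs_scheme \<Rightarrow>
   ('u \<Rightarrow> 'v \<Rightarrow> 'w \<Rightarrow> 't) \<Rightarrow> bool"
where
  "trilin U V W Z f \<longleftrightarrow> (\<forall>u\<in>carr U. bilin V W Z (f u)) \<and>
     (\<forall>v\<in>carr V. \<forall>w\<in>carr W. lin U Z (\<lambda>u. f u v w))"

lemma trilinI:
  assumes "\<And>v w. v \<in> carr V \<Longrightarrow> w \<in> carr W \<Longrightarrow> lin U Z (\<lambda>u. f u v w)"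
    "\<And>u w. u \<in> carr U \<Longrightarrow> w \<in> carr W \<Longrightarrow> lin V Z (\<lambda>v. f u v w)"
    "\<And>u v. u \<in> carr U \<Longrightarrow> v \<in> carr V \<Longrightarrow> lin W Z (\<lambda>w. f u v w)"
  shows "trilin U V W Z f"
  using assms by (simp add: trilin_def bilin_def)

lemma trilin_in:
  "trilin U V W Z f \<Longrightarrow> u \<in> carr U \<Longrightarrow> v \<in> carr V \<Longrightarrow> w \<in> carr W \<Longrightarrow> f u v w \<in> carr Z"
  unfolding trilin_def bilin_def lin_def by blast

lemma trilin_lin1:
  "trilin U V W Z f \<Longrightarrow> lin X U g \<Longrightarrow> v \<in> carr V \<Longrightarrow> w \<in> carr W \<Longrightarrow> lin X Z (\<lambda>x. f (g x) v w)"
  unfolding trilin_def bilin_def lin_def by simp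

lemma trilin_lin2:
  "trilin U V W Z f \<Longrightarrow> u \<in> carr U \<Longrightarrow> lin X V g \<Longrightarrow> w \<in> carr W \<Longrightarrow> lin X Z (\<lambda>x. f u (g x) w)"
  unfolding trilin_def bilin_def lin_def by simp

lemma trilin_lin3:
  "trilin U V W Z f \<Longrightarrow> u \<in> carr U \<Longrightarrow> v \<in> carr V \<Longrightarrow> lin X W g \<Longrightarrow> lin X Z (\<lambda>x. f u v (g x))"
  unfolding trilin_def bilin_def lin_def by simp

section \<open>Nested Sweedler sums\<close>

lemma keys_carr:
  assumes "is_vs V" "is_vs W" "t \<in> carr (V \<otimes>\<^sub>v W)" "p \<in> Poly_Mapping.keys t"
  shows "fst p \<in> carr V" "snd p \<in> carr W"
  using keys_tensor[OF assms(3,4)] vbasis(1)[OF assms(1)] vbasis(1)[OF assms(2)] by blast+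

text \<open>The support of \<open>t\<close> consists of pairs of chosen basis vectors, so agreement
  on the carriers is enough. This is how membership hypotheses become available under a Sweedler
  sum.\<close>

lemma tlift_cong:
  assumes "t \<in> carr (V \<otimes>\<^sub>v W)" "is_vs V" "is_vs W"
    and "\<And>v w. v \<in> carr V \<Longrightarrow> w \<in> carr W \<Longrightarrow> f v w = g v w"
  shows "tlift Z f t = tlift Z g t"
  unfolding tlift_def using keys_carr[OF assms(2,3,1)] assms(4) by (auto intro!: sum.cong)

lemma tlift_in:
  assumes "t \<in> carr (V \<otimes>\<^sub>v W)" "is_vs V" "is_vs W" "is_vs Z"
    and "\<And>v w. v \<in> carr V \<Longrightarrow> w \<in> carr W \<Longrightarrow> f v w \<in> carr Z"
  shows "tlift Z f t \<in> carr Z"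
  unfolding tlift_def using keys_carr[OF assms(2,3,1)] assms(5)
  by (auto intro!: vs_sum[OF assms(4)] vs_scl[OF assms(4)])

text \<open>Fubini for two independent Sweedler sums: neither tensor depends on the legs of the
  other.\<close>

lemma tlift_swap:
  assumes "is_vs Z"
  shows "tlift Z (\<lambda>x y. tlift Z (\<lambda>u v. f x y u v) s) t = tlift Z (\<lambda>u v. tlift Z (\<lambda>x y. f x y u v) t) s"
proof -
  show ?thesis unfolding tlift_def scl_sum_right[OF assms] scl_scl[OF assms]
    by (subst sum.swap) (simp add: mult.commute)
qed

lemma lin_tlift:
  assumes "lin Y Z g" "is_vs V" "is_vs W" "is_vs Y" "is_vs Z" "t \<in> carr (V \<otimes>\<^sub>v W)"
    and "\<And>v w. v \<in> carr V \<Longrightarrow> w \<in> carr W \<Longrightarrow> f v w \<in> carr Y"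
  shows "g (tlift Y f t) = tlift Z (\<lambda>v w. g (f v w)) t"
  unfolding tlift_def using assms keys_carr[OF assms(2,3,6)]
  by (subst lin_sum(1)[OF assms(4,5,1)]) auto

lemma scl_tlift: "is_vs Z \<Longrightarrow> scl Z c (tlift Z f t) = tlift Z (\<lambda>v w. scl Z c (f v w)) t"
  unfolding tlift_def by (simp add: scl_sum_right scl_scl mult.commute)

text \<open>A Sweedler sum can depend on x through its summands or through the tensor that is
  expanded. This rule covers the first case and \<open>lin_tlift_arg\<close> the second; used
  together as introduction rules they derive multilinearity of a nested sum from its syntax.\<close>

lemma lin_tlift_body:
  assumes "t \<in> carr (V \<otimes>\<^sub>v W)" "is_vs V" "is_vs W" "is_vs Z"
    and "\<And>v w. v \<in> carr V \<Longrightarrow> w \<in> carr W \<Longrightarrow> lin X Z (\<lambda>x. f x v w)"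
  shows "lin X Z (\<lambda>x. tlift Z (\<lambda>v w. f x v w) t)"
proof -
  note k = keys_carr[OF assms(2,3,1)]
  have l: "lin X Z (\<lambda>x. f x (fst p) (snd p))" if "p \<in> Poly_Mapping.keys t" for p
    using assms(5) k[OF that] by blast
  show ?thesis
    unfolding lin_def
  proof (intro conjI ballI allI)
    show "tlift Z (f x) t \<in> carr Z" if "x \<in> carr X" for x
      using assms(5) that lin_in by (intro tlift_in[OF assms(1-4)]) fastforce
    show "tlift Z (f (x + y)) t = tlift Z (f x) t + tlift Z (f y) t"
      if "x \<in> carr X" "y \<in> carr X" for x y
      unfolding tlift_def sum.distrib[symmetric]
      by (rule sum.cong[OF refl]) (simp add: lin_add[OF l that] scl_add_right[OF assms(4)])
    show "tlift Z (f (scl X c x)) t = scl Z c (tlift Z (f x) t)" if "x \<in> carr X" for c x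
      unfolding tlift_def scl_sum_right[OF assms(4)]
      by (rule sum.cong[OF refl]) (simp add: lin_scl[OF l that] scl_scl[OF assms(4)] mult.commute)
  qed
qed

lemma lin_tlift_arg:
  assumes "lin X (V \<otimes>\<^sub>v W) g" "is_vs V" "is_vs W" "is_vs Z" "bilin V W Z f"
  shows "lin X Z (\<lambda>x. tlift Z f (g x))"
  by (rule lin_comp[OF tlift_lin[OF assms(2-5)] assms(1)])

lemma tmap_lin:
  assumes "is_vs V" "is_vs W" "is_vs V'" "is_vs W'" "lin V V' f" "lin W W' g"
  shows "lin (V \<otimes>\<^sub>v W) (V' \<otimes>\<^sub>v W') (tmap V' W' f g)"
  unfolding tmap_def
  by (rule tlift_lin[OF assms(1,2) tensor_is_vs], rule bilinI)
    (assumption | rule bilin_lin1[OF tens_bilin] bilin_lin2[OF tens_bilin] lin_in[OF assms(5)] lin_in[OF assms(6)] assms)+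

lemma tlift_tmap:
  assumes "t \<in> carr (V \<otimes>\<^sub>v W)" "is_vs V" "is_vs W" "is_vs V'" "is_vs W'" "is_vs Z"
    and "lin V V' g" "lin W W' h" "bilin V' W' Z f"
  shows "tlift Z f (tmap V' W' g h t) = tlift Z (\<lambda>v w. f (g v) (h w)) t"
  unfolding tmap_def
  by (subst lin_tlift[OF tlift_lin[OF assms(4,5,6,9)] assms(2,3) tensor_is_vs assms(6,1)])
    (auto intro!: tens_in assms tlift_cong[OF assms(1-3)]
      tlift_tens lin_in[OF assms(7)] lin_in[OF assms(8)])

lemma tmap_tens:
  assumes "is_vs V" "is_vs W" "is_vs V'" "is_vs W'" "lin V V' f" "lin W W' g" "v \<in> carr V" "w \<in> carr W"
  shows "tmap V' W' f g (tens V W v w) = tens V' W' (f v) (g w)"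
  unfolding tmap_def
  by (rule tlift_tens[OF assms(1,2) tensor_is_vs _ assms(7,8)], rule bilinI)
    (assumption | rule bilin_lin1[OF tens_bilin] bilin_lin2[OF tens_bilin] lin_in[OF assms(5)] lin_in[OF assms(6)] assms)+

lemma tmap_cong:
  assumes "t \<in> carr (V \<otimes>\<^sub>v W)" "is_vs V" "is_vs W"
    and "\<And>v. v \<in> carr V \<Longrightarrow> f v = f' v" "\<And>w. w \<in> carr W \<Longrightarrow> g w = g' w"
  shows "tmap V' W' f g t = tmap V' W' f' g' t"
  unfolding tmap_def by (rule tlift_cong[OF assms(1-3)]) (simp add: assms(4,5))

lemma tmap_tmap:
  assumes "t \<in> carr (V \<otimes>\<^sub>v W)" "is_vs V" "is_vs W" "is_vs V'" "is_vs W'" "is_vs V''" "is_vs W''"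
    and "lin V V' f" "lin W W' g" "lin V' V'' f'" "lin W' W'' g'"
  shows "tmap V'' W'' f' g' (tmap V' W' f g t) = tmap V'' W'' (\<lambda>x. f' (f x)) (\<lambda>x. g' (g x)) t"
  unfolding tmap_def[of V'' W'']
  by (rule tlift_tmap[OF assms(1-5) tensor_is_vs assms(8,9)], rule bilinI)
    (assumption | rule bilin_lin1[OF tens_bilin] bilin_lin2[OF tens_bilin] lin_in[OF assms(10)] lin_in[OF assms(11)] assms)+

lemma tlift_tens_self:
  assumes "is_vs V" "is_vs W" "t \<in> carr (V \<otimes>\<^sub>v W)"
  shows "tlift (V \<otimes>\<^sub>v W) (tens V W) t = t"
  using tensor_expand[OF assms] by (simp add: tlift_def)

lemma tmap_ident:
  assumes "is_vs V" "is_vs W" "t \<in> carr (V \<otimes>\<^sub>v W)"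
    and "\<And>v. v \<in> carr V \<Longrightarrow> f v = v" "\<And>w. w \<in> carr W \<Longrightarrow> g w = w"
  shows "tmap V W f g t = t"
proof -
  have "tmap V W f g t = tlift (V \<otimes>\<^sub>v W) (tens V W) t"
    unfolding tmap_def by (rule tlift_cong[OF assms(3,1,2)]) (simp add: assms(4,5))
  then show ?thesis by (simp add: tlift_tens_self[OF assms(1-3)])
qed

lemma lin_eqI:
  assumes "t \<in> carr (V \<otimes>\<^sub>v W)" "is_vs V" "is_vs W" "is_vs Z" "lin (V \<otimes>\<^sub>v W) Z f" "lin (V \<otimes>\<^sub>v W) Z g"
    and "\<And>v w. v \<in> carr V \<Longrightarrow> w \<in> carr W \<Longrightarrow> f (tens V W v w) = g (tens V W v w)"
  shows "f t = g t"
  by (rule tensor_map_unique[OF assms(2-7,1)])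

text \<open>Tested against a trilinear map, the associator is only a change in the nesting of two
  sums. Linear maps are pushed through both layers of \<open>tassoc\<close>, and the claim is then
  visible on pure tensors.\<close>

lemma tlift_tassoc:
  assumes t: "t \<in> carr ((U \<otimes>\<^sub>v V) \<otimes>\<^sub>v W)" and vs: "is_vs U" "is_vs V" "is_vs W" "is_vs Z"
    and f: "trilin U V W Z f"
  shows "tlift Z (\<lambda>u s. tlift Z (\<lambda>v w. f u v w) s) (tassoc U V W t)
       = tlift Z (\<lambda>s w. tlift Z (\<lambda>u v. f u v w) s) t"
proof -
  let ?T = "U \<otimes>\<^sub>v (V \<otimes>\<^sub>v W)"
  let ?L = "tlift Z (\<lambda>u s. tlift Z (\<lambda>v w. f u v w) s)"
  note R = lin_ident vs tensor_is_vs bilin_lin1[OF tens_bilin] bilin_lin2[OF tens_bilin] tens_in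
    trilin_lin1[OF f] trilin_lin2[OF f] trilin_lin3[OF f] bilinI
  have b: "bilin U (V \<otimes>\<^sub>v W) Z (\<lambda>u s. tlift Z (\<lambda>v w. f u v w) s)"
    by (rule bilinI; (assumption | rule lin_tlift_arg lin_tlift_body R)+)
  have L: "lin ?T Z ?L" by (rule tlift_lin[OF vs(1) tensor_is_vs vs(4) b])
  have in1: "tlift ?T (\<lambda>u v. tens U (V \<otimes>\<^sub>v W) u (tens V W v w)) s \<in> carr ?T"
    if "s \<in> carr (U \<otimes>\<^sub>v V)" "w \<in> carr W" for s w
    by (rule tlift_in[OF that(1)]) (assumption | rule R)+
  have "?L (tassoc U V W t) = tlift Z (\<lambda>s w. ?L (tlift ?T (\<lambda>u v. tens U (V \<otimes>\<^sub>v W) u (tens V W v w)) s)) t"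
    unfolding tassoc_def Let_def
    by (rule lin_tlift[OF L tensor_is_vs vs(3) tensor_is_vs vs(4) t in1])
  also have "\<dots> = tlift Z (\<lambda>s w. tlift Z (\<lambda>u v. f u v w) s) t"
  proof (rule tlift_cong[OF t tensor_is_vs vs(3)])
    fix s w assume s: "s \<in> carr (U \<otimes>\<^sub>v V)" and w: "w \<in> carr W"
    have "?L (tlift ?T (\<lambda>u v. tens U (V \<otimes>\<^sub>v W) u (tens V W v w)) s)
        = tlift Z (\<lambda>u v. ?L (tens U (V \<otimes>\<^sub>v W) u (tens V W v w))) s"
      by (rule lin_tlift[OF L vs(1,2) tensor_is_vs vs(4) s]) (rule tens_in[OF vs(1) tensor_is_vs])
    also have "\<dots> = tlift Z (\<lambda>u v. f u v w) s"
    proof (rule tlift_cong[OF s vs(1,2)])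
      fix u v assume uv: "u \<in> carr U" "v \<in> carr V"
      have "?L (tens U (V \<otimes>\<^sub>v W) u (tens V W v w)) = tlift Z (\<lambda>v w. f u v w) (tens V W v w)"
        by (rule tlift_tens[OF vs(1) tensor_is_vs vs(4) b uv(1) tens_in[OF vs(2,3)]])
      also have "\<dots> = f u v w"
        by (rule tlift_tens[OF vs(2,3,4) _ uv(2) w]) (use f uv in \<open>simp add: trilin_def\<close>)
      finally show "?L (tens U (V \<otimes>\<^sub>v W) u (tens V W v w)) = f u v w" .
    qed
    finally show "?L (tlift ?T (\<lambda>u v. tens U (V \<otimes>\<^sub>v W) u (tens V W v w)) s) = tlift Z (\<lambda>u v. f u v w) s" .
  qed
  finally show ?thesis .
qed

text \<open>Common to the coassociativity of a coalgebra and of a comodule.\<close>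

lemma coassoc_tlift:
  assumes "is_vs V" "is_vs H" "is_vs Z" "lin V (V \<otimes>\<^sub>v H) co" "lin H (H \<otimes>\<^sub>v H) D" "v \<in> carr V"
    and "tassoc V H H (tmap (V \<otimes>\<^sub>v H) H co id (co v)) = tmap V (H \<otimes>\<^sub>v H) id D (co v)"
    and f: "trilin V H H Z f"
  shows "tlift Z (\<lambda>x z. tlift Z (\<lambda>x y. f x y z) (co x)) (co v)
       = tlift Z (\<lambda>x y. tlift Z (\<lambda>y z. f x y z) (D y)) (co v)"
proof -
  note R = lin_ident assms(1-3) tensor_is_vs lin_tlift_arg lin_tlift_body
    trilin_lin1[OF f] trilin_lin2[OF f] trilin_lin3[OF f] bilinI lin_id
  have co: "co v \<in> carr (V \<otimes>\<^sub>v H)" by (rule lin_in[OF assms(4,6)])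
  have b: "bilin V (H \<otimes>\<^sub>v H) Z (\<lambda>u s. tlift Z (\<lambda>v w. f u v w) s)"
    by (rule bilinI; (assumption | rule R)+)
  have b': "bilin (V \<otimes>\<^sub>v H) H Z (\<lambda>s z. tlift Z (\<lambda>x y. f x y z) s)"
    by (rule bilinI; (assumption | rule R)+)
  have t: "tmap (V \<otimes>\<^sub>v H) H co id (co v) \<in> carr ((V \<otimes>\<^sub>v H) \<otimes>\<^sub>v H)"
    by (rule lin_in[OF tmap_lin co]) (rule assms tensor_is_vs lin_id)+
  have "tlift Z (\<lambda>x z. tlift Z (\<lambda>x y. f x y z) (co x)) (co v)
      = tlift Z (\<lambda>s z. tlift Z (\<lambda>x y. f x y z) s) (tmap (V \<otimes>\<^sub>v H) H co id (co v))"
    by (subst tlift_tmap[OF co assms(1,2) tensor_is_vs assms(2,3,4) lin_id b']) simp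
  also have "\<dots> = tlift Z (\<lambda>u s. tlift Z (\<lambda>v w. f u v w) s) (tmap V (H \<otimes>\<^sub>v H) id D (co v))"
    using tlift_tassoc[OF t assms(1,2,2,3) f] assms(7) by simp
  also have "\<dots> = tlift Z (\<lambda>x y. tlift Z (\<lambda>y z. f x y z) (D y)) (co v)"
    by (subst tlift_tmap[OF co assms(1,2,1) tensor_is_vs assms(3) lin_id assms(5) b]) simp
  finally show ?thesis .
qed

section \<open>The braiding\<close>

lemma lin_mult_left: "lin X base_field g \<Longrightarrow> lin X base_field (\<lambda>x. c * g x)"
  by (simp add: lin_def algebra_simps)

lemma lin_mult_right: "lin X base_field g \<Longrightarrow> lin X base_field (\<lambda>x. g x * c)"
  by (simp add: lin_def algebra_simps)

lemma scl_tlift_base: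
  assumes "t \<in> carr (V \<otimes>\<^sub>v W)" "is_vs V" "is_vs W" "is_vs Z" "z \<in> carr Z"
  shows "scl Z (tlift base_field f t) z = tlift Z (\<lambda>v w. scl Z (f v w) z) t"
  by (rule lin_tlift[OF lin_scale_left[OF assms(4) lin_ident assms(5)] assms(2,3) base_field_is_vs assms(4,1)])
    simp

text \<open>In the convolution algebra an idempotent p with right inverse q is the unit: \<epsilon>
  = p q = (p p) q = p (p q) = p \<epsilon> = p.\<close>

lemma convolution_idempotent:
  assumes "is_coalgebra H" and p: "lin H base_field p" and q: "lin H base_field q"
    and pp: "\<And>x. x \<in> carr H \<Longrightarrow> tlift base_field (\<lambda>x1 x2. p x1 * p x2) (comul H x) = p x"
    and pq: "\<And>x. x \<in> carr H \<Longrightarrow> tlift base_field (\<lambda>x1 x2. p x1 * q x2) (comul H x) = counit H x"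
    and x: "x \<in> carr H"
  shows "p x = counit H x"
proof -
  have vs: "is_vs H" and co: "lin H (H \<otimes>\<^sub>v H) (comul H)"
    using assms(1) by (simp_all add: is_coalgebra_def)
  have tri: "trilin H H H base_field (\<lambda>x y z. p x * p y * q z)"
    by (rule trilinI) (assumption | rule lin_mult_left lin_mult_right p q)+
  note D = lin_in[OF co x]
  have "counit H x = tlift base_field (\<lambda>x1 x2. p x1 * q x2) (comul H x)" by (simp add: pq x)
  also have "\<dots> = tlift base_field (\<lambda>x1 z. tlift base_field (\<lambda>x y. p x * p y * q z) (comul H x1)) (comul H x)"
  proof (rule tlift_cong[OF D vs vs])
    fix u v assume u: "u \<in> carr H"
    have "p u * q v = tlift base_field (\<lambda>x1 x2. p x1 * p x2) (comul H u) * q v" by (simp add: pp u)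
    also have "\<dots> = tlift base_field (\<lambda>x y. p x * p y * q v) (comul H u)"
      using scl_tlift[OF base_field_is_vs, of "q v" "\<lambda>x y. p x * p y" "comul H u"]
      by (simp add: mult.commute)
    finally show "p u * q v = tlift base_field (\<lambda>x y. p x * p y * q v) (comul H u)" .
  qed
  also have "\<dots> = tlift base_field (\<lambda>x1 x2. tlift base_field (\<lambda>y z. p x1 * p y * q z) (comul H x2)) (comul H x)"
    by (rule coassoc_tlift[OF vs vs base_field_is_vs co co x _ tri])
      (use assms(1) x in \<open>simp add: is_coalgebra_def\<close>)
  also have "\<dots> = tlift base_field (\<lambda>x1 x2. p (scl H (counit H x2) x1)) (comul H x)"
  proof (rule tlift_cong[OF D vs vs])
    fix u v assume uv: "u \<in> carr H" "v \<in> carr H"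
    have "tlift base_field (\<lambda>y z. p u * p y * q z) (comul H v)
        = p u * tlift base_field (\<lambda>y z. p y * q z) (comul H v)"
      using scl_tlift[OF base_field_is_vs, of "p u" "\<lambda>y z. p y * q z" "comul H v"]
      by (simp add: mult.assoc)
    then show "tlift base_field (\<lambda>y z. p u * p y * q z) (comul H v) = p (scl H (counit H v) u)"
      by (simp add: pq uv lin_scl[OF p])
  qed
  also have "\<dots> = p (tlift H (\<lambda>x1 x2. scl H (counit H x2) x1) (comul H x))"
    by (rule lin_tlift[OF p vs vs vs base_field_is_vs D, symmetric]) (rule vs_scl[OF vs])
  also have "\<dots> = p x" using assms(1) x by (simp add: is_coalgebra_def)
  finally show ?thesis by simp
qed

text \<open>Multiplicativity of r in one argument, taken at 1 = 1 1, makes r(-, 1) and r(1, -)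
  idempotent for convolution. Since \<Delta>(1) = 1 \<otimes> 1, the inverse form restricts to a
  convolution inverse of each, so \<open>convolution_idempotent\<close> applies.\<close>

lemma coquasitriangular_one:
  assumes "coquasitriangular H r" "x \<in> carr H"
  shows "r x (one H) = counit H x" "r (one H) x = counit H x"
proof -
  obtain r' where r': "conv_inverse H r r'" using assms(1) by (auto simp: coquasitriangular_def)
  have co: "is_coalgebra H" and alg: "is_algebra H" and D1: "comul H (one H) = tens H H (one H) (one H)"
    and e1: "counit H (one H) = 1" and r: "bilin H H base_field r"
    using assms(1) by (auto simp: coquasitriangular_def hopf_algebra_def is_bialgebra_def)
  have vs: "is_vs H" and one: "one H \<in> carr H" and one2: "mul H (one H) (one H) = one H"
    using alg by (auto simp: is_algebra_def)
  have b': "bilin H H base_field r'" using r' by (simp add: conv_inverse_def)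
  have ax: "r (mul H x y) z = tlift base_field (\<lambda>z1 z2. r x z1 * r y z2) (comul H z)"
    "r x (mul H y z) = tlift base_field (\<lambda>x1 x2. r x1 z * r x2 y) (comul H x)"
    if "x \<in> carr H" "y \<in> carr H" "z \<in> carr H" for x y z
    using assms(1) that by (auto simp: coquasitriangular_def)
  have inv: "conv2 H r r' x y = counit H x * counit H y" if "x \<in> carr H" "y \<in> carr H" for x y
    using r' that by (simp add: conv_inverse_def)
  note R = lin_mult_left lin_mult_right bilin_lin1[OF r] bilin_lin2[OF r] bilin_lin1[OF b'] bilin_lin2[OF b']
    lin_ident one
  have D: "comul H x \<in> carr (H \<otimes>\<^sub>v H)" if "x \<in> carr H" for x
    using co that lin_in unfolding is_coalgebra_def by blast
  show "r x (one H) = counit H x"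
  proof (rule convolution_idempotent[OF co _ _ _ _ assms(2), where p = "\<lambda>x. r x (one H)" and q = "\<lambda>x. r' x (one H)"])
    show "tlift base_field (\<lambda>x1 x2. r x1 (one H) * r x2 (one H)) (comul H x) = r x (one H)"
      if "x \<in> carr H" for x
      using ax(2)[OF that one one] by (simp add: one2)
    show "tlift base_field (\<lambda>x1 x2. r x1 (one H) * r' x2 (one H)) (comul H x) = counit H x"
      if x: "x \<in> carr H" for x
    proof -
      have "conv2 H r r' x (one H) = tlift base_field (\<lambda>x1 x2. r x1 (one H) * r' x2 (one H)) (comul H x)"
        unfolding conv2_def D1
      proof (rule tlift_cong[OF D[OF x] vs vs])
        fix u v assume "u \<in> carr H" "v \<in> carr H"
        then show "tlift base_field (\<lambda>y1 y2. r u y1 * r' v y2) (tens H H (one H) (one H))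
            = r u (one H) * r' v (one H)"
          by (intro tlift_tens[OF vs vs base_field_is_vs _ one one] bilinI) (assumption | rule R)+
      qed
      then show ?thesis using inv[OF x one] e1 by simp
    qed
  qed (assumption | rule R)+
  show "r (one H) x = counit H x"
  proof (rule convolution_idempotent[OF co _ _ _ _ assms(2), where p = "\<lambda>x. r (one H) x" and q = "\<lambda>x. r' (one H) x"])
    show "tlift base_field (\<lambda>x1 x2. r (one H) x1 * r (one H) x2) (comul H x) = r (one H) x"
      if "x \<in> carr H" for x
      using ax(1)[OF one one that] by (simp add: one2)
    show "tlift base_field (\<lambda>x1 x2. r (one H) x1 * r' (one H) x2) (comul H x) = counit H x"
      if x: "x \<in> carr H" for x
    proof -
      have "conv2 H r r' (one H) x = tlift base_field (\<lambda>x1 x2. r (one H) x1 * r' (one H) x2) (comul H x)"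
        unfolding conv2_def D1
        by (rule tlift_tens[OF vs vs base_field_is_vs _ one one], rule bilinI)
          (assumption | rule lin_tlift_body[OF D[OF x] vs vs base_field_is_vs] R)+
      then show ?thesis using inv[OF one x] e1 by simp
    qed
  qed (assumption | rule R)+
qed

section \<open>Tensor products of comodules\<close>

lemma comod_of_simps [simp]:
  "carr (comod_of A) = carr A" "scl (comod_of A) = scl A" "coact (comod_of A) = coaction A"
  by (simp_all add: comod_of_def)

text \<open>The chosen basis depends on \<open>carr\<close> and \<open>scl\<close> alone. Two
  records that differ in further fields, such as \<open>A\<close> and \<open>comod_of A\<close>,
  therefore have equal tensor products, not merely isomorphic ones.\<close>

lemma vs_congs:
  assumes "carr V = carr V'" "scl V = scl V'"
  shows "is_vs V = is_vs V'" "lin V W f = lin V' W f" "lin W V g = lin W V' g"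
    "vbasis V = vbasis V'" "coord V = coord V'" "V \<otimes>\<^sub>v W = V' \<otimes>\<^sub>v W" "W \<otimes>\<^sub>v V = W \<otimes>\<^sub>v V'"
    "tens V W = tens V' W" "tens W V = tens W V'" "tlift V h = tlift V' h"
    "tmap V W = tmap V' W" "tmap W V = tmap W V'"
proof -
  show v: "vbasis V = vbasis V'" by (simp add: vbasis_def assms)
  show c: "coord V = coord V'" by (simp add: coord_def[abs_def] v assms)
  show "is_vs V = is_vs V'" "lin V W f = lin V' W f" "lin W V g = lin W V' g" "tlift V h = tlift V' h"
    by (simp_all add: is_vs_def lin_def assms tlift_def[abs_def])
  show T: "V \<otimes>\<^sub>v W = V' \<otimes>\<^sub>v W" "W \<otimes>\<^sub>v V = W \<otimes>\<^sub>v V'" by (simp_all add: tensor_def v)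
  show t: "tens V W = tens V' W" "tens W V = tens W V'" by (simp_all add: tens_def[abs_def] c)
  show "tmap V W = tmap V' W" "tmap W V = tmap W V'"
    by (simp_all add: tmap_def[abs_def] T t)
qed

lemmas comod_of_congs [simp] = vs_congs[OF comod_of_simps(1,2)]

lemma tensor_coact_tens:
  assumes "is_vs V" "is_vs W" "is_vs H" "bilin H H H (mul H)"
    and V: "lin V (V \<otimes>\<^sub>v H) (coact V)" and W: "lin W (W \<otimes>\<^sub>v H) (coact W)"
    and v: "v \<in> carr V" and w: "w \<in> carr W"
  shows "coact (tensor_comod H V W) (tens V W v w) =
    tlift ((V \<otimes>\<^sub>v W) \<otimes>\<^sub>v H) (\<lambda>v0 v1. tlift ((V \<otimes>\<^sub>v W) \<otimes>\<^sub>v H) (\<lambda>w0 w1.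
      tens (V \<otimes>\<^sub>v W) H (tens V W v0 w0) (mul H v1 w1)) (coact W w)) (coact V v)"
    and "lin (V \<otimes>\<^sub>v W) ((V \<otimes>\<^sub>v W) \<otimes>\<^sub>v H) (coact (tensor_comod H V W))"
proof -
  have b: "bilin V W ((V \<otimes>\<^sub>v W) \<otimes>\<^sub>v H) (\<lambda>v w. tlift ((V \<otimes>\<^sub>v W) \<otimes>\<^sub>v H) (\<lambda>v0 v1. tlift ((V \<otimes>\<^sub>v W) \<otimes>\<^sub>v H) (\<lambda>w0 w1.
      tens (V \<otimes>\<^sub>v W) H (tens V W v0 w0) (mul H v1 w1)) (coact W w)) (coact V v))"
    by (rule bilinI; (assumption | rule assms tensor_is_vs lin_comp[OF V] lin_comp[OF W] lin_in[OF V] lin_in[OF W]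
        lin_ident lin_tlift_arg lin_tlift_body bilinI bilin_lin1[OF tens_bilin] bilin_lin2[OF tens_bilin]
        bilin_lin1[OF assms(4)] bilin_lin2[OF assms(4)] bilin_in[OF assms(4)] tens_in)+)
  show "coact (tensor_comod H V W) (tens V W v w) =
    tlift ((V \<otimes>\<^sub>v W) \<otimes>\<^sub>v H) (\<lambda>v0 v1. tlift ((V \<otimes>\<^sub>v W) \<otimes>\<^sub>v H) (\<lambda>w0 w1.
      tens (V \<otimes>\<^sub>v W) H (tens V W v0 w0) (mul H v1 w1)) (coact W w)) (coact V v)"
    unfolding tensor_comod_def Let_def
    using tlift_tens[OF assms(1,2) tensor_is_vs b v w] by simp
  show "lin (V \<otimes>\<^sub>v W) ((V \<otimes>\<^sub>v W) \<otimes>\<^sub>v H) (coact (tensor_comod H V W))"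
    unfolding tensor_comod_def Let_def
    using tlift_lin[OF assms(1,2) tensor_is_vs b] by simp
qed

lemma is_comoduleD:
  assumes "is_comodule H V"
  shows "is_vs V" "lin V (V \<otimes>\<^sub>v H) (coact V)"
  using assms by (simp_all add: is_comodule_def)

text \<open>Only braidings with \<open>A\<close> on the left and on pure tensors occur below, so the
  braiding is handled as a bilinear function of two elements.\<close>

definition braid ::
  "('h \<Rightarrow> 'h \<Rightarrow> 'k::field) \<Rightarrow> ('k, 'a::ab_group_add, 'h, 'y) cobialg_scheme \<Rightarrow>
   ('k, 'v::ab_group_add, 'h, 'x) comod_scheme \<Rightarrow> 'a \<Rightarrow> 'v \<Rightarrow> (('v \<times> 'a) \<Rightarrow>\<^sub>0 'k)"
where
  "braid r A V a v = braiding r (comod_of A) V (tens A V a v)"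

section \<open>Structure maps of a braided Hopf algebra in Sweedler form\<close>

locale braided_hopf =
  fixes H :: "('k::field, 'h::ab_group_add) bialg"
    and r :: "'h \<Rightarrow> 'h \<Rightarrow> 'k"
    and A :: "('k, 'a::ab_group_add, 'h) cobialg"
    and S :: "'a \<Rightarrow> 'a"
  assumes cqt: "coquasitriangular H r"
    and bh: "braided_hopf_algebra H r A"
    and S: "is_antipode A S"
begin

abbreviation bra where "bra V \<equiv> braid r A V"

lemma H_facts:
  shows H_vs: "is_vs H" and H_mul: "bilin H H H (mul H)" and H_one: "one H \<in> carr H"
    and H_comul: "lin H (H \<otimes>\<^sub>v H) (comul H)"
    and r_bilin: "bilin H H base_field r"
  using cqt by (auto simp: coquasitriangular_def hopf_algebra_def is_bialgebra_def is_algebra_def is_coalgebra_def)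

lemma r_mul:
  assumes "x \<in> carr H" "y \<in> carr H" "z \<in> carr H"
  shows "r (mul H x y) z = tlift base_field (\<lambda>z1 z2. r x z1 * r y z2) (comul H z)"
    "r x (mul H y z) = tlift base_field (\<lambda>x1 x2. r x1 z * r x2 y) (comul H x)"
  using cqt assms by (auto simp: coquasitriangular_def)

lemma A_facts:
  shows A_alg: "is_algebra A" and A_comodule: "is_comodule H (comod_of A)"
    and A_vs: "is_vs A" and A_mul: "bilin A A A (mul A)" and A_one: "one A \<in> carr A"
    and A_comul: "lin A (A \<otimes>\<^sub>v A) (comul A)"
    and A_coalg: "is_coalgebra A" and A_coaction: "lin A (A \<otimes>\<^sub>v H) (coaction A)"
    and A_comul_one: "comul A (one A) = tens A A (one A) (one A)"
  using bh by (auto simp: braided_hopf_algebra_def Let_def is_algebra_def is_coalgebra_def is_comodule_def)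

lemma A_comul_mul: "x \<in> carr A \<Longrightarrow> y \<in> carr A \<Longrightarrow> comul A (mul A x y) = braided_mul r A (comul A x) (comul A y)"
  using bh by (auto simp: braided_hopf_algebra_def Let_def)

lemma A_assoc: "x \<in> carr A \<Longrightarrow> y \<in> carr A \<Longrightarrow> z \<in> carr A \<Longrightarrow> mul A (mul A x y) z = mul A x (mul A y z)"
  and A_one_mul: "x \<in> carr A \<Longrightarrow> mul A (one A) x = x" and A_mul_one: "x \<in> carr A \<Longrightarrow> mul A x (one A) = x"
  using A_alg by (auto simp: is_algebra_def)

lemma S_lin: "lin A A S"
  using S by (simp add: is_antipode_def)

text \<open>Backchaining with this set proves linearity and membership for nested Sweedler
  expressions; individual proofs extend it by rules for their own maps, usually under the name
  \<open>R\<close>. The scaling rules match the coefficients produced by one or two braidings,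
  namely values of r and products of two such values.\<close>

lemmas lin_rules =
  lin_ident tensor_is_vs base_field_is_vs H_vs A_vs H_one A_one
  lin_scale lin_scale_left[OF _ bilin_lin1[OF r_bilin]] lin_scale_left[OF _ bilin_lin2[OF r_bilin]]
  lin_scale_left[OF _ lin_mult_left[OF bilin_lin1[OF r_bilin]]] lin_scale_left[OF _ lin_mult_left[OF bilin_lin2[OF r_bilin]]]
  lin_scale_left[OF _ lin_mult_right[OF bilin_lin1[OF r_bilin]]] lin_scale_left[OF _ lin_mult_right[OF bilin_lin2[OF r_bilin]]]
  lin_tlift_arg lin_tlift_body tlift_in vs_scl
  bilin_lin1[OF tens_bilin] bilin_lin2[OF tens_bilin] tens_in
  bilin_lin1[OF H_mul] bilin_lin2[OF H_mul] bilin_in[OF H_mul]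
  bilin_lin1[OF A_mul] bilin_lin2[OF A_mul] bilin_in[OF A_mul]
  lin_comp[OF A_comul] lin_in[OF A_comul] lin_comp[OF H_comul] lin_in[OF H_comul]
  lin_comp[OF A_coaction] lin_in[OF A_coaction] lin_comp[OF S_lin] lin_in[OF S_lin] 
  bilinI trilinI

lemma braid_unfold:
  assumes M: "is_vs M" "lin M (M \<otimes>\<^sub>v H) (coact M)" and a: "a \<in> carr A" "m \<in> carr M"
  shows "bra M a m = tlift (M \<otimes>\<^sub>v A) (\<lambda>a0 a1. tlift (M \<otimes>\<^sub>v A) (\<lambda>m0 m1.
      scl (M \<otimes>\<^sub>v A) (r a1 m1) (tens M A m0 a0)) (coact M m)) (coaction A a)"
  unfolding braid_def braiding_def Let_def comod_of_congs comod_of_simps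
  by (rule tlift_tens[OF A_vs M(1) tensor_is_vs _ a], rule bilinI;
      (assumption | rule M lin_rules lin_comp[OF M(2)] lin_in[OF M(2)])+)

lemma braid_bilin:
  assumes M: "is_vs M" "lin M (M \<otimes>\<^sub>v H) (coact M)"
  shows "bilin A M (M \<otimes>\<^sub>v A) (bra M)"
proof -
  have "bilin A M (M \<otimes>\<^sub>v A) (\<lambda>a m. tlift (M \<otimes>\<^sub>v A) (\<lambda>a0 a1. tlift (M \<otimes>\<^sub>v A) (\<lambda>m0 m1.
      scl (M \<otimes>\<^sub>v A) (r a1 m1) (tens M A m0 a0)) (coact M m)) (coaction A a))"
    by (rule bilinI; (assumption | rule M lin_rules lin_comp[OF M(2)] lin_in[OF M(2)])+)
  then show ?thesis
    using vs_add[OF A_vs] vs_add[OF M(1)] vs_scl[OF A_vs] vs_scl[OF M(1)]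
    unfolding bilin_def lin_def by (simp add: braid_unfold[OF M])
qed

text \<open>Later computations with the braiding start here: once its value is consumed by a
  bilinear map, it is a double sum over two coactions with weight r.\<close>

lemma tlift_braid:
  assumes M: "is_vs M" "lin M (M \<otimes>\<^sub>v H) (coact M)" and a: "a \<in> carr A" "m \<in> carr M"
    and Z: "is_vs Z" and f: "bilin M A Z f"
  shows "tlift Z f (bra M a m) = tlift Z (\<lambda>a0 a1. tlift Z (\<lambda>m0 m1.
      scl Z (r a1 m1) (f m0 a0)) (coact M m)) (coaction A a)"
proof -
  note R = M lin_rules lin_comp[OF M(2)] lin_in[OF M(2)]
  note L = tlift_lin[OF M(1) A_vs Z f]
  have "tlift Z f (bra M a m) = tlift Z (\<lambda>a0 a1. tlift Z f (tlift (M \<otimes>\<^sub>v A) (\<lambda>m0 m1.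
      scl (M \<otimes>\<^sub>v A) (r a1 m1) (tens M A m0 a0)) (coact M m))) (coaction A a)"
    unfolding braid_unfold[OF M a]
    by (rule lin_tlift[OF L A_vs H_vs tensor_is_vs Z lin_in[OF A_coaction a(1)]])
      (assumption | rule R a)+
  also have "\<dots> = tlift Z (\<lambda>a0 a1. tlift Z (\<lambda>m0 m1.
      scl Z (r a1 m1) (f m0 a0)) (coact M m)) (coaction A a)"
  proof (rule tlift_cong[OF lin_in[OF A_coaction a(1)] A_vs H_vs])
    fix a0 a1 assume A: "a0 \<in> carr A" "a1 \<in> carr H"
    have "tlift Z f (tlift (M \<otimes>\<^sub>v A) (\<lambda>m0 m1. scl (M \<otimes>\<^sub>v A) (r a1 m1) (tens M A m0 a0)) (coact M m))
       = tlift Z (\<lambda>m0 m1. tlift Z f (scl (M \<otimes>\<^sub>v A) (r a1 m1) (tens M A m0 a0))) (coact M m)"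
      by (rule lin_tlift[OF L M(1) H_vs tensor_is_vs Z lin_in[OF M(2) a(2)]])
        (assumption | rule R A)+
    also have "\<dots> = tlift Z (\<lambda>m0 m1. scl Z (r a1 m1) (f m0 a0)) (coact M m)"
      by (rule tlift_cong[OF lin_in[OF M(2) a(2)] M(1) H_vs])
        (simp add: lin_scl[OF L tens_in[OF M(1) A_vs]] tlift_tens[OF M(1) A_vs Z f] A)
    finally show "tlift Z f (tlift (M \<otimes>\<^sub>v A) (\<lambda>m0 m1. scl (M \<otimes>\<^sub>v A) (r a1 m1) (tens M A m0 a0)) (coact M m))
       = tlift Z (\<lambda>m0 m1. scl Z (r a1 m1) (f m0 a0)) (coact M m)" .
  qed
  finally show ?thesis .
qed

lemma braid_self_bilin: "bilin A A (A \<otimes>\<^sub>v A) (bra (comod_of A))"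
  using braid_bilin[of "comod_of A"] A_vs A_coaction by (simp add: bilin_def)

lemma tlift_braid_self:
  assumes "a \<in> carr A" "b \<in> carr A" "is_vs Z" "bilin A A Z f"
  shows "tlift Z f (bra (comod_of A) a b) = tlift Z (\<lambda>a0 a1. tlift Z (\<lambda>b0 b1.
      scl Z (r a1 b1) (f b0 a0)) (coaction A b)) (coaction A a)"
  using tlift_braid[of "comod_of A" a b Z f] assms A_vs A_coaction by (simp add: bilin_def)

text \<open>This is colinearity of the multiplication, with the tensor product coaction on A
  \<otimes> A written out.\<close>

lemma coaction_mul:
  assumes a: "a \<in> carr A" and b: "b \<in> carr A" and Z: "is_vs Z" and f: "bilin A H Z f"
  shows "tlift Z f (coaction A (mul A a b)) = tlift Z (\<lambda>a0 a1. tlift Z (\<lambda>b0 b1.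
    f (mul A a0 b0) (mul H a1 b1)) (coaction A b)) (coaction A a)"
proof -
  let ?T = "(A \<otimes>\<^sub>v A) \<otimes>\<^sub>v H" and ?m = "tlift A (mul A)"
  note ca = lin_in[OF A_coaction a] and cb = lin_in[OF A_coaction b]
  have col: "colinear H (tensor_comod H (comod_of A) (comod_of A)) (comod_of A) ?m"
    using bh by (auto simp: braided_hopf_algebra_def Let_def)
  have m: "lin (A \<otimes>\<^sub>v A) A ?m" by (rule tlift_lin[OF A_vs A_vs A_vs A_mul])
  have mt: "?m (tens A A x y) = mul A x y" if "x \<in> carr A" "y \<in> carr A" for x y
    by (rule tlift_tens[OF A_vs A_vs A_vs A_mul that])
  have T: "carr (tensor_comod H (comod_of A) (comod_of A)) = carr (A \<otimes>\<^sub>v A)"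
    by (simp add: tensor_comod_def Let_def)
  have co: "lin (A \<otimes>\<^sub>v A) ?T (coact (tensor_comod H (comod_of A) (comod_of A)))"
    and ct: "coact (tensor_comod H (comod_of A) (comod_of A)) (tens A A a b) =
    tlift ?T (\<lambda>v0 v1. tlift ?T (\<lambda>w0 w1. tens (A \<otimes>\<^sub>v A) H (tens A A v0 w0) (mul H v1 w1)) (coaction A b)) (coaction A a)"
    using tensor_coact_tens[of "comod_of A" "comod_of A" H a b] a b H_vs H_mul A_vs A_coaction by simp_all
  let ?g = "\<lambda>t h. f (?m t) h"
  have g: "bilin (A \<otimes>\<^sub>v A) H Z ?g"
    by (rule bilinI; (assumption | rule bilin_lin1[OF f] bilin_lin2[OF f] m lin_in[OF m] lin_ident)+)
  note L = tlift_lin[OF tensor_is_vs H_vs Z g]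
  have "coaction A (mul A a b) = tmap A H ?m id (coact (tensor_comod H (comod_of A) (comod_of A)) (tens A A a b))"
    using bspec[OF conjunct2[OF col[unfolded colinear_def T]] tens_in[OF A_vs A_vs, of a b]]
    by (simp add: mt[OF a b])
  then have "tlift Z f (coaction A (mul A a b)) =
     tlift Z (\<lambda>t h. f (?m t) (id h)) (coact (tensor_comod H (comod_of A) (comod_of A)) (tens A A a b))"
    using tlift_tmap[OF lin_in[OF co tens_in[OF A_vs A_vs, of a b]] tensor_is_vs H_vs A_vs H_vs Z m lin_id f]
    by simp
  also have "\<dots> = tlift Z (\<lambda>a0 a1. tlift Z ?g (tlift ?T (\<lambda>w0 w1. tens (A \<otimes>\<^sub>v A) H (tens A A a0 w0) (mul H a1 w1))
      (coaction A b))) (coaction A a)"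
    unfolding ct id_apply
    by (rule lin_tlift[OF L A_vs H_vs tensor_is_vs Z ca]) (assumption | rule lin_rules cb)+
  also have "\<dots> = tlift Z (\<lambda>a0 a1. tlift Z (\<lambda>b0 b1. f (mul A a0 b0) (mul H a1 b1)) (coaction A b)) (coaction A a)"
  proof (rule tlift_cong[OF ca A_vs H_vs])
    fix a0 a1 assume 1: "a0 \<in> carr A" "a1 \<in> carr H"
    have "tlift Z ?g (tlift ?T (\<lambda>w0 w1. tens (A \<otimes>\<^sub>v A) H (tens A A a0 w0) (mul H a1 w1)) (coaction A b))
      = tlift Z (\<lambda>b0 b1. tlift Z ?g (tens (A \<otimes>\<^sub>v A) H (tens A A a0 b0) (mul H a1 b1))) (coaction A b)"
      by (rule lin_tlift[OF L A_vs H_vs tensor_is_vs Z cb]) (assumption | rule lin_rules)+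
    also have "\<dots> = tlift Z (\<lambda>b0 b1. f (mul A a0 b0) (mul H a1 b1)) (coaction A b)"
      by (rule tlift_cong[OF cb A_vs H_vs])
        (simp add: tlift_tens[OF tensor_is_vs H_vs Z g] tens_in A_vs bilin_in[OF H_mul] 1 mt)
    finally show "tlift Z ?g (tlift ?T (\<lambda>w0 w1. tens (A \<otimes>\<^sub>v A) H (tens A A a0 w0) (mul H a1 w1)) (coaction A b))
      = tlift Z (\<lambda>b0 b1. f (mul A a0 b0) (mul H a1 b1)) (coaction A b)" .
  qed
  finally show ?thesis .
qed

lemma coaction_one: "coaction A (one A) = tens A H (one A) (one H)"
proof -
  let ?u = "\<lambda>c. scl A c (one A)"
  have col: "colinear H (unit_comod H) (comod_of A) ?u"
    using bh by (auto simp: braided_hopf_algebra_def Let_def)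
  have u: "lin base_field A ?u" by (rule lin_scale_left[OF A_vs lin_ident A_one])
  have "coaction A (scl A 1 (one A)) = tmap A H ?u id (tens base_field H 1 (one H))"
    using col by (auto simp: colinear_def unit_comod_def)
  also have "\<dots> = tens A H (scl A 1 (one A)) (id (one H))"
    by (rule tmap_tens[OF base_field_is_vs H_vs A_vs H_vs u lin_id _ H_one]) simp
  finally show ?thesis by (simp add: scl_one[OF A_vs])
qed

lemma r_one: "x \<in> carr H \<Longrightarrow> r x (one H) = counit H x" "x \<in> carr H \<Longrightarrow> r (one H) x = counit H x"
  using coquasitriangular_one[OF cqt] by blast+

lemma comodule_coassoc:
  assumes "is_comodule H V" "is_vs Z" "v \<in> carr V" "trilin V H H Z f"
  shows "tlift Z (\<lambda>x z. tlift Z (\<lambda>x y. f x y z) (coact V x)) (coact V v)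
       = tlift Z (\<lambda>x y. tlift Z (\<lambda>y z. f x y z) (comul H y)) (coact V v)"
  by (rule coassoc_tlift[OF is_comoduleD(1)[OF assms(1)] H_vs assms(2) is_comoduleD(2)[OF assms(1)]
        H_comul assms(3) _ assms(4)]) (use assms(1,3) in \<open>simp add: is_comodule_def\<close>)

lemma coaction_coassoc:
  assumes "is_vs Z" "a \<in> carr A" "trilin A H H Z f"
  shows "tlift Z (\<lambda>x z. tlift Z (\<lambda>x y. f x y z) (coaction A x)) (coaction A a)
       = tlift Z (\<lambda>x y. tlift Z (\<lambda>y z. f x y z) (comul H y)) (coaction A a)"
  by (rule coassoc_tlift[OF A_vs H_vs assms(1) A_coaction H_comul assms(2) _ assms(3)])
    (use A_comodule assms(2) in \<open>simp add: is_comodule_def tassoc_def\<close>)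

lemma comul_coassoc:
  assumes "is_vs Z" "x \<in> carr A" "trilin A A A Z f"
  shows "tlift Z (\<lambda>x z. tlift Z (\<lambda>x y. f x y z) (comul A x)) (comul A x)
       = tlift Z (\<lambda>x y. tlift Z (\<lambda>y z. f x y z) (comul A y)) (comul A x)"
  by (rule coassoc_tlift[OF A_vs A_vs assms(1) A_comul A_comul assms(2) _ assms(3)])
    (use A_coalg assms(2) in \<open>simp add: is_coalgebra_def\<close>)

section \<open>Hexagon identities, unit and naturality of the braiding\<close>

text \<open>One hexagon identity. It rests on r(xy, z) = r(x, z1) r(y, z2) and coassociativity of M;
  the factor b stands next to m and crosses it first.\<close>

lemma braid_mul:
  assumes M: "is_comodule H M" and a: "a \<in> carr A" and b: "b \<in> carr A" and m: "m \<in> carr M"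
    and Z: "is_vs Z" and f: "bilin M A Z f"
  shows "tlift Z f (bra M (mul A a b) m) = tlift Z (\<lambda>m' b'. tlift Z (\<lambda>m'' a'. f m'' (mul A a' b'))
    (bra M a m')) (bra M b m)"
proof -
  note MD = is_comoduleD[OF M]
  note R = a b m Z lin_rules MD lin_comp[OF MD(2)] lin_in[OF MD(2)] bilin_lin1[OF f] bilin_lin2[OF f] bilin_in[OF f]
    bilin_lin1[OF braid_bilin[OF MD]] bilin_lin2[OF braid_bilin[OF MD]] bilin_in[OF braid_bilin[OF MD]]
  note ca = lin_in[OF A_coaction a] and cb = lin_in[OF A_coaction b] and cm = lin_in[OF MD(2) m]
  have "tlift Z f (bra M (mul A a b) m)
      = tlift Z (\<lambda>c0 c1. tlift Z (\<lambda>m0 m1. scl Z (r c1 m1) (f m0 c0)) (coact M m)) (coaction A (mul A a b))"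
    by (rule tlift_braid[OF MD _ m Z f]) (rule R)+
  also have "\<dots> = tlift Z (\<lambda>a0 a1. tlift Z (\<lambda>b0 b1. tlift Z (\<lambda>m0 m1. scl Z (r (mul H a1 b1) m1) (f m0 (mul A a0 b0)))
      (coact M m)) (coaction A b)) (coaction A a)"
    by (rule coaction_mul[OF a b Z]) (assumption | rule R)+
  also have "\<dots> = tlift Z (\<lambda>a0 a1. tlift Z (\<lambda>b0 b1. tlift Z (\<lambda>m0 m1. tlift Z (\<lambda>z1 z2.
      scl Z (r a1 z1 * r b1 z2) (f m0 (mul A a0 b0))) (comul H m1)) (coact M m)) (coaction A b)) (coaction A a)"
    by (intro tlift_cong[OF ca A_vs H_vs] tlift_cong[OF cb A_vs H_vs] tlift_cong[OF cm MD(1) H_vs])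
      (simp add: r_mul, rule scl_tlift_base, (assumption | rule R)+)
  \<comment> \<open>Coassociativity of M turns the two legs of \<open>m1\<close> into two successive
    coactions. The outer leg is paired with b and the inner one with a, which is the order of the
    two braidings in the claim.\<close>
  also have "\<dots> = tlift Z (\<lambda>a0 a1. tlift Z (\<lambda>b0 b1. tlift Z (\<lambda>m0 z2. tlift Z (\<lambda>m0 z1.
      scl Z (r a1 z1 * r b1 z2) (f m0 (mul A a0 b0))) (coact M m0)) (coact M m)) (coaction A b)) (coaction A a)"
    by (intro tlift_cong[OF ca A_vs H_vs] tlift_cong[OF cb A_vs H_vs] comodule_coassoc[OF M Z m, symmetric])
      (assumption | rule R)+
  also have "\<dots> = tlift Z (\<lambda>b0 b1. tlift Z (\<lambda>m0 m1. tlift Z (\<lambda>a0 a1. tlift Z (\<lambda>m0 m2.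
      scl Z (r a1 m2 * r b1 m1) (f m0 (mul A a0 b0))) (coact M m0)) (coaction A a)) (coact M m)) (coaction A b)"
    by (subst tlift_swap[OF Z], rule tlift_cong[OF cb A_vs H_vs], rule tlift_swap[OF Z])
  also have "\<dots> = tlift Z (\<lambda>b0 b1. tlift Z (\<lambda>m0 m1. scl Z (r b1 m1) (tlift Z (\<lambda>m'' a'. f m'' (mul A a' b0))
    (bra M a m0))) (coact M m)) (coaction A b)"
  proof (intro tlift_cong[OF cb A_vs H_vs] tlift_cong[OF cm MD(1) H_vs])
    fix b0 b1 m0 m1 assume 1: "b0 \<in> carr A" "b1 \<in> carr H" "m0 \<in> carr M" "m1 \<in> carr H"
    show "tlift Z (\<lambda>a0 a1. tlift Z (\<lambda>m0 m2. scl Z (r a1 m2 * r b1 m1) (f m0 (mul A a0 b0))) (coact M m0)) (coaction A a)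
      = scl Z (r b1 m1) (tlift Z (\<lambda>m'' a'. f m'' (mul A a' b0)) (bra M a m0))"
      by (subst tlift_braid[OF MD a 1(3) Z], (assumption | rule R 1)+)
        (simp add: scl_tlift[OF Z] scl_scl[OF Z] mult.commute)
  qed
  also have "\<dots> = tlift Z (\<lambda>m' b'. tlift Z (\<lambda>m'' a'. f m'' (mul A a' b'))
    (bra M a m')) (bra M b m)"
    by (rule tlift_braid[OF MD b m Z, symmetric]) (assumption | rule R)+
  finally show ?thesis .
qed

text \<open>
  The braiding of \<open>A\<close> with an object carrying a colinear image of \<open>A \<otimes> V\<close>: this is applied to the
  action of \<open>A\<close> on a module and to the universal bilinear map of \<open>A \<otimes> V\<close>.
\<close>

lemma braid_colinear_image:
  assumes V: "is_comodule H V" and M: "is_vs M" "lin M (M \<otimes>\<^sub>v H) (coact M)"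
    and g: "bilin A V M g"
    and cg: "\<And>b v. b \<in> carr A \<Longrightarrow> v \<in> carr V \<Longrightarrow> coact M (g b v) =
      tlift (M \<otimes>\<^sub>v H) (\<lambda>b0 b1. tlift (M \<otimes>\<^sub>v H) (\<lambda>v0 v1. tens M H (g b0 v0) (mul H b1 v1)) (coact V v)) (coaction A b)"
    and a: "a \<in> carr A" and b: "b \<in> carr A" and v: "v \<in> carr V"
    and Z: "is_vs Z" and f: "bilin M A Z f"
  shows "tlift Z f (bra M a (g b v)) = tlift Z (\<lambda>b' a'. tlift Z (\<lambda>v' a''. f (g b' v') a'')
    (bra V a' v)) (bra (comod_of A) a b)"
proof -
  note VD = is_comoduleD[OF V]
  note R = a b v Z M lin_rules VD lin_comp[OF M(2)] lin_in[OF M(2)] lin_comp[OF VD(2)] lin_in[OF VD(2)]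
    bilin_lin1[OF f] bilin_lin2[OF f] bilin_in[OF f] bilin_lin1[OF g] bilin_lin2[OF g] bilin_in[OF g]
    bilin_lin1[OF braid_bilin[OF VD]] bilin_lin2[OF braid_bilin[OF VD]] bilin_in[OF braid_bilin[OF VD]]
  note ca = lin_in[OF A_coaction a] and cb = lin_in[OF A_coaction b] and cv = lin_in[OF VD(2) v]
  have coact_g: "tlift Z h (coact M (g b v)) = tlift Z (\<lambda>b0 b1. tlift Z (\<lambda>v0 v1. h (g b0 v0) (mul H b1 v1)) (coact V v)) (coaction A b)"
    if h: "bilin M H Z h" for h
  proof -
    note L = tlift_lin[OF M(1) H_vs Z h]
    have "tlift Z h (coact M (g b v)) = tlift Z (\<lambda>b0 b1. tlift Z h (tlift (M \<otimes>\<^sub>v H) (\<lambda>v0 v1.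
        tens M H (g b0 v0) (mul H b1 v1)) (coact V v))) (coaction A b)"
      unfolding cg[OF b v]
      by (rule lin_tlift[OF L A_vs H_vs tensor_is_vs Z cb]) (assumption | rule R)+
    also have "\<dots> = tlift Z (\<lambda>b0 b1. tlift Z (\<lambda>v0 v1. h (g b0 v0) (mul H b1 v1)) (coact V v)) (coaction A b)"
    proof (rule tlift_cong[OF cb A_vs H_vs])
      fix b0 b1 assume 1: "b0 \<in> carr A" "b1 \<in> carr H"
      have "tlift Z h (tlift (M \<otimes>\<^sub>v H) (\<lambda>v0 v1. tens M H (g b0 v0) (mul H b1 v1)) (coact V v))
        = tlift Z (\<lambda>v0 v1. tlift Z h (tens M H (g b0 v0) (mul H b1 v1))) (coact V v)"
        by (rule lin_tlift[OF L VD(1) H_vs tensor_is_vs Z cv]) (assumption | rule R 1)+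
      also have "\<dots> = tlift Z (\<lambda>v0 v1. h (g b0 v0) (mul H b1 v1)) (coact V v)"
        by (rule tlift_cong[OF cv VD(1) H_vs])
          (simp add: tlift_tens[OF M(1) H_vs Z h] bilin_in[OF H_mul] bilin_in[OF g] 1)
      finally show "tlift Z h (tlift (M \<otimes>\<^sub>v H) (\<lambda>v0 v1. tens M H (g b0 v0) (mul H b1 v1)) (coact V v))
        = tlift Z (\<lambda>v0 v1. h (g b0 v0) (mul H b1 v1)) (coact V v)" .
    qed
    finally show ?thesis .
  qed
  have "tlift Z f (bra M a (g b v))
      = tlift Z (\<lambda>a0 a1. tlift Z (\<lambda>m0 m1. scl Z (r a1 m1) (f m0 a0)) (coact M (g b v))) (coaction A a)"
    by (rule tlift_braid[OF M a _ Z f]) (rule R)+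
  also have "\<dots> = tlift Z (\<lambda>a0 a1. tlift Z (\<lambda>b0 b1. tlift Z (\<lambda>v0 v1. scl Z (r a1 (mul H b1 v1)) (f (g b0 v0) a0))
      (coact V v)) (coaction A b)) (coaction A a)"
    by (intro tlift_cong[OF ca A_vs H_vs] coact_g) (assumption | rule R)+
  also have "\<dots> = tlift Z (\<lambda>a0 a1. tlift Z (\<lambda>b0 b1. tlift Z (\<lambda>v0 v1. tlift Z (\<lambda>z1 z2.
      scl Z (r z1 v1 * r z2 b1) (f (g b0 v0) a0)) (comul H a1)) (coact V v)) (coaction A b)) (coaction A a)"
    by (intro tlift_cong[OF ca A_vs H_vs] tlift_cong[OF cb A_vs H_vs] tlift_cong[OF cv VD(1) H_vs])
      (simp add: r_mul, rule scl_tlift_base, (assumption | rule R)+)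
  also have "\<dots> = tlift Z (\<lambda>a0 a1. tlift Z (\<lambda>z1 z2. tlift Z (\<lambda>b0 b1. tlift Z (\<lambda>v0 v1.
      scl Z (r z1 v1 * r z2 b1) (f (g b0 v0) a0)) (coact V v)) (coaction A b)) (comul H a1)) (coaction A a)"
    by (rule tlift_cong[OF ca A_vs H_vs], subst tlift_swap[OF Z], rule tlift_cong[OF cb A_vs H_vs], rule tlift_swap[OF Z])
  \<comment> \<open>The rule r(x, yz) = r(x1, z) r(x2, y) pairs the second leg of \<open>a1\<close>
    with b. After coassociativity this is the outer leg, so a crosses b first, and the inner
    coaction is left for crossing v.\<close>
  also have "\<dots> = tlift Z (\<lambda>a0 z2. tlift Z (\<lambda>a0 z1. tlift Z (\<lambda>b0 b1. tlift Z (\<lambda>v0 v1.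
      scl Z (r z1 v1 * r z2 b1) (f (g b0 v0) a0)) (coact V v)) (coaction A b)) (coaction A a0)) (coaction A a)"
    by (rule coaction_coassoc[OF Z a, symmetric]) (assumption | rule R)+
  also have "\<dots> = tlift Z (\<lambda>a0 a1. tlift Z (\<lambda>b0 b1. scl Z (r a1 b1) (tlift Z (\<lambda>v' a''. f (g b0 v') a'')
    (bra V a0 v))) (coaction A b)) (coaction A a)"
  proof (rule tlift_cong[OF ca A_vs H_vs])
    fix a0 a1 assume 1: "a0 \<in> carr A" "a1 \<in> carr H"
    note ca0 = lin_in[OF A_coaction 1(1)]
    show "tlift Z (\<lambda>a0 z1. tlift Z (\<lambda>b0 b1. tlift Z (\<lambda>v0 v1.
      scl Z (r z1 v1 * r a1 b1) (f (g b0 v0) a0)) (coact V v)) (coaction A b)) (coaction A a0) =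
      tlift Z (\<lambda>b0 b1. scl Z (r a1 b1) (tlift Z (\<lambda>v' a''. f (g b0 v') a'') (bra V a0 v))) (coaction A b)"
    proof (subst tlift_swap[OF Z], rule tlift_cong[OF cb A_vs H_vs])
      fix b0 b1 assume 2: "b0 \<in> carr A" "b1 \<in> carr H"
      show "tlift Z (\<lambda>a0 z1. tlift Z (\<lambda>v0 v1. scl Z (r z1 v1 * r a1 b1) (f (g b0 v0) a0)) (coact V v)) (coaction A a0)
        = scl Z (r a1 b1) (tlift Z (\<lambda>v' a''. f (g b0 v') a'') (bra V a0 v))"
        by (subst tlift_braid[OF VD 1(1) v Z], (assumption | rule R 1 2)+)
          (simp add: scl_tlift[OF Z] scl_scl[OF Z] mult.commute)
    qed
  qed
  also have "\<dots> = tlift Z (\<lambda>b' a'. tlift Z (\<lambda>v' a''. f (g b' v') a'') (bra V a' v)) (bra (comod_of A) a b)"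
    by (rule tlift_braid_self[OF a b Z, symmetric]) (assumption | rule R)+
  finally show ?thesis .
qed

text \<open>Since 1 coacts by 1 \<otimes> 1 and r(1, x) = \<epsilon>(x), the weight disappears by
  the counit axiom of M.\<close>

lemma braid_one:
  assumes M: "is_comodule H M" and m: "m \<in> carr M" and Z: "is_vs Z" and f: "bilin M A Z f"
  shows "tlift Z f (bra M (one A) m) = f m (one A)"
proof -
  note MD = is_comoduleD[OF M]
  note R = m Z lin_rules MD lin_comp[OF MD(2)] lin_in[OF MD(2)] bilin_lin1[OF f] bilin_lin2[OF f] bilin_in[OF f]
  note cm = lin_in[OF MD(2) m]
  have l: "lin M Z (\<lambda>x. f x (one A))" by (rule bilin_lin1[OF f lin_ident A_one])
  have "tlift Z f (bra M (one A) m) = tlift Z (\<lambda>m0 m1. scl Z (r (one H) m1) (f m0 (one A))) (coact M m)"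
    unfolding tlift_braid[OF MD A_one m Z f] coaction_one
    by (rule tlift_tens[OF A_vs H_vs Z _ A_one H_one]) (rule bilinI; (assumption | rule R)+)
  also have "\<dots> = tlift Z (\<lambda>m0 m1. f (scl M (counit H m1) m0) (one A)) (coact M m)"
    by (rule tlift_cong[OF cm MD(1) H_vs]) (simp add: r_one lin_scl[OF l])
  also have "\<dots> = f (tlift M (\<lambda>m0 m1. scl M (counit H m1) m0) (coact M m)) (one A)"
    by (rule lin_tlift[OF l MD(1) H_vs MD(1) Z cm, symmetric]) (rule vs_scl[OF MD(1)])
  also have "\<dots> = f m (one A)" using M m by (simp add: is_comodule_def)
  finally show ?thesis .
qed

text \<open>The braiding sees m only through its coaction, which f preserves.\<close>

lemma braid_natural:
  assumes M: "is_vs M" "lin M (M \<otimes>\<^sub>v H) (coact M)" and N: "is_vs N" "lin N (N \<otimes>\<^sub>v H) (coact N)"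
    and f: "colinear H M N f" and a: "a \<in> carr A" and m: "m \<in> carr M"
    and Z: "is_vs Z" and g: "bilin N A Z g"
  shows "tlift Z g (bra N a (f m)) = tlift Z (\<lambda>m' a'. g (f m') a') (bra M a m)"
proof -
  have fl: "lin M N f" and fc: "coact N (f m) = tmap N H f id (coact M m)"
    using f m by (simp_all add: colinear_def)
  note R = a m Z N M lin_rules lin_comp[OF fl] lin_in[OF fl] bilin_lin1[OF g] bilin_lin2[OF g] bilin_in[OF g]
    fl lin_comp[OF M(2)] lin_in[OF M(2)]
  have "tlift Z g (bra N a (f m)) = tlift Z (\<lambda>a0 a1. tlift Z (\<lambda>m0 m1. scl Z (r a1 m1) (g m0 a0))
      (coact N (f m))) (coaction A a)"
    by (rule tlift_braid[OF N a _ Z g]) (rule R)+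
  also have "\<dots> = tlift Z (\<lambda>a0 a1. tlift Z (\<lambda>m0 m1. scl Z (r a1 m1) (g (f m0) a0))
      (coact M m)) (coaction A a)"
    unfolding fc
    by (intro tlift_cong[OF lin_in[OF A_coaction a] A_vs H_vs],
        subst tlift_tmap[OF lin_in[OF M(2) m] M(1) H_vs N(1) H_vs Z fl lin_id])
      (assumption | rule bilinI; (assumption | rule R)+ | simp)+
  also have "\<dots> = tlift Z (\<lambda>m' a'. g (f m') a') (bra M a m)"
    by (rule tlift_braid[OF M a m Z, symmetric]) (rule bilinI; (assumption | rule R)+)
  finally show ?thesis .
qed

text \<open>In the braided product of \<Delta>(a) and \<Delta>(b) the inner legs \<open>a2\<close>
  and \<open>b1\<close> change places; this is the one crossing in the formula.\<close>

lemma comul_mul: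
  assumes a: "a \<in> carr A" and b: "b \<in> carr A" and Z: "is_vs Z" and f: "bilin A A Z f"
  shows "tlift Z f (comul A (mul A a b)) =
    tlift Z (\<lambda>a1 a2. tlift Z (\<lambda>b1 b2. tlift Z (\<lambda>b' a'. f (mul A a1 b') (mul A a' b2))
      (bra (comod_of A) a2 b1)) (comul A b)) (comul A a)"
proof -
  note R = a b Z lin_rules bilin_lin1[OF f] bilin_lin2[OF f] bilin_in[OF f]
    bilin_lin1[OF braid_self_bilin] bilin_lin2[OF braid_self_bilin] bilin_in[OF braid_self_bilin]
  note L = tlift_lin[OF A_vs A_vs Z f]
  note ca = lin_in[OF A_comul a] and cb = lin_in[OF A_comul b]
  show ?thesis
    unfolding A_comul_mul[OF a b] braided_mul_def braid_def[symmetric, where V = "comod_of A", simplified]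
  proof (subst lin_tlift[OF L A_vs A_vs tensor_is_vs Z ca]; (rule tlift_cong[OF ca A_vs A_vs])?)
    fix a1 a2 assume 1: "a1 \<in> carr A" "a2 \<in> carr A"
    show "tlift (A \<otimes>\<^sub>v A) (\<lambda>a' b'. tlift (A \<otimes>\<^sub>v A) (\<lambda>p q. tens A A (mul A a1 p) (mul A q b'))
      (bra (comod_of A) a2 a')) (comul A b) \<in> carr (A \<otimes>\<^sub>v A)"
      by (assumption | rule R 1)+
    show "tlift Z f (tlift (A \<otimes>\<^sub>v A) (\<lambda>a' b'. tlift (A \<otimes>\<^sub>v A) (\<lambda>p q. tens A A (mul A a1 p) (mul A q b'))
      (bra (comod_of A) a2 a')) (comul A b)) =
      tlift Z (\<lambda>b1 b2. tlift Z (\<lambda>b' a'. f (mul A a1 b') (mul A a' b2)) (bra (comod_of A) a2 b1)) (comul A b)"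
    proof (subst lin_tlift[OF L A_vs A_vs tensor_is_vs Z cb]; (rule tlift_cong[OF cb A_vs A_vs])?)
      fix b1 b2 assume 2: "b1 \<in> carr A" "b2 \<in> carr A"
      note cc = bilin_in[OF braid_self_bilin 1(2) 2(1)]
      show "tlift (A \<otimes>\<^sub>v A) (\<lambda>p q. tens A A (mul A a1 p) (mul A q b2)) (bra (comod_of A) a2 b1) \<in> carr (A \<otimes>\<^sub>v A)"
        by (assumption | rule R 1 2)+
      show "tlift Z f (tlift (A \<otimes>\<^sub>v A) (\<lambda>p q. tens A A (mul A a1 p) (mul A q b2)) (bra (comod_of A) a2 b1))
        = tlift Z (\<lambda>b' a'. f (mul A a1 b') (mul A a' b2)) (bra (comod_of A) a2 b1)"
        by (subst lin_tlift[OF L A_vs A_vs tensor_is_vs Z cc]; (rule tlift_cong[OF cc A_vs A_vs])?)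
          (simp_all add: tens_in A_vs tlift_tens[OF A_vs A_vs Z f] bilin_in[OF A_mul] 1 2)
    qed
  qed
qed

end

section \<open>The bimodule of a module\<close>

context braided_hopf
begin

text \<open>
  In Sweedler notation \<open>shear Z M s F a m c\<close> is \<open>\<Sum> F a\<^sub>1 m' (a' c)\<close>, where \<open>m' \<otimes> a'\<close> runs through the
  braiding of \<open>s a\<^sub>2\<close> with \<open>m\<close>.
\<close>

definition shear ::
  "('k, 'z::ab_group_add, 'y) vs_scheme \<Rightarrow> ('k, 'm::ab_group_add, 'h, 'x) comod_scheme \<Rightarrow> ('a \<Rightarrow> 'a) \<Rightarrow>
   ('a \<Rightarrow> 'm \<Rightarrow> 'a \<Rightarrow> 'z) \<Rightarrow> 'a \<Rightarrow> 'm \<Rightarrow> 'a \<Rightarrow> 'z"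
where
  "shear Z M s F a m c = tlift Z (\<lambda>a1 a2. tlift Z (\<lambda>m' a'. F a1 m' (mul A a' c)) (bra M (s a2) m)) (comul A a)"

lemma shear_trilin:
  assumes MD: "is_vs M" "lin M (M \<otimes>\<^sub>v H) (coact M)" and Z: "is_vs Z" and s: "lin A A s"
    and F: "trilin A M A Z F"
  shows "trilin A M A Z (shear Z M s F)"
proof -
  note R = Z MD lin_rules lin_comp[OF s] lin_in[OF s] trilin_lin1[OF F] trilin_lin2[OF F] trilin_lin3[OF F]
    bilin_lin1[OF braid_bilin[OF MD]] bilin_lin2[OF braid_bilin[OF MD]] bilin_in[OF braid_bilin[OF MD]]
  show ?thesis unfolding shear_def
    by (rule trilinI; (assumption | rule R)+)
qed

lemma shear_cong:
  assumes MD: "is_vs M" "lin M (M \<otimes>\<^sub>v H) (coact M)" and s: "lin A A s"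
    and FG: "\<And>a m c. a \<in> carr A \<Longrightarrow> m \<in> carr M \<Longrightarrow> c \<in> carr A \<Longrightarrow> F a m c = G a m c"
    and a: "a \<in> carr A" "m \<in> carr M" "c \<in> carr A"
  shows "shear Z M s F a m c = shear Z M s G a m c"
  unfolding shear_def
  by (intro tlift_cong[OF lin_in[OF A_comul a(1)] A_vs A_vs] tlift_cong[OF bilin_in[OF braid_bilin[OF MD]] MD(1) A_vs] FG)
    (assumption | rule a lin_in[OF s] bilin_in[OF A_mul])+

lemma lin_shear:
  assumes g: "lin Y Z g" and Y: "is_vs Y" and Z: "is_vs Z"
    and MD: "is_vs M" "lin M (M \<otimes>\<^sub>v H) (coact M)" and s: "lin A A s" and F: "trilin A M A Y F"
    and a: "a \<in> carr A" "m \<in> carr M" "c \<in> carr A"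
  shows "g (shear Y M s F a m c) = shear Z M s (\<lambda>a m c. g (F a m c)) a m c"
proof -
  note R = a Y Z MD lin_rules lin_comp[OF s] lin_in[OF s] trilin_in[OF F]
    bilin_in[OF braid_bilin[OF MD]]
  have "g (shear Y M s F a m c) = tlift Z (\<lambda>a1 a2. g (tlift Y (\<lambda>m' a'. F a1 m' (mul A a' c)) (bra M (s a2) m))) (comul A a)"
    unfolding shear_def
    by (rule lin_tlift[OF g A_vs A_vs Y Z lin_in[OF A_comul a(1)]]) (assumption | rule R)+
  also have "\<dots> = shear Z M s (\<lambda>a m c. g (F a m c)) a m c"
    unfolding shear_def
  proof (rule tlift_cong[OF lin_in[OF A_comul a(1)] A_vs A_vs])
    fix a1 a2 assume 1: "a1 \<in> carr A" "a2 \<in> carr A"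
    show "g (tlift Y (\<lambda>m' a'. F a1 m' (mul A a' c)) (bra M (s a2) m))
      = tlift Z (\<lambda>m' a'. g (F a1 m' (mul A a' c))) (bra M (s a2) m)"
      by (rule lin_tlift[OF g MD(1) A_vs Y Z bilin_in[OF braid_bilin[OF MD]]]) (assumption | rule R 1)+
  qed
  finally show ?thesis .
qed

text \<open>If s' has right convolution inverse s, the shears with s and s' compose to the identity.
  It is used for S and the identity in both orders, which makes the two shears mutually
  inverse.\<close>

lemma shear_shear:
  assumes M: "is_comodule H M" and Z: "is_vs Z" and s: "lin A A s" and s': "lin A A s'"
    and ss: "\<And>x. x \<in> carr A \<Longrightarrow> tlift A (\<lambda>x1 x2. mul A (s' x1) (s x2)) (comul A x) = scl A (counit A x) (one A)"
    and F: "trilin A M A Z F" and a: "a \<in> carr A" "m \<in> carr M" "c \<in> carr A"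
  shows "shear Z M s (shear Z M s' F) a m c = F a m c"
proof -
  note MD = is_comoduleD[OF M] and ca = lin_in[OF A_comul a(1)]
  note bb = bilin_in[OF braid_bilin[OF MD]]
  note R = a Z MD lin_rules lin_comp[OF s] lin_in[OF s] lin_comp[OF s'] lin_in[OF s']
    trilin_lin1[OF F] trilin_lin2[OF F] trilin_lin3[OF F] trilin_in[OF F]
    bilin_lin1[OF braid_bilin[OF MD]] bilin_lin2[OF braid_bilin[OF MD]] bb
  have "shear Z M s (shear Z M s' F) a m c
    = tlift Z (\<lambda>a1 a2. tlift Z (\<lambda>a1 a1'. tlift Z (\<lambda>m' b'. tlift Z (\<lambda>m'' a''. F a1 m'' (mul A a'' (mul A b' c)))
        (bra M (s' a1') m')) (bra M (s a2) m)) (comul A a1)) (comul A a)"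
    unfolding shear_def by (intro tlift_cong[OF ca A_vs A_vs] tlift_swap[OF Z])
  \<comment> \<open>Coassociativity puts the arguments of \<open>s'\<close> and \<open>s\<close>
    into one comultiplication. The two consecutive braidings then merge, by
    \<open>braid_mul\<close>, into one braiding of the product to which \<open>ss\<close>
    applies.\<close>
  also have "\<dots> = tlift Z (\<lambda>a1 a2. tlift Z (\<lambda>a2 a3. tlift Z (\<lambda>m' b'. tlift Z (\<lambda>m'' a''. F a1 m'' (mul A a'' (mul A b' c)))
        (bra M (s' a2) m')) (bra M (s a3) m)) (comul A a2)) (comul A a)"
    by (rule comul_coassoc[OF Z a(1)]) (assumption | rule R)+
  also have "\<dots> = tlift Z (\<lambda>a1 a2. F (scl A (counit A a2) a1) m c) (comul A a)"
  proof (rule tlift_cong[OF ca A_vs A_vs])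
    fix a1 a2 assume 1: "a1 \<in> carr A" "a2 \<in> carr A"
    note c2 = lin_in[OF A_comul 1(2)]
    let ?G = "\<lambda>x. tlift Z (\<lambda>m' a'. F a1 m' (mul A a' c)) (bra M x m)"
    have G: "lin A Z ?G" by (assumption | rule R 1)+
    have "tlift Z (\<lambda>a2 a3. tlift Z (\<lambda>m' b'. tlift Z (\<lambda>m'' a''. F a1 m'' (mul A a'' (mul A b' c)))
        (bra M (s' a2) m')) (bra M (s a3) m)) (comul A a2)
      = tlift Z (\<lambda>a2 a3. ?G (mul A (s' a2) (s a3))) (comul A a2)"
    proof (rule tlift_cong[OF c2 A_vs A_vs])
      fix x y assume 2: "x \<in> carr A" "y \<in> carr A"
      have "?G (mul A (s' x) (s y)) = tlift Z (\<lambda>m' b'. tlift Z (\<lambda>m'' a'. F a1 m'' (mul A (mul A a' b') c))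
          (bra M (s' x) m')) (bra M (s y) m)"
        by (rule braid_mul[OF M _ _ a(2) Z]) (assumption | rule R 1 2)+
      also have "\<dots> = tlift Z (\<lambda>m' b'. tlift Z (\<lambda>m'' a''. F a1 m'' (mul A a'' (mul A b' c)))
        (bra M (s' x) m')) (bra M (s y) m)"
        by (intro tlift_cong[OF bb MD(1) A_vs]) (simp_all add: A_assoc a lin_in[OF s] lin_in[OF s'] 2)
      finally show "tlift Z (\<lambda>m' b'. tlift Z (\<lambda>m'' a''. F a1 m'' (mul A a'' (mul A b' c)))
        (bra M (s' x) m')) (bra M (s y) m) = ?G (mul A (s' x) (s y))" by simp
    qed
    also have "\<dots> = ?G (tlift A (\<lambda>x y. mul A (s' x) (s y)) (comul A a2))"
      by (rule lin_tlift[OF G A_vs A_vs A_vs Z c2, symmetric]) (assumption | rule R)+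
    also have "\<dots> = scl Z (counit A a2) (?G (one A))"
      unfolding ss[OF 1(2)] by (rule lin_scl[OF G A_one])
    also have "?G (one A) = F a1 m (mul A (one A) c)"
      by (rule braid_one[OF M a(2) Z]) (assumption | rule R 1)+
    also have "\<dots> = F a1 m c" by (simp add: A_one_mul a)
    also have "scl Z (counit A a2) \<dots> = F (scl A (counit A a2) a1) m c"
      using lin_scl[OF trilin_lin1[OF F lin_ident a(2,3)] 1(1)] by simp
    finally show "tlift Z (\<lambda>a2 a3. tlift Z (\<lambda>m' b'. tlift Z (\<lambda>m'' a''. F a1 m'' (mul A a'' (mul A b' c)))
        (bra M (s' a2) m')) (bra M (s a3) m)) (comul A a2) = F (scl A (counit A a2) a1) m c" .
  qed
  also have "\<dots> = F (tlift A (\<lambda>a1 a2. scl A (counit A a2) a1) (comul A a)) m c"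
    by (rule lin_tlift[OF trilin_lin1[OF F lin_ident a(2,3)] A_vs A_vs A_vs Z ca, symmetric])
      (rule vs_scl[OF A_vs])
  also have "\<dots> = F a m c" using A_coalg a by (simp add: is_coalgebra_def)
  finally show ?thesis .
qed

text \<open>Here \<Delta>(1) = 1 \<otimes> 1, and 1 crosses m unchanged.\<close>

lemma shear_one:
  assumes M: "is_comodule H M" and Z: "is_vs Z" and F: "trilin A M A Z F" and a: "m \<in> carr M" "c \<in> carr A"
  shows "shear Z M (\<lambda>x. x) F (one A) m c = F (one A) m c"
proof -
  note MD = is_comoduleD[OF M]
  note R = a Z MD lin_rules trilin_lin1[OF F] trilin_lin2[OF F] trilin_lin3[OF F] trilin_in[OF F]
    bilin_lin1[OF braid_bilin[OF MD]] bilin_lin2[OF braid_bilin[OF MD]] bilin_in[OF braid_bilin[OF MD]]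
  have "shear Z M (\<lambda>x. x) F (one A) m c = tlift Z (\<lambda>m' a'. F (one A) m' (mul A a' c)) (bra M (one A) m)"
    unfolding shear_def A_comul_one
    by (rule tlift_tens[OF A_vs A_vs Z _ A_one A_one]) (assumption | rule R)+
  also have "\<dots> = F (one A) m (mul A (one A) c)"
    by (rule braid_one[OF M a(1) Z]) (assumption | rule R)+
  finally show ?thesis by (simp add: A_one_mul a)
qed

lemma shear_mul_right:
  assumes MD: "is_vs M" "lin M (M \<otimes>\<^sub>v H) (coact M)" and s: "lin A A s"
    and a: "a \<in> carr A" "m \<in> carr M" "c \<in> carr A" "b \<in> carr A"
  shows "shear Z M s F a m (mul A c b) = shear Z M s (\<lambda>a m c. F a m (mul A c b)) a m c"
  unfolding shear_def
  by (intro tlift_cong[OF lin_in[OF A_comul a(1)] A_vs A_vs] tlift_cong[OF bilin_in[OF braid_bilin[OF MD]] MD(1) A_vs])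
    (simp_all add: A_assoc a lin_in[OF s])

text \<open>The left action of \<open>a\<close> on the braided tensor product of three left modules, precomposed to \<open>F\<close>.\<close>

definition twist ::
  "('k, 'z::ab_group_add, 'y) vs_scheme \<Rightarrow> ('k, 'm::ab_group_add, 'h, 'x) comod_scheme \<Rightarrow> 'a \<Rightarrow>
   ('a \<Rightarrow> 'm \<Rightarrow> 'a \<Rightarrow> 'z) \<Rightarrow> 'a \<Rightarrow> 'm \<Rightarrow> 'a \<Rightarrow> 'z"
where
  "twist Z M a F b m c = tlift Z (\<lambda>a1 a2. tlift Z (\<lambda>b' a'. tlift Z (\<lambda>m' a''. F (mul A a1 b') m' (mul A a'' c))
     (bra M a' m)) (bra (comod_of A) a2 b)) (comul A a)"

lemma twist_trilin:
  assumes MD: "is_vs M" "lin M (M \<otimes>\<^sub>v H) (coact M)" and Z: "is_vs Z" and F: "trilin A M A Z F"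
    and a: "a \<in> carr A"
  shows "trilin A M A Z (twist Z M a F)"
proof -
  note R = a Z MD lin_rules trilin_lin1[OF F] trilin_lin2[OF F] trilin_lin3[OF F]
    bilin_lin1[OF braid_bilin[OF MD]] bilin_lin2[OF braid_bilin[OF MD]] bilin_in[OF braid_bilin[OF MD]]
    bilin_lin1[OF braid_self_bilin] bilin_lin2[OF braid_self_bilin] bilin_in[OF braid_self_bilin]
  show ?thesis unfolding twist_def
    by (rule trilinI; (assumption | rule R)+)
qed

text \<open>The map a \<otimes> m \<otimes> c \<mapsto> \<Sum> \<open>a1\<close> \<otimes> m'
  \<otimes> a' c behind this shear intertwines left multiplication on the first factor with the
  diagonal action described by \<open>twist\<close>. The reason is multiplicativity of \<Delta>,
  with \<open>braid_mul\<close> splitting the crossing of the product of second legs past m.\<close>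

lemma shear_mul:
  assumes M: "is_comodule H M" and Z: "is_vs Z" and F: "trilin A M A Z F"
    and a: "a \<in> carr A" "b \<in> carr A" "m \<in> carr M" "c \<in> carr A"
  shows "shear Z M (\<lambda>x. x) F (mul A a b) m c = shear Z M (\<lambda>x. x) (twist Z M a F) b m c"
proof -
  note MD = is_comoduleD[OF M] and ca = lin_in[OF A_comul a(1)] and cb = lin_in[OF A_comul a(2)]
  note bb = bilin_in[OF braid_bilin[OF MD]]
  note R = a Z MD lin_rules trilin_lin1[OF F] trilin_lin2[OF F] trilin_lin3[OF F] trilin_in[OF F]
    bilin_lin1[OF braid_bilin[OF MD]] bilin_lin2[OF braid_bilin[OF MD]] bb
    bilin_lin1[OF braid_self_bilin] bilin_lin2[OF braid_self_bilin] bilin_in[OF braid_self_bilin]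
  have "shear Z M (\<lambda>x. x) F (mul A a b) m c =
    tlift Z (\<lambda>a1 a2. tlift Z (\<lambda>b1 b2. tlift Z (\<lambda>b' a'. tlift Z (\<lambda>m' x. F (mul A a1 b') m' (mul A x c))
      (bra M (mul A a' b2) m)) (bra (comod_of A) a2 b1)) (comul A b)) (comul A a)"
    unfolding shear_def
    by (rule comul_mul[OF a(1,2) Z]) (assumption | rule R)+
  also have "\<dots> = tlift Z (\<lambda>b1 b2. tlift Z (\<lambda>a1 a2. tlift Z (\<lambda>b' a'. tlift Z (\<lambda>m' x. F (mul A a1 b') m' (mul A x c))
      (bra M (mul A a' b2) m)) (bra (comod_of A) a2 b1)) (comul A a)) (comul A b)"
    by (rule tlift_swap[OF Z])
  also have "\<dots> = shear Z M (\<lambda>x. x) (twist Z M a F) b m c"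
    unfolding shear_def
  proof (rule tlift_cong[OF cb A_vs A_vs])
    fix b1 b2 assume 1: "b1 \<in> carr A" "b2 \<in> carr A"
    have "tlift Z (\<lambda>a1 a2. tlift Z (\<lambda>b' a'. tlift Z (\<lambda>m' x. F (mul A a1 b') m' (mul A x c))
        (bra M (mul A a' b2) m)) (bra (comod_of A) a2 b1)) (comul A a)
      = tlift Z (\<lambda>a1 a2. tlift Z (\<lambda>b' a'. tlift Z (\<lambda>m' x. tlift Z (\<lambda>m'' a''. F (mul A a1 b') m'' (mul A a'' (mul A x c)))
        (bra M a' m')) (bra M b2 m)) (bra (comod_of A) a2 b1)) (comul A a)"
    proof (rule tlift_cong[OF ca A_vs A_vs], rule tlift_cong[OF bilin_in[OF braid_self_bilin] A_vs A_vs])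
      fix a1 a2 b' a' assume 2: "a1 \<in> carr A" "a2 \<in> carr A" "b' \<in> carr A" "a' \<in> carr A"
      show "a2 \<in> carr A" "b1 \<in> carr A" by fact+
      have "tlift Z (\<lambda>m' x. F (mul A a1 b') m' (mul A x c)) (bra M (mul A a' b2) m)
        = tlift Z (\<lambda>m' x. tlift Z (\<lambda>m'' a''. F (mul A a1 b') m'' (mul A (mul A a'' x) c)) (bra M a' m')) (bra M b2 m)"
        by (rule braid_mul[OF M _ _ a(3) Z]) (assumption | rule R 1 2)+
      also have "\<dots> = tlift Z (\<lambda>m' x. tlift Z (\<lambda>m'' a''. F (mul A a1 b') m'' (mul A a'' (mul A x c)))
        (bra M a' m')) (bra M b2 m)"
        by (intro tlift_cong[OF bb MD(1) A_vs]) (simp_all add: A_assoc a 1 2)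
      finally show "tlift Z (\<lambda>m' x. F (mul A a1 b') m' (mul A x c)) (bra M (mul A a' b2) m) = \<dots>" .
    qed
    also have "\<dots> = tlift Z (\<lambda>a1 a2. tlift Z (\<lambda>m' x. tlift Z (\<lambda>b' a'. tlift Z (\<lambda>m'' a''. F (mul A a1 b') m'' (mul A a'' (mul A x c)))
        (bra M a' m')) (bra (comod_of A) a2 b1)) (bra M b2 m)) (comul A a)"
      by (intro tlift_cong[OF ca A_vs A_vs] tlift_swap[OF Z])
    also have "\<dots> = tlift Z (\<lambda>m' x. twist Z M a F b1 m' (mul A x c)) (bra M b2 m)"
      unfolding twist_def by (rule tlift_swap[OF Z])
    finally show "tlift Z (\<lambda>a1 a2. tlift Z (\<lambda>b' a'. tlift Z (\<lambda>m' x. F (mul A a1 b') m' (mul A x c))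
        (bra M (mul A a' b2) m)) (bra (comod_of A) a2 b1)) (comul A a)
      = tlift Z (\<lambda>m' x. twist Z M a F b1 m' (mul A x c)) (bra M b2 m)" .
  qed
  finally show ?thesis .
qed

lemma S_antipode:
  assumes "x \<in> carr A"
  shows "tlift A (\<lambda>x1 x2. mul A (S x1) x2) (comul A x) = scl A (counit A x) (one A)"
    "tlift A (\<lambda>x1 x2. mul A x1 (S x2)) (comul A x) = scl A (counit A x) (one A)"
  using S assms by (simp_all add: is_antipode_def)

text \<open>The counterpart of \<open>shear_mul\<close> for the inverse shear: it carries the
  diagonal action back to left multiplication. This follows formally by conjugating
  \<open>shear_mul\<close> with the inverse pair.\<close>

lemma twist_shear_antipode:
  assumes M: "is_comodule H M" and Z: "is_vs Z" and F: "trilin A M A Z F"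
    and a: "a \<in> carr A" "b \<in> carr A" "m \<in> carr M" "c \<in> carr A"
  shows "twist Z M a (shear Z M S F) b m c = shear Z M S (\<lambda>b. F (mul A a b)) b m c"
proof -
  note MD = is_comoduleD[OF M]
  have KF: "trilin A M A Z (shear Z M S F)" by (rule shear_trilin[OF MD Z S_lin F])
  \<comment> \<open>The inserted shears with S and with the identity cancel. The inner one lets
    \<open>shear_mul\<close> act, after which the other pair cancels too.\<close>
  have "twist Z M a (shear Z M S F) b m c = shear Z M S (shear Z M (\<lambda>x. x) (twist Z M a (shear Z M S F))) b m c"
    by (rule shear_shear[OF M Z S_lin lin_ident S_antipode(2) twist_trilin[OF MD Z KF a(1)] a(2-4), symmetric])
  also have "\<dots> = shear Z M S (\<lambda>b. F (mul A a b)) b m c"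
  proof (rule shear_cong[OF MD S_lin _ a(2-4)])
    fix x m c assume 1: "x \<in> carr A" "m \<in> carr M" "c \<in> carr A"
    have "shear Z M (\<lambda>x. x) (twist Z M a (shear Z M S F)) x m c = shear Z M (\<lambda>x. x) (shear Z M S F) (mul A a x) m c"
      by (rule shear_mul[OF M Z KF a(1) 1, symmetric])
    also have "\<dots> = F (mul A a x) m c"
      by (rule shear_shear[OF M Z lin_ident S_lin S_antipode(1) F bilin_in[OF A_mul a(1) 1(1)] 1(2,3)])
    finally show "shear Z M (\<lambda>x. x) (twist Z M a (shear Z M S F)) x m c = F (mul A a x) m c" .
  qed
  finally show ?thesis .
qed

section \<open>The bimodule structure on M \<otimes> A\<close>

text \<open>With the action of A on M as continuation, the shear sends m \<otimes> c to \<Sum>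
  \<open>a1\<close> m' \<otimes> a' c, where m' \<otimes> a' is the braiding of \<open>a2\<close>
  with m. This is the diagonal action on M \<otimes> A.\<close>

definition bimod_act :: "('k, 'm::ab_group_add, 'h, 'a) rmod \<Rightarrow> 'a \<Rightarrow> (('m \<times> 'a) \<Rightarrow>\<^sub>0 'k) \<Rightarrow> (('m \<times> 'a) \<Rightarrow>\<^sub>0 'k)" where
  "bimod_act M a = tlift (M \<otimes>\<^sub>v A) (shear (M \<otimes>\<^sub>v A) M (\<lambda>x. x) (\<lambda>b m c. tens M A (act M b m) c) a)"

definition bimod_of :: "('k, 'm::ab_group_add, 'h, 'a) rmod \<Rightarrow> ('k, ('m \<times> 'a) \<Rightarrow>\<^sub>0 'k, 'a) bimod" where
  "bimod_of M = \<lparr>carr = carr (M \<otimes>\<^sub>v A), scl = scl (M \<otimes>\<^sub>v A), lact = bimod_act M,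
     ract = (\<lambda>t b. tmap M A id (\<lambda>y. mul A y b) t)\<rparr>"

lemma bimod_of_simps [simp]:
  "carr (bimod_of M) = carr (M \<otimes>\<^sub>v A)" "scl (bimod_of M) = scl (M \<otimes>\<^sub>v A)"
  "lact (bimod_of M) = bimod_act M" "ract (bimod_of M) t b = tmap M A id (\<lambda>y. mul A y b) t"
  by (simp_all add: bimod_of_def)

lemma is_rmodD:
  assumes "is_rmod H A M"
  shows "is_comodule H M" "is_vs M" "lin M (M \<otimes>\<^sub>v H) (coact M)" "bilin A M M (act M)"
  using assms by (auto simp: is_rmod_def is_comodule_def)

lemma act_tens_trilin:
  assumes M: "is_vs M" "bilin A M M (act M)"
  shows "trilin A M A (M \<otimes>\<^sub>v A) (\<lambda>b m c. tens M A (act M b m) c)"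
  by (rule trilinI; (assumption | rule lin_rules M bilin_lin1[OF M(2)] bilin_lin2[OF M(2)] bilin_in[OF M(2)])+)

lemma bimod_act_tens:
  assumes M: "is_rmod H A M" and a: "a \<in> carr A" "m \<in> carr M" "c \<in> carr A"
  shows "bimod_act M a (tens M A m c) = shear (M \<otimes>\<^sub>v A) M (\<lambda>x. x) (\<lambda>b m c. tens M A (act M b m) c) a m c"
proof -
  note MD = is_rmodD[OF M]
  note t = shear_trilin[OF MD(2,3) tensor_is_vs lin_ident act_tens_trilin[OF MD(2,4)]]
  show ?thesis unfolding bimod_act_def
    by (rule tlift_tens[OF MD(2) A_vs tensor_is_vs _ a(2,3)]) (use t a(1) in \<open>simp add: trilin_def\<close>)
qed

lemma bimod_act_bilin:
  assumes M: "is_rmod H A M"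
  shows "bilin A (M \<otimes>\<^sub>v A) (M \<otimes>\<^sub>v A) (bimod_act M)"
proof -
  note MD = is_rmodD[OF M]
  note t = shear_trilin[OF MD(2,3) tensor_is_vs lin_ident act_tens_trilin[OF MD(2,4)]]
  show ?thesis unfolding bimod_act_def
    by (rule bilinI; (assumption | rule MD(2) lin_rules trilin_lin1[OF t] trilin_lin2[OF t] trilin_lin3[OF t])+)
qed

text \<open>The compatibility in \<open>is_rmod\<close> says that A \<otimes> M \<rightarrow> M is
  colinear, so \<open>braid_colinear_image\<close> applies with the action as
  \<open>g\<close>.\<close>

lemma braid_act:
  assumes M: "is_rmod H A M" and a: "a \<in> carr A" "b \<in> carr A" "m \<in> carr M" and Z: "is_vs Z" and f: "bilin M A Z f"
  shows "tlift Z f (bra M a (act M b m)) = tlift Z (\<lambda>b' a'. tlift Z (\<lambda>m' a''. f (act M b' m') a'')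
    (bra M a' m)) (bra (comod_of A) a b)"
  by (rule braid_colinear_image[OF is_rmodD(1)[OF M] is_rmodD(2-4)[OF M] _ a Z f])
    (use M in \<open>simp add: is_rmod_def\<close>)

lemma ract_lin:
  assumes M: "is_vs M"
  shows "bilin (M \<otimes>\<^sub>v A) A (M \<otimes>\<^sub>v A) (\<lambda>t b. tmap M A id (\<lambda>y. mul A y b) t)"
  unfolding tmap_def id_apply
  by (rule bilinI; (assumption | rule M lin_rules)+)

lemma ract_tens:
  assumes "is_vs M" "m \<in> carr M" "c \<in> carr A" "b \<in> carr A"
  shows "tmap M A id (\<lambda>y. mul A y b) (tens M A m c) = tens M A m (mul A c b)"
  by (subst tmap_tens[OF assms(1) A_vs assms(1) A_vs lin_id]) (simp_all add: assms bilin_lin1[OF A_mul lin_ident])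

text \<open>Left associativity comes from \<open>shear_mul\<close> and the left unit law from
  \<open>shear_one\<close>. The two actions commute because on the factor A one multiplies from the
  left and the other from the right.\<close>

lemma bimod_of_is_bimod:
  assumes M: "is_rmod H A M"
  shows "is_bimod A (bimod_of M)"
proof -
  note MD = is_rmodD[OF M]
  let ?T = "M \<otimes>\<^sub>v A" and ?F = "\<lambda>b m c. tens M A (act M b m) c"
  note F = act_tens_trilin[OF MD(2,4)]
  note bl = bimod_act_bilin[OF M] and br = ract_lin[OF MD(2)]
  note E = lin_eqI[OF _ MD(2) A_vs tensor_is_vs]
  note lr = bilin_lin2[OF bl] bilin_lin1[OF br] bilin_in[OF bl] bilin_in[OF br] lin_ident
  have one: "bimod_act M (one A) t = t" "tmap M A id (\<lambda>y. mul A y (one A)) t = t" if "t \<in> carr ?T" for t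
  proof -
    show "bimod_act M (one A) t = t"
    proof (rule E[OF that, where g = "\<lambda>x. x"])
      fix m c assume m: "m \<in> carr M" "c \<in> carr A"
      then show "bimod_act M (one A) (tens M A m c) = tens M A m c"
        using M by (simp add: bimod_act_tens[OF M A_one m] shear_one[OF MD(1) tensor_is_vs F m] is_rmod_def)
    qed (rule lr A_one)+
    show "tmap M A id (\<lambda>y. mul A y (one A)) t = t"
      by (rule tmap_ident[OF MD(2) A_vs that]) (simp_all add: A_mul_one)
  qed
  have mul: "bimod_act M (mul A a b) t = bimod_act M a (bimod_act M b t)"
    if a: "a \<in> carr A" "b \<in> carr A" and t: "t \<in> carr ?T" for a b t
  proof (rule E[OF t])
    fix m c assume m: "m \<in> carr M" "c \<in> carr A"
    have "bimod_act M (mul A a b) (tens M A m c) = shear ?T M (\<lambda>x. x) (twist ?T M a ?F) b m c"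
      by (simp add: bimod_act_tens[OF M _ m] bilin_in[OF A_mul] a shear_mul[OF MD(1) tensor_is_vs F a m])
    \<comment> \<open>The twisted continuation is the action of a: by \<open>braid_act\<close>,
      \<open>a2\<close> passes the element b m by passing b and then m, and associativity of the
      module combines \<open>a1\<close> with b'.\<close>
    also have "\<dots> = shear ?T M (\<lambda>x. x) (\<lambda>b m c. bimod_act M a (?F b m c)) b m c"
    proof (rule shear_cong[OF MD(2,3) lin_ident _ a(2) m])
      fix b m c assume 1: "b \<in> carr A" "m \<in> carr M" "c \<in> carr A"
      have "bimod_act M a (?F b m c) = shear ?T M (\<lambda>x. x) ?F a (act M b m) c"
        by (rule bimod_act_tens[OF M a(1) bilin_in[OF MD(4)] 1(3)]) (rule 1)+
      also have "\<dots> = tlift ?T (\<lambda>a1 a2. tlift ?T (\<lambda>b' a'. tlift ?T (\<lambda>m' a''.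
          tens M A (act M a1 (act M b' m')) (mul A a'' c)) (bra M a' m)) (bra (comod_of A) a2 b)) (comul A a)"
        unfolding shear_def
      proof (rule tlift_cong[OF lin_in[OF A_comul a(1)] A_vs A_vs])
        fix a1 a2 assume 2: "a1 \<in> carr A" "a2 \<in> carr A"
        show "tlift ?T (\<lambda>m' a'. tens M A (act M a1 m') (mul A a' c)) (bra M a2 (act M b m))
         = tlift ?T (\<lambda>b' a'. tlift ?T (\<lambda>m' a''. tens M A (act M a1 (act M b' m')) (mul A a'' c))
            (bra M a' m)) (bra (comod_of A) a2 b)"
          by (rule braid_act[OF M 2(2) 1(1,2) tensor_is_vs])
            (assumption | rule lin_rules MD 1 2 bilin_lin2[OF MD(4)] bilin_in[OF MD(4)])+
      qed
      also have "\<dots> = twist ?T M a ?F b m c"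
        unfolding twist_def
        by (intro tlift_cong[OF lin_in[OF A_comul a(1)] A_vs A_vs] tlift_cong[OF bilin_in[OF braid_self_bilin] A_vs A_vs]
          tlift_cong[OF bilin_in[OF braid_bilin[OF MD(2,3)]] MD(2) A_vs])
          (use M 1 in \<open>simp_all add: is_rmod_def\<close>)
      finally show "twist ?T M a ?F b m c = bimod_act M a (?F b m c)" by simp
    qed
    also have "\<dots> = bimod_act M a (shear ?T M (\<lambda>x. x) ?F b m c)"
      by (rule lin_shear[OF bilin_lin2[OF bl a(1) lin_ident] tensor_is_vs tensor_is_vs MD(2,3) lin_ident F a(2) m, symmetric])
    also have "\<dots> = bimod_act M a (bimod_act M b (tens M A m c))"
      by (simp add: bimod_act_tens[OF M a(2) m])
    finally show "bimod_act M (mul A a b) (tens M A m c) = bimod_act M a (bimod_act M b (tens M A m c))" .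
  qed (rule lr a bilin_in[OF A_mul])+
  have mulr: "tmap M A id (\<lambda>y. mul A y (mul A a b)) t = tmap M A id (\<lambda>y. mul A y b) (tmap M A id (\<lambda>y. mul A y a) t)"
    if a: "a \<in> carr A" "b \<in> carr A" and t: "t \<in> carr ?T" for a b t
  proof (rule E[OF t])
    fix m c assume m: "m \<in> carr M" "c \<in> carr A"
    then show "tmap M A id (\<lambda>y. mul A y (mul A a b)) (tens M A m c)
      = tmap M A id (\<lambda>y. mul A y b) (tmap M A id (\<lambda>y. mul A y a) (tens M A m c))"
      by (simp add: ract_tens[OF MD(2)] a bilin_in[OF A_mul] A_assoc)
  qed (rule lr a bilin_in[OF A_mul])+
  have comm: "tmap M A id (\<lambda>y. mul A y b) (bimod_act M a t) = bimod_act M a (tmap M A id (\<lambda>y. mul A y b) t)"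
    if a: "a \<in> carr A" "b \<in> carr A" and t: "t \<in> carr ?T" for a b t
  proof (rule E[OF t])
    fix m c assume m: "m \<in> carr M" "c \<in> carr A"
    have "tmap M A id (\<lambda>y. mul A y b) (bimod_act M a (tens M A m c))
       = shear ?T M (\<lambda>x. x) (\<lambda>x m c. tmap M A id (\<lambda>y. mul A y b) (?F x m c)) a m c"
      unfolding bimod_act_tens[OF M a(1) m]
      by (rule lin_shear[OF bilin_lin1[OF br lin_ident a(2)] tensor_is_vs tensor_is_vs MD(2,3) lin_ident F a(1) m])
    also have "\<dots> = shear ?T M (\<lambda>x. x) (\<lambda>x m c. ?F x m (mul A c b)) a m c"
      by (rule shear_cong[OF MD(2,3) lin_ident _ a(1) m]) (simp add: ract_tens[OF MD(2)] bilin_in[OF MD(4)] a)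
    also have "\<dots> = bimod_act M a (tmap M A id (\<lambda>y. mul A y b) (tens M A m c))"
      by (simp add: ract_tens[OF MD(2) m a(2)] bimod_act_tens[OF M a(1) m(1)] bilin_in[OF A_mul] m a
          shear_mul_right[OF MD(2,3) lin_ident a(1) m a(2)])
    finally show "tmap M A id (\<lambda>y. mul A y b) (bimod_act M a (tens M A m c))
       = bimod_act M a (tmap M A id (\<lambda>y. mul A y b) (tens M A m c))" .
  qed (rule lr a bilin_in[OF A_mul])+
  have bm: "bilin A (bimod_of M) (bimod_of M) (bimod_act M)"
    "bilin (bimod_of M) A (bimod_of M) (\<lambda>t b. tmap M A id (\<lambda>y. mul A y b) t)"
    "is_vs (bimod_of M)"
    using bl br tensor_is_vs[of M A] by (simp_all add: bilin_def lin_def is_vs_def)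
  then show ?thesis
    unfolding is_bimod_def
    using one mul mulr comm by (simp add: bimod_of_def)
qed

end

section \<open>Finitely generated projective bimodules\<close>

lemma is_algebraD:
  assumes "is_algebra A"
  shows "is_vs A" "bilin A A A (mul A)" "one A \<in> carr A"
    "\<And>x y z. x \<in> carr A \<Longrightarrow> y \<in> carr A \<Longrightarrow> z \<in> carr A \<Longrightarrow> mul A (mul A x y) z = mul A x (mul A y z)"
    "\<And>x. x \<in> carr A \<Longrightarrow> mul A (one A) x = x" "\<And>x. x \<in> carr A \<Longrightarrow> mul A x (one A) = x"
  using assms by (auto simp: is_algebra_def)

lemma is_bimodD:
  assumes "is_bimod A M"
  shows "is_vs M" "bilin A M M (lact M)" "bilin M A M (ract M)"
    "\<And>a b v. a \<in> carr A \<Longrightarrow> b \<in> carr A \<Longrightarrow> v \<in> carr M \<Longrightarrow> lact M (mul A a b) v = lact M a (lact M b v)"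
    "\<And>a b v. a \<in> carr A \<Longrightarrow> b \<in> carr A \<Longrightarrow> v \<in> carr M \<Longrightarrow> ract M v (mul A a b) = ract M (ract M v a) b"
    "\<And>a b v. a \<in> carr A \<Longrightarrow> b \<in> carr A \<Longrightarrow> v \<in> carr M \<Longrightarrow> ract M (lact M a v) b = lact M a (ract M v b)"
    "\<And>v. v \<in> carr M \<Longrightarrow> lact M (one A) v = v" "\<And>v. v \<in> carr M \<Longrightarrow> ract M v (one A) = v"
  using assms unfolding is_bimod_def by blast+

lemma bimod_homD:
  assumes "bimod_hom A M N f"
  shows "lin M N f" "\<And>a v. a \<in> carr A \<Longrightarrow> v \<in> carr M \<Longrightarrow> f (lact M a v) = lact N a (f v)"
    "\<And>a v. a \<in> carr A \<Longrightarrow> v \<in> carr M \<Longrightarrow> f (ract M v a) = ract N (f v) a"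
  using assms unfolding bimod_hom_def by blast+

lemma bimod_hom_comp:
  assumes "bimod_hom A M N f" "bimod_hom A L M g"
  shows "bimod_hom A L N (\<lambda>x. f (g x))"
  unfolding bimod_hom_def
  using lin_comp[OF bimod_homD(1)[OF assms(1)] bimod_homD(1)[OF assms(2)]]
    bimod_homD(2,3)[OF assms(1)] bimod_homD(2,3)[OF assms(2)] lin_in[OF bimod_homD(1)[OF assms(2)]]
  by simp

text \<open>The free bimodule of rank one, in which the coordinates of an element of
  \<open>free_bimod A m\<close> lie.\<close>

definition outer_bimod :: "('k::field, 'a::ab_group_add, 'z) alg_scheme \<Rightarrow> ('k, ('a \<times> 'a) \<Rightarrow>\<^sub>0 'k, 'a) bimod" where
  "outer_bimod A = \<lparr>carr = carr (A \<otimes>\<^sub>v A), scl = scl (A \<otimes>\<^sub>v A),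
     lact = (\<lambda>a. tmap A A (mul A a) id), ract = (\<lambda>t b. tmap A A id (\<lambda>y. mul A y b) t)\<rparr>"

lemma outer_bimod_simps [simp]:
  "carr (outer_bimod A) = carr (A \<otimes>\<^sub>v A)" "scl (outer_bimod A) = scl (A \<otimes>\<^sub>v A)"
  "lact (outer_bimod A) a = tmap A A (mul A a) id" "ract (outer_bimod A) t b = tmap A A id (\<lambda>y. mul A y b) t"
  by (simp_all add: outer_bimod_def)

lemmas outer_bimod_congs = vs_congs[OF outer_bimod_simps(1,2)]

lemma outer_bimod_is_bimod:
  assumes "is_algebra A"
  shows "is_bimod A (outer_bimod A)"
proof -
  note AD = is_algebraD[OF assms]
  note R = lin_ident AD(1-3) tensor_is_vs lin_tlift_arg lin_tlift_body tens_in bilinI bilin_in[OF AD(2)]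
    bilin_lin1[OF tens_bilin] bilin_lin2[OF tens_bilin] bilin_lin1[OF AD(2)] bilin_lin2[OF AD(2)]
  have b1: "bilin A (A \<otimes>\<^sub>v A) (A \<otimes>\<^sub>v A) (\<lambda>a. tmap A A (mul A a) id)"
    unfolding tmap_def id_apply by (rule bilinI; (assumption | rule R)+)
  have b2: "bilin (A \<otimes>\<^sub>v A) A (A \<otimes>\<^sub>v A) (\<lambda>t b. tmap A A id (\<lambda>y. mul A y b) t)"
    unfolding tmap_def id_apply by (rule bilinI; (assumption | rule R)+)
  have ract: "ract (outer_bimod A) = (\<lambda>t b. tmap A A id (\<lambda>y. mul A y b) t)"
    by (simp add: outer_bimod_def)
  have bm: "bilin A (outer_bimod A) (outer_bimod A) (lact (outer_bimod A))"
    "bilin (outer_bimod A) A (outer_bimod A) (ract (outer_bimod A))" "is_vs (outer_bimod A)"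
    using b1 b2 tensor_is_vs[of A A] by (simp_all add: bilin_def outer_bimod_congs ract)
  have mul: "tmap A A (mul A (mul A a b)) id v = tmap A A (mul A a) id (tmap A A (mul A b) id v)"
    "tmap A A id (\<lambda>y. mul A y (mul A a b)) v = tmap A A id (\<lambda>y. mul A y b) (tmap A A id (\<lambda>y. mul A y a) v)"
    "tmap A A id (\<lambda>y. mul A y b) (tmap A A (mul A a) id v) = tmap A A (mul A a) id (tmap A A id (\<lambda>y. mul A y b) v)"
    if "a \<in> carr A" "b \<in> carr A" "v \<in> carr (A \<otimes>\<^sub>v A)" for a b v
  proof -
    note l = bilin_lin2[OF AD(2) that(1) lin_ident] bilin_lin2[OF AD(2) that(2) lin_ident]
      bilin_lin1[OF AD(2) lin_ident that(1)] bilin_lin1[OF AD(2) lin_ident that(2)]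
    note T = tmap_tmap[OF that(3) AD(1,1,1,1,1,1)]
    show "tmap A A (mul A (mul A a b)) id v = tmap A A (mul A a) id (tmap A A (mul A b) id v)"
      unfolding T[OF l(2) lin_id l(1) lin_id] by (rule tmap_cong[OF that(3) AD(1,1)]) (simp_all add: AD(4) that)
    show "tmap A A id (\<lambda>y. mul A y (mul A a b)) v = tmap A A id (\<lambda>y. mul A y b) (tmap A A id (\<lambda>y. mul A y a) v)"
      unfolding T[OF lin_id l(3) lin_id l(4)] by (rule tmap_cong[OF that(3) AD(1,1)]) (simp_all add: AD(4) that)
    show "tmap A A id (\<lambda>y. mul A y b) (tmap A A (mul A a) id v) = tmap A A (mul A a) id (tmap A A id (\<lambda>y. mul A y b) v)"
      unfolding T[OF l(1) lin_id lin_id l(4)] T[OF lin_id l(4) l(1) lin_id] by simp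
  qed
  have one: "tmap A A (mul A (one A)) id v = v" "tmap A A id (\<lambda>y. mul A y (one A)) v = v"
    if "v \<in> carr (A \<otimes>\<^sub>v A)" for v
    by (rule tmap_ident[OF AD(1,1) that]; simp add: AD)+
  show ?thesis unfolding is_bimod_def using bm mul one by simp
qed

text \<open>\<open>Poly_Mapping.map\<close> leaves entries outside the support at 0, so it is
  pointwise application only for maps that fix 0.\<close>

lemma lookup_map_zero: "f 0 = 0 \<Longrightarrow> Poly_Mapping.lookup (Poly_Mapping.map f p) i = f (Poly_Mapping.lookup p i)"
  by (simp add: Poly_Mapping.map.rep_eq when_def)

text \<open>The cutoff at \<open>m\<close> makes the support finite, so that the abstraction
  function can be inverted.\<close>

definition family :: "nat \<Rightarrow> (nat \<Rightarrow> 'b::zero) \<Rightarrow> nat \<Rightarrow>\<^sub>0 'b" where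
  "family m g = Abs_poly_mapping (\<lambda>i. if i < m then g i else 0)"

lemma lookup_family: "Poly_Mapping.lookup (family m g) i = (if i < m then g i else 0)"
proof -
  have "finite {i. (if i < m then g i else 0) \<noteq> 0}"
    by (rule finite_subset[of _ "{..<m}"]) auto
  then show ?thesis unfolding family_def by (subst Abs_poly_mapping_inverse) auto
qed

lemma free_bimod_carr:
  "f \<in> carr (free_bimod A m) \<longleftrightarrow>
    (\<forall>i. Poly_Mapping.lookup f i \<in> carr (outer_bimod A) \<and> (m \<le> i \<longrightarrow> Poly_Mapping.lookup f i = 0))"
  by (auto simp: free_bimod_def in_keys_iff) (metis leI)

lemma lookup_free_bimod:
  assumes "is_algebra A"
  shows "Poly_Mapping.lookup (scl (free_bimod A m) c f) i = scl (outer_bimod A) c (Poly_Mapping.lookup f i)"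
    "a \<in> carr A \<Longrightarrow> Poly_Mapping.lookup (lact (free_bimod A m) a f) i = lact (outer_bimod A) a (Poly_Mapping.lookup f i)"
    "a \<in> carr A \<Longrightarrow> Poly_Mapping.lookup (ract (free_bimod A m) f a) i = ract (outer_bimod A) (Poly_Mapping.lookup f i) a"
  by (simp_all add: free_bimod_def lookup_map_zero scl_zero_right[OF tensor_is_vs] tmap_def tlift_def)

text \<open>Operations and equality are read coordinate by coordinate, so each axiom reduces to the
  same axiom of \<open>outer_bimod\<close>.\<close>

lemma free_bimod_is_bimod:
  assumes "is_algebra A"
  shows "is_bimod A (free_bimod A m)"
proof -
  let ?F = "free_bimod A m" and ?O = "outer_bimod A"
  note L = lookup_free_bimod[OF assms] and O = is_bimodD[OF outer_bimod_is_bimod[OF assms]]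
  have inO: "Poly_Mapping.lookup f i \<in> carr ?O" if "f \<in> carr ?F" for f i
    using that by (simp add: free_bimod_carr)
  have F0: "Poly_Mapping.lookup f i = 0" if "f \<in> carr ?F" "m \<le> i" for f i
    using that by (simp add: free_bimod_carr)
  note l0 = lin_0[OF O(1)]
  have "vector_space (scl ?F)"
    by (unfold_locales; rule poly_mapping_eqI)
      (simp_all only: L lookup_add scl_add_right[OF O(1)] scl_add_left[OF O(1)] scl_scl[OF O(1)] scl_one[OF O(1)])
  then interpret F: vector_space "scl ?F" .
  have "F.subspace (carr ?F)"
    unfolding F.subspace_def
    by (simp add: free_bimod_carr L(1) lookup_add vs_zero[OF O(1)] vs_add[OF O(1)] vs_scl[OF O(1)]
        scl_zero_right[OF O(1)] del: outer_bimod_simps)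
  then have vs: "is_vs ?F" using F.vector_space_axioms by (simp add: is_vs_def)
  have lin1: "lact ?F a f \<in> carr ?F" "ract ?F f a \<in> carr ?F" if "a \<in> carr A" "f \<in> carr ?F" for a f
    using that unfolding free_bimod_carr[of "lact ?F a f"] free_bimod_carr[of "ract ?F f a"]
    by (auto simp: L F0[OF that(2)] inO[OF that(2)] bilin_in[OF O(2)] bilin_in[OF O(3)]
        l0[OF bilin_lin2[OF O(2) _ lin_ident]] l0[OF bilin_lin1[OF O(3) lin_ident]] simp del: outer_bimod_simps)
  have b: "bilin A ?F ?F (lact ?F)"
  proof (rule bilinI)
    fix a assume a: "a \<in> carr A"
    note l = bilin_lin2[OF O(2) a lin_ident]
    show "lin ?F ?F (\<lambda>v. lact ?F a v)"
      unfolding lin_def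
      by (auto intro!: lin1 a poly_mapping_eqI simp: L(1) L(2)[OF a] lookup_add lin_add[OF l inO inO] lin_scl[OF l inO]
          simp del: outer_bimod_simps)
  next
    fix v assume v: "v \<in> carr ?F"
    note l = bilin_lin1[OF O(2) lin_ident inO[OF v]]
    show "lin A ?F (\<lambda>a. lact ?F a v)"
      unfolding lin_def
      by (auto intro!: lin1 v poly_mapping_eqI simp: L(1,2) vs_add[OF is_algebraD(1)[OF assms]] vs_scl[OF is_algebraD(1)[OF assms]]
          lookup_add lin_add[OF l] lin_scl[OF l] simp del: outer_bimod_simps)
  qed
  have b': "bilin ?F A ?F (ract ?F)"
  proof (rule bilinI)
    fix a assume a: "a \<in> carr A"
    note l = bilin_lin1[OF O(3) lin_ident a]
    show "lin ?F ?F (\<lambda>v. ract ?F v a)"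
      unfolding lin_def
      by (auto intro!: lin1 a poly_mapping_eqI simp: L(1) L(3)[OF a] lookup_add lin_add[OF l inO inO] lin_scl[OF l inO]
          simp del: outer_bimod_simps)
  next
    fix v assume v: "v \<in> carr ?F"
    note l = bilin_lin2[OF O(3) inO[OF v] lin_ident]
    show "lin A ?F (\<lambda>a. ract ?F v a)"
      unfolding lin_def
      by (auto intro!: lin1 v poly_mapping_eqI simp: L(1,3) vs_add[OF is_algebraD(1)[OF assms]] vs_scl[OF is_algebraD(1)[OF assms]]
          lookup_add lin_add[OF l] lin_scl[OF l] simp del: outer_bimod_simps)
  qed
  show ?thesis
    unfolding is_bimod_def
    by (auto intro!: vs b b' poly_mapping_eqI simp: L bilin_in[OF is_algebraD(2)[OF assms]] O(4-8) inO is_algebraD(3)[OF assms]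
      simp del: outer_bimod_simps)
qed

text \<open>Finite generation and projectivity in retract form. No complement is named and X may
  live in any type; \<open>retract_fg_projective\<close> supplies the complement and the type
  required by \<open>smooth_algebra\<close>.\<close>

definition free_retract :: "('k::field, 'a::ab_group_add, 'z) alg_scheme \<Rightarrow> ('k, 'p::ab_group_add, 'a) bimod \<Rightarrow> bool" where
  "free_retract A X \<longleftrightarrow> is_bimod A X \<and> (\<exists>m j q. bimod_hom A X (free_bimod A m) j \<and>
     bimod_hom A (free_bimod A m) X q \<and> (\<forall>x\<in>carr X. q (j x) = x))"

text \<open>The dual basis lemma for bimodules: the maps \<open>p i\<close> are coordinates with
  values in A \<otimes> A, the elements \<open>x i\<close> are generators, and \<open>dual\<close>
  says that the coordinates reassemble every element. The coordinates form the splitting and the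
  reassembly is the retraction.\<close>

lemma dual_basis_free_retract:
  fixes m :: nat
  assumes A: "is_algebra A" and X: "is_bimod A X"
    and x: "\<And>i. i < m \<Longrightarrow> x i \<in> carr X" and p: "\<And>i. i < m \<Longrightarrow> bimod_hom A X (outer_bimod A) (p i)"
    and dual: "\<And>t. t \<in> carr X \<Longrightarrow>
      (\<Sum>i<m. tlift X (\<lambda>a c. lact X a (ract X (x i) c)) (p i t)) = t"
  shows "free_retract A X"
proof -
  let ?F = "free_bimod A m" and ?O = "outer_bimod A"
  \<comment> \<open>The bimodule map a \<otimes> c \<mapsto> a x c out of the rank one free
    bimodule, with x = \<open>x i\<close>; it sends 1 \<otimes> 1 to the generator.\<close>
  let ?psi = "\<lambda>i. tlift X (\<lambda>a c. lact X a (ract X (x i) c))"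
  let ?j = "\<lambda>t. family m (\<lambda>i. p i t)" and ?q = "\<lambda>f. \<Sum>i<m. ?psi i (Poly_Mapping.lookup f i)"
  note AD = is_algebraD[OF A] and XD = is_bimodD[OF X]
  note L = lookup_free_bimod[OF A] and O = is_bimodD[OF outer_bimod_is_bimod[OF A]]
  have F: "is_vs ?F" by (rule is_bimodD(1)[OF free_bimod_is_bimod[OF A]])
  have bl: "bilin A A X (\<lambda>a c. lact X a (ract X (x i) c))" if "i < m" for i
    by (rule bilinI; (assumption | rule bilin_lin1[OF XD(2)] bilin_lin2[OF XD(2)] bilin_lin2[OF XD(3)]
      bilin_in[OF XD(3)] x that lin_ident)+)
  have psi: "bimod_hom A ?O X (?psi i)" if i: "i < m" for i
    unfolding bimod_hom_def
  proof (intro conjI ballI)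
    show "lin ?O X (?psi i)"
      using tlift_lin[OF AD(1,1) XD(1) bl[OF i]] by (simp add: outer_bimod_congs)
    fix a v assume a: "a \<in> carr A" and "v \<in> carr ?O"
    then have v: "v \<in> carr (A \<otimes>\<^sub>v A)" by simp
    have la: "lin X X (lact X a)" "lin X X (\<lambda>v. ract X v a)"
      by (rule bilin_lin2[OF XD(2) a lin_ident], rule bilin_lin1[OF XD(3) lin_ident a])
    note in1 = bilin_in[OF bl[OF i]]
    have "?psi i (lact ?O a v) = tlift X (\<lambda>b c. lact X (mul A a b) (ract X (x i) c)) v"
      using tlift_tmap[OF v AD(1,1,1,1) XD(1) bilin_lin2[OF AD(2) a lin_ident] lin_id bl[OF i]] by simp
    also have "\<dots> = tlift X (\<lambda>b c. lact X a (lact X b (ract X (x i) c))) v"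
      by (rule tlift_cong[OF v AD(1,1)]) (simp add: XD(4) a bilin_in[OF XD(3)] x i)
    also have "\<dots> = lact X a (?psi i v)"
      by (rule lin_tlift[OF la(1) AD(1,1) XD(1,1) v in1, symmetric])
    finally show "?psi i (lact ?O a v) = lact X a (?psi i v)" .
    have "?psi i (ract ?O v a) = tlift X (\<lambda>b c. lact X b (ract X (x i) (mul A c a))) v"
      using tlift_tmap[OF v AD(1,1,1,1) XD(1) lin_id bilin_lin1[OF AD(2) lin_ident a] bl[OF i]] by simp
    also have "\<dots> = tlift X (\<lambda>b c. ract X (lact X b (ract X (x i) c)) a) v"
      by (rule tlift_cong[OF v AD(1,1)]) (simp add: XD(5,6) a bilin_in[OF XD(3)] x i)
    also have "\<dots> = ract X (?psi i v) a"
      by (rule lin_tlift[OF la(2) AD(1,1) XD(1,1) v in1, symmetric])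
    finally show "?psi i (ract ?O v a) = ract X (?psi i v) a" .
  qed
  have inO: "Poly_Mapping.lookup f i \<in> carr ?O" if "f \<in> carr ?F" for f i
    using that by (simp add: free_bimod_carr)
  have psi_in: "?psi i (Poly_Mapping.lookup f i) \<in> carr X" if "i < m" "f \<in> carr ?F" for i f
    by (rule lin_in[OF bimod_homD(1)[OF psi[OF that(1)]] inO[OF that(2)]])
  have lq: "lin ?F X ?q"
    unfolding lin_def
    by (auto intro!: vs_sum[OF XD(1)] psi_in sum.cong simp: lookup_add L(1) scl_sum_right[OF XD(1)] sum.distrib[symmetric]
      lin_add[OF bimod_homD(1)[OF psi] inO inO] lin_scl[OF bimod_homD(1)[OF psi] inO] simp del: outer_bimod_simps)
  have q: "bimod_hom A ?F X ?q"
    unfolding bimod_hom_def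
  proof (intro conjI ballI lq)
    fix a f assume a: "a \<in> carr A" and f: "f \<in> carr ?F"
    have "?q (lact ?F a f) = (\<Sum>i<m. lact X a (?psi i (Poly_Mapping.lookup f i)))"
      unfolding L(2)[OF a] by (rule sum.cong[OF refl], rule bimod_homD(2)[OF psi a inO[OF f]]) simp
    also have "\<dots> = lact X a (?q f)"
      by (rule lin_setsum[OF XD(1) bilin_lin2[OF XD(2) a lin_ident], symmetric]) (simp_all add: psi_in f)
    finally show "?q (lact ?F a f) = lact X a (?q f)" .
    have "?q (ract ?F f a) = (\<Sum>i<m. ract X (?psi i (Poly_Mapping.lookup f i)) a)"
      unfolding L(3)[OF a] by (rule sum.cong[OF refl], rule bimod_homD(3)[OF psi a inO[OF f]]) simp
    also have "\<dots> = ract X (?q f) a"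
      by (rule lin_setsum[OF XD(1) bilin_lin1[OF XD(3) lin_ident a], symmetric]) (simp_all add: psi_in f)
    finally show "?q (ract ?F f a) = ract X (?q f) a" .
  qed
  have pO: "p i t \<in> carr ?O" if "i < m" "t \<in> carr X" for i t
    by (rule lin_in[OF bimod_homD(1)[OF p[OF that(1)]] that(2)])
  have jin: "?j t \<in> carr ?F" if "t \<in> carr X" for t
    unfolding free_bimod_carr lookup_family using pO[OF _ that] vs_zero[OF O(1)] by auto
  have j: "bimod_hom A X ?F ?j"
    unfolding bimod_hom_def lin_def
    using lin_0[OF O(1) bilin_lin2[OF O(2) _ lin_ident]] lin_0[OF O(1) bilin_lin1[OF O(3) lin_ident]]
    by (auto intro!: poly_mapping_eqI jin simp: lookup_family lookup_add L lin_add[OF bimod_homD(1)[OF p]]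
        lin_scl[OF bimod_homD(1)[OF p]] bimod_homD(2,3)[OF p] scl_zero_right[OF O(1)] simp del: outer_bimod_simps)
  have "?q (?j t) = t" if "t \<in> carr X" for t
    using dual[OF that] by (simp add: lookup_family)
  with q j X show ?thesis unfolding free_retract_def by blast
qed

lemma sub_bimod:
  assumes M: "is_bimod A M" and C: "C \<subseteq> carr M" "is_vs (M\<lparr>carr := C\<rparr>)"
    and l: "\<And>a x. a \<in> carr A \<Longrightarrow> x \<in> C \<Longrightarrow> lact M a x \<in> C" and r: "\<And>a x. a \<in> carr A \<Longrightarrow> x \<in> C \<Longrightarrow> ract M x a \<in> C"
  shows "is_bimod A (M\<lparr>carr := C\<rparr>)"
proof -
  have s: "x \<in> carr M" if "x \<in> C" for x using C that by blast
  have "bilin A (M\<lparr>carr := C\<rparr>) (M\<lparr>carr := C\<rparr>) (lact M)" "bilin (M\<lparr>carr := C\<rparr>) A (M\<lparr>carr := C\<rparr>) (ract M)"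
    using is_bimodD(2,3)[OF M] l r s unfolding bilin_def lin_def by simp_all
  then show ?thesis using is_bimodD(4-8)[OF M] s C(2) unfolding is_bimod_def by simp
qed

lemma sub_vs:
  assumes "is_vs M" "0 \<in> C" "\<And>x y. x \<in> C \<Longrightarrow> y \<in> C \<Longrightarrow> x + y \<in> C" "\<And>c x. x \<in> C \<Longrightarrow> scl M c x \<in> C"
  shows "is_vs (M\<lparr>carr := C\<rparr>)"
proof -
  interpret vector_space "scl M" using assms(1) by (simp add: is_vs_def)
  show ?thesis using assms vector_space_axioms by (auto simp: is_vs_def subspace_def)
qed

lemma scl_minus_one: "is_vs V \<Longrightarrow> scl V (- 1) x = - x"
  unfolding is_vs_def by (metis module.scale_minus_left module.scale_one module_iff_vector_space)

text \<open>The idempotent j q splits the free bimodule into the image of j and the kernel of q. The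
  image is a copy of X in the ambient type of the free bimodules.\<close>

lemma retract_fg_projective:
  assumes A: "is_algebra A" and X: "is_bimod A X" and j: "bimod_hom A X (free_bimod A m) j"
    and q: "bimod_hom A (free_bimod A m) X q" and qj: "\<And>x. x \<in> carr X \<Longrightarrow> q (j x) = x"
  shows "fg_projective_bimod A ((free_bimod A m)\<lparr>carr := j ` carr X\<rparr>)"
    "bimod_hom A X ((free_bimod A m)\<lparr>carr := j ` carr X\<rparr>) j"
    "bimod_hom A ((free_bimod A m)\<lparr>carr := j ` carr X\<rparr>) X q"
proof -
  let ?F = "free_bimod A m"
  let ?I = "?F\<lparr>carr := j ` carr X\<rparr>" and ?N = "?F\<lparr>carr := {f \<in> carr ?F. q f = 0}\<rparr>"
  note F = free_bimod_is_bimod[OF A, of m]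
  note FD = is_bimodD[OF F] and XD = is_bimodD[OF X] and jD = bimod_homD[OF j] and qD = bimod_homD[OF q]
  have jin: "j x \<in> carr ?F" if "x \<in> carr X" for x by (rule lin_in[OF jD(1) that])
  have qin: "q f \<in> carr X" if "f \<in> carr ?F" for f by (rule lin_in[OF qD(1) that])
  have vsI: "is_vs ?I"
  proof (rule sub_vs[OF FD(1)])
    show "0 \<in> j ` carr X" using lin_0[OF XD(1) jD(1)] vs_zero[OF XD(1)] by (metis image_eqI)
  qed (use lin_add[OF jD(1)] vs_add[OF XD(1)] lin_scl[OF jD(1)] vs_scl[OF XD(1)] in \<open>auto simp flip: lin_add[OF jD(1)] lin_scl[OF jD(1)]\<close>)
  have I: "is_bimod A ?I"
    by (rule sub_bimod[OF F _ vsI])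
      (auto intro: jin simp flip: jD(2,3) intro!: imageI bilin_in[OF XD(2)] bilin_in[OF XD(3)])
  have zl: "lact X a 0 = 0" "ract X 0 a = 0" if "a \<in> carr A" for a
    using lin_0[OF XD(1) bilin_lin2[OF XD(2) that lin_ident]] lin_0[OF XD(1) bilin_lin1[OF XD(3) lin_ident that]] by simp_all
  have vsN: "is_vs ?N"
    by (rule sub_vs[OF FD(1)])
      (auto intro: vs_zero vs_add vs_scl FD(1) simp: lin_0[OF FD(1) qD(1)] lin_add[OF qD(1)] lin_scl[OF qD(1)] scl_zero_right[OF XD(1)])
  have N: "is_bimod A ?N"
    by (rule sub_bimod[OF F _ vsN]) (auto simp: bilin_in[OF FD(2)] bilin_in[OF FD(3)] qD(2,3) zl)
  have homs: "bimod_hom A ?I ?F id" "bimod_hom A ?N ?F id"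
    unfolding bimod_hom_def lin_def using jin by auto
  have ds: "internal_direct_sum (carr ?I) (carr ?N) (carr ?F)"
    unfolding internal_direct_sum_def
  proof (intro conjI)
    show "carr ?I \<inter> carr ?N = {0}"
      using qj lin_0[OF XD(1) jD(1)] vs_zero[OF XD(1)] vs_zero[OF vsI] vs_zero[OF vsN] by fastforce
    show "carr ?F = {x + y | x y. x \<in> carr ?I \<and> y \<in> carr ?N}"
    proof (intro equalityI subsetI)
      fix f assume f: "f \<in> carr ?F"
      \<comment> \<open>The component in the kernel of q is f - j (q f), written with the scalar -1
        so that closure and linearity apply to it directly.\<close>
      let ?y = "f + scl ?F (- 1) (j (q f))"
      have y: "?y \<in> carr ?F" by (intro vs_add[OF FD(1)] vs_scl[OF FD(1)] f jin qin)
      have "q ?y = q f + scl X (- 1) (q (j (q f)))"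
        by (simp add: lin_add[OF qD(1) f vs_scl[OF FD(1) jin[OF qin[OF f]]]] lin_scl[OF qD(1) jin[OF qin[OF f]]])
      then have "q ?y = 0" by (simp add: qj qin f scl_minus_one[OF XD(1)])
      moreover have "f = j (q f) + ?y" by (simp add: scl_minus_one[OF FD(1)])
      ultimately show "f \<in> {x + y | x y. x \<in> carr ?I \<and> y \<in> carr ?N}"
        using y qin[OF f] by (intro CollectI exI[of _ "j (q f)"] exI[of _ ?y]) simp
    next
      fix f assume "f \<in> {x + y | x y. x \<in> carr ?I \<and> y \<in> carr ?N}"
      then show "f \<in> carr ?F" using jin vs_add[OF FD(1)] by auto
    qed
  qed
  have "bimod_iso A ?I ?I"
    unfolding bimod_iso_def by (intro exI[of _ id]) (auto simp: bimod_hom_def lin_def)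
  then show "fg_projective_bimod A ?I"
    unfolding fg_projective_bimod_def bimod_summand_def using I N homs ds by blast
  show "bimod_hom A X ?I j" "bimod_hom A ?I X q"
    using j q jin unfolding bimod_hom_def lin_def by auto
qed

text \<open>Each term is replaced by its copy under the splitting j, with differential j d q and
  augmentation e q. On these copies q inverts j, so kernels and images are carried along by
  j.\<close>

lemma smooth_algebra_if_retracts:
  fixes X :: "nat \<Rightarrow> ('k::field, 'p::ab_group_add, 'a::ab_group_add) bimod"
  assumes A: "is_algebra A" and X: "\<And>i. i \<le> n \<Longrightarrow> free_retract A (X i)"
    and d: "\<And>i. i < n \<Longrightarrow> bimod_hom A (X (Suc i)) (X i) (d i)"
    and e: "bimod_hom A (X 0) (regular_bimod A) e"
    and ex: "exact_sequence n (\<lambda>i. carr (X i)) d e (carr A)"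
  shows "smooth_algebra A"
proof -
  \<comment> \<open>Rank, splitting and retraction are packed into one tuple, so that a single
    choice gives all three as functions of i.\<close>
  have "\<forall>i. \<exists>t. i \<le> n \<longrightarrow> bimod_hom A (X i) (free_bimod A (fst t)) (fst (snd t)) \<and>
     bimod_hom A (free_bimod A (fst t)) (X i) (snd (snd t)) \<and> (\<forall>x\<in>carr (X i). snd (snd t) (fst (snd t) x) = x)"
    using X unfolding free_retract_def by fastforce
  from choice[OF this] obtain t where t: "\<And>i. i \<le> n \<Longrightarrow> bimod_hom A (X i) (free_bimod A (fst (t i))) (fst (snd (t i))) \<and>
     bimod_hom A (free_bimod A (fst (t i))) (X i) (snd (snd (t i))) \<and>
     (\<forall>x\<in>carr (X i). snd (snd (t i)) (fst (snd (t i)) x) = x)"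
    by blast
  define m where "m i = fst (t i)" for i
  define j where "j i = fst (snd (t i))" for i
  define q where "q i = snd (snd (t i))" for i
  have jq: "\<And>i. i \<le> n \<Longrightarrow> bimod_hom A (X i) (free_bimod A (m i)) (j i)"
     "\<And>i. i \<le> n \<Longrightarrow> bimod_hom A (free_bimod A (m i)) (X i) (q i)"
     "\<And>i x. i \<le> n \<Longrightarrow> x \<in> carr (X i) \<Longrightarrow> q i (j i x) = x"
    using t by (auto simp: m_def j_def q_def)
  have Xb: "is_bimod A (X i)" if "i \<le> n" for i using X[OF that] by (simp add: free_retract_def)
  define Y where "Y i = (free_bimod A (m i))\<lparr>carr := j i ` carr (X i)\<rparr>" for i
  note ret = retract_fg_projective[OF A Xb jq(1) jq(2) jq(3), folded Y_def]
  have cY: "carr (Y i) = j i ` carr (X i)" for i by (simp add: Y_def)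
  define d' where "d' i y = j i (d i (q (Suc i) y))" for i y
  define e' where "e' y = e (q 0 y)" for y
  have inj: "j i x = 0 \<longleftrightarrow> x = 0" if "i \<le> n" "x \<in> carr (X i)" for i x
    using jq(3)[OF that] lin_0[OF is_bimodD(1)[OF Xb[OF that(1)]] bimod_homD(1)[OF jq(1)[OF that(1)]]]
      jq(3)[OF that(1) vs_zero[OF is_bimodD(1)[OF Xb[OF that(1)]]]] by metis
  have din: "d i x \<in> carr (X i)" if "i < n" "x \<in> carr (X (Suc i))" for i x
    using lin_in[OF bimod_homD(1)[OF d[OF that(1)]] that(2)] .
  \<comment> \<open>The target of f is left open because the fact serves both the augmentation and
    the differentials.\<close>
  have kernel: "{y \<in> carr (Y i). f (q i y) = 0} = j i ` {x \<in> carr (X i). f x = 0}" if "i \<le> n"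
    for i and f :: "'p \<Rightarrow> 'c::zero"
    unfolding cY using jq(3)[OF that] by force
  have dimg: "d' i ` carr (Y (Suc i)) = j i ` (d i ` carr (X (Suc i)))" if "i < n" for i
    unfolding cY d'_def image_image using jq(3)[of "Suc i"] that by (auto intro!: image_cong)
  have j0: "j i ` {0} = {0}" if "i \<le> n" for i
    using inj[OF that vs_zero[OF is_bimodD(1)[OF Xb[OF that]]]] by simp
  have "exact_sequence n (\<lambda>i. carr (Y i)) d' e' (carr A)"
    unfolding exact_sequence_def
  proof (intro conjI allI impI)
    show "e' ` carr (Y 0) = carr A"
      using ex jq(3)[of 0] unfolding exact_sequence_def cY e'_def image_image by (auto cong: image_cong)
    show "{x \<in> carr (Y 0). e' x = 0} = (if n = 0 then {0} else d' 0 ` carr (Y 1))"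
      unfolding e'_def kernel[OF le0] using ex dimg[of 0] j0[of 0] by (simp add: exact_sequence_def)
    fix i assume i: "i < n"
    have "{x \<in> carr (Y (Suc i)). d' i x = 0} = {y \<in> carr (Y (Suc i)). d i (q (Suc i) y) = 0}"
      unfolding d'_def cY using i using j0[of i] by (auto simp: jq(3) inj din)
    also have "\<dots> = j (Suc i) ` {x \<in> carr (X (Suc i)). d i x = 0}"
      by (rule kernel) (use i in simp)
    also have "\<dots> = (if Suc i = n then {0} else d' (Suc i) ` carr (Y (Suc (Suc i))))"
      using ex i dimg[of "Suc i"] j0[of "Suc i"] by (auto simp: exact_sequence_def)
    finally show "{x \<in> carr (Y (Suc i)). d' i x = 0} = (if Suc i = n then {0} else d' (Suc i) ` carr (Y (Suc (Suc i))))" .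
  qed
  moreover have "bimod_hom A (Y (Suc i)) (Y i) (d' i)" if "i < n" for i
    unfolding d'_def
    by (rule bimod_hom_comp[OF ret(2) bimod_hom_comp[OF d ret(3)]]) (use that in simp_all)
  moreover have "bimod_hom A (Y 0) (regular_bimod A) e'"
    unfolding e'_def by (rule bimod_hom_comp[OF e ret(3)]) simp_all
  moreover have "\<forall>i\<le>n. fg_projective_bimod A (Y i)" using ret(1) by blast
  ultimately show ?thesis unfolding smooth_algebra_def using A by blast
qed

section \<open>Exactness and direct summands\<close>

lemma vs_minus: "is_vs V \<Longrightarrow> x \<in> carr V \<Longrightarrow> - x \<in> carr V"
  by (metis vs_scl scl_minus_one)

text \<open>The support is grouped by its second components, and \<open>x c\<close> is the sum over
  one group, hence 0 when the group is empty. Together with \<open>tensor_basis_sum_zero\<close>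
  this presents X \<otimes> A as a direct sum of copies of X, one for each basis vector of A, so
  that exactness can be checked on coefficients.\<close>

lemma tensor_basis_expand:
  assumes X: "is_vs X" and A: "is_vs A" and t: "t \<in> carr (X \<otimes>\<^sub>v A)"
  obtains C x where "finite C" "C \<subseteq> vbasis A" "\<forall>c. x c \<in> carr X" "t = (\<Sum>c\<in>C. tens X A (x c) c)"
proof
  let ?k = "Poly_Mapping.keys t"
  let ?C = "snd ` ?k" and ?x = "\<lambda>c. \<Sum>p\<in>{p \<in> ?k. snd p = c}. scl X (Poly_Mapping.lookup t p) (fst p)"
  have s: "scl X (Poly_Mapping.lookup t p) (fst p) \<in> carr X" if "p \<in> ?k" for p
    by (rule vs_scl[OF X keys_carr(1)[OF X A t that]])
  show "finite ?C" "?C \<subseteq> vbasis A" using keys_tensor(2)[OF t] by auto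
  show "\<forall>c. ?x c \<in> carr X" by (intro allI vs_sum[OF X]) (use s in auto)
  have sm: "tens X A (?x c) c = (\<Sum>p\<in>{p \<in> ?k. snd p = c}. tens X A (scl X (Poly_Mapping.lookup t p) (fst p)) (snd p))"
    if "c \<in> ?C" for c
  proof -
    have c: "c \<in> carr A" using that keys_carr(2)[OF X A t] by auto
    have "tens X A (?x c) c = (\<Sum>p\<in>{p \<in> ?k. snd p = c}. tens X A (scl X (Poly_Mapping.lookup t p) (fst p)) c)"
      by (rule lin_setsum[OF X bilin_lin1[OF tens_bilin[OF X A] lin_ident c]]) (use s in auto)
    then show ?thesis by simp
  qed
  have "t = (\<Sum>p\<in>?k. tens X A (scl X (Poly_Mapping.lookup t p) (fst p)) (snd p))"
    by (subst tensor_expand[OF X A t], rule sum.cong[OF refl],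
        rule lin_scl[OF bilin_lin1[OF tens_bilin[OF X A] lin_ident keys_carr(2)[OF X A t]] keys_carr(1)[OF X A t], symmetric])
  also have "\<dots> = (\<Sum>c\<in>?C. \<Sum>p\<in>{p \<in> ?k. snd p = c}. tens X A (scl X (Poly_Mapping.lookup t p) (fst p)) (snd p))"
    by (rule sum.group[symmetric]) auto
  also have "\<dots> = (\<Sum>c\<in>?C. tens X A (?x c) c)" by (rule sum.cong[OF refl]) (simp only: sm)
  finally show "t = (\<Sum>c\<in>?C. tens X A (?x c) c)" .
qed

lemma tmap_basis_sum:
  assumes X: "is_vs X" and Y: "is_vs Y" and A: "is_vs A" and f: "lin X Y f"
    and C: "finite C" "C \<subseteq> vbasis A" and x: "\<And>c. c \<in> C \<Longrightarrow> x c \<in> carr X"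
  shows "tmap Y A f id (\<Sum>c\<in>C. tens X A (x c) c) = (\<Sum>c\<in>C. tens Y A (f (x c)) c)"
proof -
  have "c \<in> carr A" if "c \<in> C" for c using that C(2) vbasis(1)[OF A] by blast
  then show ?thesis
    by (subst lin_setsum[OF tensor_is_vs tmap_lin[OF X A Y A f lin_id] C(1)])
      (auto intro!: tens_in X A sum.cong tmap_tens[OF X A Y A f lin_id, simplified] x)
qed

text \<open>The linear map u \<otimes> a \<mapsto> \<open>coord A a c\<close> u picks out the
  coefficient at c, so an expansion along a basis of A has unique coefficients.\<close>

lemma tensor_basis_sum_zero:
  assumes Y: "is_vs Y" and A: "is_vs A" and C: "finite C" "C \<subseteq> vbasis A" and y: "\<And>c. c \<in> C \<Longrightarrow> y c \<in> carr Y"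
    and z: "(\<Sum>c\<in>C. tens Y A (y c) c) = 0" and c: "c \<in> C"
  shows "y c = 0"
proof -
  let ?s = "tlift Y (\<lambda>u a. scl Y (coord A a c) u)"
  have C': "c \<in> carr A" if "c \<in> C" for c using that C(2) vbasis(1)[OF A] by blast
  have l: "lin A base_field (\<lambda>a. coord A a c)"
    unfolding lin_def by (simp add: coord_add[OF A] coord_scl[OF A])
  have b: "bilin Y A Y (\<lambda>u a. scl Y (coord A a c) u)"
    by (rule bilinI; (assumption | rule lin_scale lin_scale_left Y lin_ident l)+)
  note L = tlift_lin[OF Y A Y b]
  have "0 = ?s (\<Sum>c\<in>C. tens Y A (y c) c)" using z lin_0[OF tensor_is_vs L] by simp
  also have "\<dots> = (\<Sum>d\<in>C. ?s (tens Y A (y d) d))"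
    by (rule lin_setsum[OF tensor_is_vs L C(1)]) (rule tens_in[OF Y A])
  also have "\<dots> = (\<Sum>d\<in>C. if d = c then y c else 0)"
  proof (rule sum.cong[OF refl])
    fix d assume d: "d \<in> C"
    have "scl Y 0 u = 0" for u
      using Y unfolding is_vs_def by (metis module.scale_zero_left module_iff_vector_space)
    then show "?s (tens Y A (y d) d) = (if d = c then y c else 0)"
      using tlift_tens[OF Y A Y b y[OF d] C'[OF d]] coord_of_basis[OF A subsetD[OF C(2) d]] by (auto simp: scl_one[OF Y])
  qed
  also have "\<dots> = y c" using C(1) c by simp
  finally show ?thesis by simp
qed

text \<open>Both maps act on coefficients. A tensor in the kernel has all its coefficients in the
  kernel of f, and preimages under g are chosen one basis vector at a time.\<close>

lemma tensor_ker:
  assumes X: "is_vs X" and Y: "is_vs Y" and A: "is_vs A" and W: "is_vs W" and f: "lin X Y f" and g: "lin W X g"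
    and ex: "{x \<in> carr X. f x = 0} = g ` carr W"
  shows "{t \<in> carr (X \<otimes>\<^sub>v A). tmap Y A f id t = 0} = tmap X A g id ` carr (W \<otimes>\<^sub>v A)"
proof (intro equalityI subsetI)
  fix t assume "t \<in> {t \<in> carr (X \<otimes>\<^sub>v A). tmap Y A f id t = 0}"
  then have t: "t \<in> carr (X \<otimes>\<^sub>v A)" and z: "tmap Y A f id t = 0" by auto
  obtain C x where C: "finite C" "C \<subseteq> vbasis A" "\<forall>c. x c \<in> carr X" "t = (\<Sum>c\<in>C. tens X A (x c) c)"
    by (rule tensor_basis_expand[OF X A t]) blast
  have "f (x c) = 0" if "c \<in> C" for c
    by (rule tensor_basis_sum_zero[OF Y A C(1,2) _ _ that]) (use z C lin_in[OF f] in \<open>simp_all add: tmap_basis_sum[OF X Y A f]\<close>)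
  then have "x c \<in> g ` carr W" if "c \<in> C" for c
    using C(3) that unfolding ex[symmetric] by simp
  then have "\<forall>c\<in>C. \<exists>w. w \<in> carr W \<and> g w = x c" by fastforce
  from bchoice[OF this] obtain w where w: "\<And>c. c \<in> C \<Longrightarrow> w c \<in> carr W" "\<And>c. c \<in> C \<Longrightarrow> g (w c) = x c" by blast
  have "t = tmap X A g id (\<Sum>c\<in>C. tens W A (w c) c)"
    unfolding C(4) by (subst tmap_basis_sum[OF W X A g C(1,2)]) (auto simp: w intro!: sum.cong)
  moreover have "(\<Sum>c\<in>C. tens W A (w c) c) \<in> carr (W \<otimes>\<^sub>v A)"
    by (rule vs_sum[OF tensor_is_vs tens_in[OF W A]])
  ultimately show "t \<in> tmap X A g id ` carr (W \<otimes>\<^sub>v A)" by blast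
next
  fix t assume "t \<in> tmap X A g id ` carr (W \<otimes>\<^sub>v A)"
  then obtain s where s: "s \<in> carr (W \<otimes>\<^sub>v A)" "t = tmap X A g id s" by blast
  obtain C x where C: "finite C" "C \<subseteq> vbasis A" "\<forall>c. x c \<in> carr W" "s = (\<Sum>c\<in>C. tens W A (x c) c)"
    by (rule tensor_basis_expand[OF W A s(1)]) blast
  have "g (x c) \<in> {x \<in> carr X. f x = 0}" for c unfolding ex using C(3) by simp
  then have gx: "g (x c) \<in> carr X" "f (g (x c)) = 0" for c by simp_all
  have "tmap Y A f id t = (\<Sum>c\<in>C. tens Y A 0 c)"
    unfolding s(2) C(4) tmap_basis_sum[OF W X A g C(1,2) C(3)[rule_format]] tmap_basis_sum[OF X Y A f C(1,2) gx(1)] gx(2) ..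
  also have "\<dots> = 0"
    using C(2) vbasis(1)[OF A] by (intro sum.neutral ballI lin_0[OF Y bilin_lin1[OF tens_bilin[OF Y A] lin_ident]]) blast
  finally show "t \<in> {t \<in> carr (X \<otimes>\<^sub>v A). tmap Y A f id t = 0}"
    using lin_in[OF tmap_lin[OF W A X A g lin_id] s(1)] s(2) by simp
qed

text \<open>This treats the left end of the resolution, where \<open>exact_sequence\<close> has {0}
  in place of the image of a further differential.\<close>

lemma tensor_ker_zero:
  assumes X: "is_vs X" and Y: "is_vs Y" and A: "is_vs A" and f: "lin X Y f" and ex: "{x \<in> carr X. f x = 0} = {0}"
  shows "{t \<in> carr (X \<otimes>\<^sub>v A). tmap Y A f id t = 0} = {0}"
proof -
  have "t = 0" if t: "t \<in> carr (X \<otimes>\<^sub>v A)" and z: "tmap Y A f id t = 0" for t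
  proof -
    obtain C x where C: "finite C" "C \<subseteq> vbasis A" "\<forall>c. x c \<in> carr X" "t = (\<Sum>c\<in>C. tens X A (x c) c)"
      by (rule tensor_basis_expand[OF X A t]) blast
    have "f (x c) = 0" if "c \<in> C" for c
      by (rule tensor_basis_sum_zero[OF Y A C(1,2) _ _ that]) (use z C lin_in[OF f] in \<open>simp_all add: tmap_basis_sum[OF X Y A f]\<close>)
    then have x0: "x c = 0" if "c \<in> C" for c using ex C(3)[rule_format] that by fastforce
    show "t = 0"
      unfolding C(4) using C(2) vbasis(1)[OF A] x0
      by (intro sum.neutral ballI) (auto intro!: lin_0[OF X bilin_lin1[OF tens_bilin[OF X A] lin_ident]])
  qed
  then show ?thesis
    using vs_zero[OF tensor_is_vs, of X A] lin_0[OF tensor_is_vs tmap_lin[OF X A Y A f lin_id]] by blast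
qed

lemma tensor_surj:
  assumes X: "is_vs X" and Y: "is_vs Y" and A: "is_vs A" and f: "lin X Y f" and ex: "f ` carr X = carr Y"
  shows "tmap Y A f id ` carr (X \<otimes>\<^sub>v A) = carr (Y \<otimes>\<^sub>v A)"
proof (intro equalityI subsetI)
  fix t assume t: "t \<in> carr (Y \<otimes>\<^sub>v A)"
  obtain C y where C: "finite C" "C \<subseteq> vbasis A" "\<forall>c. y c \<in> carr Y" "t = (\<Sum>c\<in>C. tens Y A (y c) c)"
    by (rule tensor_basis_expand[OF Y A t]) blast
  have "y c \<in> f ` carr X" for c using C(3) unfolding ex by simp
  then have "\<forall>c. \<exists>x. x \<in> carr X \<and> y c = f x" by (simp add: image_iff Bex_def)
  from choice[OF this] obtain x where "\<forall>c. x c \<in> carr X \<and> y c = f (x c)" ..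
  then have x: "x c \<in> carr X" "f (x c) = y c" for c by simp_all
  have "t = tmap Y A f id (\<Sum>c\<in>C. tens X A (x c) c)"
    unfolding C(4) tmap_basis_sum[OF X Y A f C(1,2) x(1)] x(2) ..
  moreover have "(\<Sum>c\<in>C. tens X A (x c) c) \<in> carr (X \<otimes>\<^sub>v A)"
    by (rule vs_sum[OF tensor_is_vs tens_in[OF X A]])
  ultimately show "t \<in> tmap Y A f id ` carr (X \<otimes>\<^sub>v A)" by blast
next
  fix t assume "t \<in> tmap Y A f id ` carr (X \<otimes>\<^sub>v A)"
  then show "t \<in> carr (Y \<otimes>\<^sub>v A)" using lin_in[OF tmap_lin[OF X A Y A f lin_id]] by blast
qed

section \<open>Splitting direct summands, finite bases\<close>

lemma rmod_homD:
  assumes "rmod_hom H A M N f"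
  shows "colinear H M N f" "lin M N f" "\<And>a v. a \<in> carr A \<Longrightarrow> v \<in> carr M \<Longrightarrow> f (act M a v) = act N a (f v)"
  using assms by (auto simp: rmod_hom_def colinear_def)

lemma rmod_hom_comp:
  assumes H: "is_vs H" and X: "is_vs X" "lin X (X \<otimes>\<^sub>v H) (coact X)" and Y: "is_vs Y" and Z: "is_vs Z"
    and f: "rmod_hom H A X Y f" and g: "rmod_hom H A Y Z g"
  shows "rmod_hom H A X Z (\<lambda>x. g (f x))"
proof -
  note fD = rmod_homD[OF f] and gD = rmod_homD[OF g]
  have "coact Z (g (f x)) = tmap Z H (\<lambda>x. g (f x)) id (coact X x)" if x: "x \<in> carr X" for x
  proof -
    have "coact Z (g (f x)) = tmap Z H g id (tmap Y H f id (coact X x))"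
      using fD(1) gD(1) x lin_in[OF fD(2) x] by (simp add: colinear_def)
    also have "\<dots> = tmap Z H (\<lambda>x. g (f x)) id (coact X x)"
      unfolding tmap_tmap[OF lin_in[OF X(2) x] X(1) H Y H Z H fD(2) lin_id gD(2) lin_id] by (simp add: id_def)
    finally show ?thesis .
  qed
  then show ?thesis
    unfolding rmod_hom_def colinear_def
    using lin_comp[OF gD(2) fD(2)] fD(3) gD(3) lin_in[OF fD(2)] by simp
qed

text \<open>Both subobjects inherit scalars, action and coaction through their inclusions, so these
  respect the decomposition, and the projection along the complement is a morphism.\<close>

lemma rmod_summand_projection:
  assumes H: "is_vs H" and M: "is_vs M" "lin M (M \<otimes>\<^sub>v H) (coact M)" "\<And>a. a \<in> carr A \<Longrightarrow> lin M M (act M a)"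
    and Q: "rmod_summand H A Q M"
  obtains p where "rmod_hom H A M Q p" "\<And>x. x \<in> carr Q \<Longrightarrow> p x = x"
proof -
  obtain Q' where Qr: "is_rmod H A Q" "is_rmod H A Q'" and h: "rmod_hom H A Q M id" "rmod_hom H A Q' M id"
    and ds: "internal_direct_sum (carr Q) (carr Q') (carr M)"
    using Q unfolding rmod_summand_def by blast
  have vs: "is_vs Q" "is_vs Q'" and coQ: "lin Q (Q \<otimes>\<^sub>v H) (coact Q)" "lin Q' (Q' \<otimes>\<^sub>v H) (coact Q')"
    and aQ: "bilin A Q Q (act Q)" "bilin A Q' Q' (act Q')"
    using Qr by (auto simp: is_rmod_def is_comodule_def)
  have int: "carr Q \<inter> carr Q' = {0}" and sum: "carr M = {x + y | x y. x \<in> carr Q \<and> y \<in> carr Q'}"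
    using ds by (auto simp: internal_direct_sum_def)
  have sM: "x \<in> carr M" if "x \<in> carr Q" for x using lin_in[OF rmod_homD(2)[OF h(1)] that] by simp
  have sM': "x \<in> carr M" if "x \<in> carr Q'" for x using lin_in[OF rmod_homD(2)[OF h(2)] that] by simp
  have sc: "scl M c x = scl Q c x" if "x \<in> carr Q" for c x using lin_scl[OF rmod_homD(2)[OF h(1)] that] by simp
  have sc': "scl M c x = scl Q' c x" if "x \<in> carr Q'" for c x using lin_scl[OF rmod_homD(2)[OF h(2)] that] by simp
  \<comment> \<open>The component in \<open>carr Q\<close>. It is unique because the difference of
    two candidates lies in both summands.\<close>
  define p where "p x = (THE y. y \<in> carr Q \<and> (\<exists>z\<in>carr Q'. x = y + z))" for x
  have p: "p (y + z) = y" if yz: "y \<in> carr Q" "z \<in> carr Q'" for y z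
    unfolding p_def
  proof (rule the_equality)
    show "y \<in> carr Q \<and> (\<exists>z'\<in>carr Q'. y + z = y + z')" using yz by blast
    fix u assume "u \<in> carr Q \<and> (\<exists>z'\<in>carr Q'. y + z = u + z')"
    then obtain z' where u: "u \<in> carr Q" "z' \<in> carr Q'" "y + z = u + z'" by blast
    have "u + - y = z + - z'" using u(3) by (simp add: algebra_simps)
    then have "u + - y \<in> carr Q \<inter> carr Q'"
      using vs_add[OF vs(1) u(1) vs_minus[OF vs(1) yz(1)]] vs_add[OF vs(2) yz(2) vs_minus[OF vs(2) u(2)]] by simp
    then show "u = y" using int by simp
  qed
  have pQ: "p x = x" if "x \<in> carr Q" for x using p[OF that vs_zero[OF vs(2)]] by simp
  have pQ': "p x = 0" if "x \<in> carr Q'" for x using p[OF vs_zero[OF vs(1)] that] by simp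
  have dec: thesis if x: "x \<in> carr M" and t: "\<And>y z. y \<in> carr Q \<Longrightarrow> z \<in> carr Q' \<Longrightarrow> x = y + z \<Longrightarrow> thesis" for x thesis
  proof -
    from x[unfolded sum] obtain y z where "y \<in> carr Q" "z \<in> carr Q'" "x = y + z" by blast
    then show thesis by (rule t)
  qed
  have pl: "lin M Q p"
    unfolding lin_def
  proof (intro conjI ballI allI)
    show "p x \<in> carr Q" if "x \<in> carr M" for x
      by (rule dec[OF that]) (simp add: p)
    show "p (x + x') = p x + p x'" if "x \<in> carr M" "x' \<in> carr M" for x x'
    proof (rule dec[OF that(1)], rule dec[OF that(2)])
      fix y z y' z' assume a: "y \<in> carr Q" "z \<in> carr Q'" "x = y + z" "y' \<in> carr Q" "z' \<in> carr Q'" "x' = y' + z'"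
      have "x + x' = (y + y') + (z + z')" using a by (simp add: algebra_simps)
      then have "p (x + x') = y + y'" using p[OF vs_add[OF vs(1) a(1,4)] vs_add[OF vs(2) a(2,5)]] by (simp only:)
      then show ?thesis using a by (simp add: p)
    qed
    show "p (scl M c x) = scl Q c (p x)" if "x \<in> carr M" for c x
    proof (rule dec[OF that])
      fix y z assume a: "y \<in> carr Q" "z \<in> carr Q'" "x = y + z"
      have "scl M c x = scl Q c y + scl Q' c z" using a by (simp add: scl_add_right[OF M(1)] sc sc')
      then show ?thesis using p[OF vs_scl[OF vs(1) a(1)] vs_scl[OF vs(2) a(2)]] a by (simp add: p)
    qed
  qed
  have pa: "p (act M a x) = act Q a (p x)" if "a \<in> carr A" "x \<in> carr M" for a x
  proof (rule dec[OF that(2)])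
    fix y z assume b: "y \<in> carr Q" "z \<in> carr Q'" "x = y + z"
    have "act M a x = act Q a y + act Q' a z"
      using rmod_homD(3)[OF h(1) that(1) b(1)] rmod_homD(3)[OF h(2) that(1) b(2)]
      by (simp add: b(3) lin_add[OF M(3)[OF that(1)] sM[OF b(1)] sM'[OF b(2)]])
    then show ?thesis using p[OF bilin_in[OF aQ(1) that(1) b(1)] bilin_in[OF aQ(2) that(1) b(2)]] b by (simp add: p)
  qed
  have pc: "coact Q (p x) = tmap Q H p id (coact M x)" if "x \<in> carr M" for x
  proof (rule dec[OF that])
    fix y z assume b: "y \<in> carr Q" "z \<in> carr Q'" "x = y + z"
    \<comment> \<open>The tensor \<open>coact Q y\<close> is written in the chosen basis of Q and
      \<open>coact M y\<close> in that of M. The map \<open>tmap M H id id\<close> is thus a real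
      change of model, and it is removed only by composing it with
      \<open>tmap Q H p id\<close>.\<close>
    have cy: "coact M y = tmap M H id id (coact Q y)" and cz: "coact M z = tmap M H id id (coact Q' z)"
      using h b unfolding rmod_hom_def colinear_def by auto
    note ty = lin_in[OF coQ(1) b(1)] and tz = lin_in[OF coQ(2) b(2)]
    have "tmap Q H p id (coact M y) = coact Q y"
      unfolding cy tmap_tmap[OF ty vs(1) H M(1) H vs(1) H rmod_homD(2)[OF h(1)] lin_id pl lin_id]
      by (rule tmap_ident[OF vs(1) H ty]) (simp_all add: pQ)
    moreover have "tmap Q H p id (coact M z) = 0"
    proof -
      have "tmap Q H p id (coact M z) = tlift (Q \<otimes>\<^sub>v H) (\<lambda>v w. 0) (coact Q' z)"
        unfolding cz tmap_tmap[OF tz vs(2) H M(1) H vs(1) H rmod_homD(2)[OF h(2)] lin_id pl lin_id] unfolding tmap_def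
        by (rule tlift_cong[OF tz vs(2) H])
          (simp add: pQ' lin_0[OF vs(1) bilin_lin1[OF tens_bilin[OF vs(1) H] lin_ident]])
      then show ?thesis by (simp add: tlift_def scl_zero_right[OF tensor_is_vs])
    qed
    ultimately show ?thesis
      using b by (simp add: p lin_add[OF M(2) sM sM'] lin_add[OF tmap_lin[OF M(1) H vs(1) H pl lin_id] lin_in[OF M(2) sM] lin_in[OF M(2) sM']])
  qed
  show thesis
    by (rule that[of p]) (simp_all add: rmod_hom_def colinear_def pl pa pc pQ)
qed

lemma finite_vbasis:
  assumes V: "is_vs V" and "finite_dim V"
  shows "finite (vbasis V)"
proof -
  interpret vector_space "scl V" using V by (simp add: is_vs_def)
  obtain B where "finite B" "B \<subseteq> carr V" "span B = carr V" using assms(2) by (auto simp: finite_dim_def)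
  then have "vbasis V \<subseteq> span B" using vbasis(1)[OF V] by simp
  with \<open>finite B\<close> show ?thesis
    using independent_span_bound[OF _ vbasis(2)[OF V]] by simp
qed

text \<open>The basis is listed by the numbers below m because \<open>free_bimod\<close> indexes its
  summands in this way.\<close>

lemma basis_enumeration:
  assumes V: "is_vs V" "finite_dim V"
  obtains m :: nat and e where "\<And>i. i < m \<Longrightarrow> e i \<in> carr V"
    "\<And>x. x \<in> carr V \<Longrightarrow> (\<Sum>i<m. scl V (coord V x (e i)) (e i)) = x"
proof -
  note fin = finite_vbasis[OF V]
  obtain e where e: "bij_betw e {0..<card (vbasis V)} (vbasis V)" using ex_bij_betw_nat_finite[OF fin] by blast
  show thesis
  proof (rule that[of "card (vbasis V)" e])
    show "e i \<in> carr V" if "i < card (vbasis V)" for i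
      using bij_betwE[OF e] that vbasis(1)[OF V(1)] by auto
    show "(\<Sum>i<card (vbasis V). scl V (coord V x (e i)) (e i)) = x" if x: "x \<in> carr V" for x
    proof -
      have z: "scl V 0 u = 0" for u
        using V(1) unfolding is_vs_def by (metis module.scale_zero_left module_iff_vector_space)
      have "(\<Sum>i<card (vbasis V). scl V (coord V x (e i)) (e i)) = (\<Sum>b\<in>vbasis V. scl V (coord V x b) b)"
        using sum.reindex_bij_betw[OF e, of "\<lambda>b. scl V (coord V x b) b"] by (simp add: atLeast0LessThan)
      also have "\<dots> = (\<Sum>b | coord V x b \<noteq> 0. scl V (coord V x b) b)"
        by (rule sum.mono_neutral_right) (use fin coord_basis[OF V(1)] z in auto)
      finally show ?thesis using coord_expand[OF V(1) x] by simp
    qed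
  qed
qed

section \<open>Relative projectives and the trivial module\<close>

lemma tlift_sum:
  assumes "is_vs Z"
  shows "(\<Sum>i\<in>I. tlift Z (f i) t) = tlift Z (\<lambda>x y. \<Sum>i\<in>I. f i x y) t"
  unfolding tlift_def by (subst sum.swap) (simp add: scl_sum_right[OF assms])

lemma free_rmod_simps [simp]:
  "carr (free_rmod H A V) = carr (A \<otimes>\<^sub>v V)" "scl (free_rmod H A V) = scl (A \<otimes>\<^sub>v V)"
  "coact (free_rmod H A V) = coact (tensor_comod H (comod_of A) V)" "act (free_rmod H A V) a = tmap A V (mul A a) id"
  by (simp_all add: free_rmod_def tensor_comod_def Let_def)

lemmas free_rmod_congs = vs_congs[OF free_rmod_simps(1,2)]

lemma trivial_rmod_simps [simp]:
  "carr (trivial_rmod H A) = UNIV" "scl (trivial_rmod H A) = (*)" "act (trivial_rmod H A) a x = counit A a * x"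
  "coact (trivial_rmod H A) c = tens base_field H c (one H)"
  by (simp_all add: trivial_rmod_def unit_comod_def)

lemma trivial_rmod_congs:
  "carr (trivial_rmod H A) = carr base_field" "scl (trivial_rmod H A) = scl base_field"
  by simp_all

context braided_hopf
begin

lemma shear_sum:
  assumes "is_vs Z"
  shows "(\<Sum>i\<in>I. shear Z M s (F i) a m c) = shear Z M s (\<lambda>a m c. \<Sum>i\<in>I. F i a m c) a m c"
  unfolding shear_def by (simp add: tlift_sum[OF assms])

lemma shear_natural:
  assumes M: "is_vs M" "lin M (M \<otimes>\<^sub>v H) (coact M)" and N: "is_vs N" "lin N (N \<otimes>\<^sub>v H) (coact N)"
    and f: "colinear H M N f" and s: "lin A A s" and Z: "is_vs Z" and F: "trilin A N A Z F"
    and a: "a \<in> carr A" "m \<in> carr M" "c \<in> carr A"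
  shows "shear Z N s F a (f m) c = shear Z M s (\<lambda>a m c. F a (f m) c) a m c"
  unfolding shear_def
proof (rule tlift_cong[OF lin_in[OF A_comul a(1)] A_vs A_vs])
  fix a1 a2 assume 1: "a1 \<in> carr A" "a2 \<in> carr A"
  show "tlift Z (\<lambda>m' a'. F a1 m' (mul A a' c)) (bra N (s a2) (f m))
    = tlift Z (\<lambda>m' a'. F a1 (f m') (mul A a' c)) (bra M (s a2) m)"
    by (rule braid_natural[OF M N f lin_in[OF s 1(2)] a(2) Z])
      (assumption | rule bilinI trilin_lin2[OF F] trilin_lin3[OF F] lin_rules 1 a)+
qed

text \<open>The left action is made of the action of A and the braiding. The map f preserves the
  first, and the second by naturality.\<close>

lemma bimod_of_hom:
  assumes M: "is_rmod H A M" and N: "is_rmod H A N" and f: "rmod_hom H A M N f"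
  shows "bimod_hom A (bimod_of M) (bimod_of N) (tmap N A f id)"
proof -
  note MD = is_rmodD[OF M] and ND = is_rmodD[OF N] and fD = rmod_homD[OF f]
  note tl = tmap_lin[OF MD(2) A_vs ND(2) A_vs fD(2) lin_id]
  note tt = tmap_tens[OF MD(2) A_vs ND(2) A_vs fD(2) lin_id, simplified]
  note E = lin_eqI[OF _ MD(2) A_vs tensor_is_vs]
  have act: "tmap N A f id (bimod_act M a t) = bimod_act N a (tmap N A f id t)"
    if a: "a \<in> carr A" and t: "t \<in> carr (M \<otimes>\<^sub>v A)" for a t
  proof (rule E[OF t])
    fix m c assume m: "m \<in> carr M" "c \<in> carr A"
    have "tmap N A f id (bimod_act M a (tens M A m c))
      = shear (N \<otimes>\<^sub>v A) M (\<lambda>x. x) (\<lambda>b m c. tmap N A f id (tens M A (act M b m) c)) a m c"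
      unfolding bimod_act_tens[OF M a m]
      by (rule lin_shear[OF tl tensor_is_vs tensor_is_vs MD(2,3) lin_ident act_tens_trilin[OF MD(2,4)] a m])
    also have "\<dots> = shear (N \<otimes>\<^sub>v A) M (\<lambda>x. x) (\<lambda>b m c. tens N A (act N b (f m)) c) a m c"
      by (rule shear_cong[OF MD(2,3) lin_ident _ a m]) (simp add: tt bilin_in[OF MD(4)] fD(3))
    also have "\<dots> = bimod_act N a (tmap N A f id (tens M A m c))"
      unfolding tt[OF m] bimod_act_tens[OF N a lin_in[OF fD(2) m(1)] m(2)]
      by (rule shear_natural[OF MD(2,3) ND(2,3) fD(1) lin_ident tensor_is_vs act_tens_trilin[OF ND(2,4)] a m, symmetric])
    finally show "tmap N A f id (bimod_act M a (tens M A m c)) = bimod_act N a (tmap N A f id (tens M A m c))" .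
  qed (rule lin_comp[OF tl] bilin_lin2[OF bimod_act_bilin[OF M] a lin_ident] bilin_lin2[OF bimod_act_bilin[OF N] a] tl)+
  have ract: "tmap N A f id (tmap M A id (\<lambda>y. mul A y b) t) = tmap N A id (\<lambda>y. mul A y b) (tmap N A f id t)"
    if b: "b \<in> carr A" and t: "t \<in> carr (M \<otimes>\<^sub>v A)" for b t
  proof (rule E[OF t])
    fix m c assume m: "m \<in> carr M" "c \<in> carr A"
    then show "tmap N A f id (tmap M A id (\<lambda>y. mul A y b) (tens M A m c))
      = tmap N A id (\<lambda>y. mul A y b) (tmap N A f id (tens M A m c))"
      by (simp add: ract_tens[OF MD(2)] ract_tens[OF ND(2)] b tt bilin_in[OF A_mul] lin_in[OF fD(2)])
  qed (rule lin_comp[OF tl] bilin_lin1[OF ract_lin[OF MD(2)] lin_ident b] bilin_lin1[OF ract_lin[OF ND(2)] _ b] tl)+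
  have "lin (bimod_of M) (bimod_of N) (tmap N A f id)"
    using tl by (simp add: lin_def)
  then show ?thesis unfolding bimod_hom_def using act ract by simp
qed

text \<open>A scalar c coacts by c \<otimes> 1 and r(x, 1) = \<epsilon>(x), so the weight disappears
  by the counit axiom for the coaction of a.\<close>

lemma braid_trivial:
  assumes Z: "is_vs Z" and f: "bilin base_field A Z f" and a: "a \<in> carr A"
    and M: "is_rmod H A (trivial_rmod H A)"
  shows "tlift Z f (bra (trivial_rmod H A) a c) = f c a"
proof -
  note MD = is_rmodD[OF M]
  note ca = lin_in[OF A_coaction a]
  have fl: "lin A Z (f c)" using f by (simp add: bilin_def)
  have f': "bilin (trivial_rmod H A) A Z f" using f by (simp add: bilin_def lin_def)
  have "tlift Z f (bra (trivial_rmod H A) a c) = tlift Z (\<lambda>a0 a1. tlift Z (\<lambda>m0 m1.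
      scl Z (r a1 m1) (f m0 a0)) (tens base_field H c (one H))) (coaction A a)"
    using tlift_braid[OF MD(2,3) a _ Z f'] by simp
  also have "\<dots> = tlift Z (\<lambda>a0 a1. f c (scl A (counit H a1) a0)) (coaction A a)"
  proof (rule tlift_cong[OF ca A_vs H_vs])
    fix a0 a1 assume 1: "a0 \<in> carr A" "a1 \<in> carr H"
    have "tlift Z (\<lambda>m0 m1. scl Z (r a1 m1) (f m0 a0)) (tens base_field H c (one H)) = scl Z (r a1 (one H)) (f c a0)"
      by (rule tlift_tens[OF base_field_is_vs H_vs Z])
        (assumption | rule bilinI lin_rules Z 1 bilin_lin1[OF f] bilin_in[OF f] | simp)+
    then show "tlift Z (\<lambda>m0 m1. scl Z (r a1 m1) (f m0 a0)) (tens base_field H c (one H)) = f c (scl A (counit H a1) a0)"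
      by (simp add: r_one 1 lin_scl[OF fl])
  qed
  also have "\<dots> = f c (tlift A (\<lambda>a0 a1. scl A (counit H a1) a0) (coaction A a))"
    by (rule lin_tlift[OF fl A_vs H_vs A_vs Z ca, symmetric]) (rule vs_scl[OF A_vs])
  also have "\<dots> = f c a" using A_comodule a by (simp add: is_comodule_def)
  finally show ?thesis .
qed

text \<open>On k \<otimes> A the leg \<open>a1\<close> acts by its counit and \<open>a2\<close>
  crosses the scalar freely, so the counit axiom of \<Delta> reduces the diagonal action to left
  multiplication.\<close>

lemma bimod_of_trivial:
  assumes M: "is_rmod H A (trivial_rmod H A)"
  defines "h \<equiv> tlift A (scl A)"
  shows "bimod_hom A (bimod_of (trivial_rmod H A)) (regular_bimod A) h"
    and "bij_betw h (carr (bimod_of (trivial_rmod H A))) (carr A)"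
proof -
  let ?M = "trivial_rmod H A"
  note MD = is_rmodD[OF M]
  note congs = vs_congs[OF trivial_rmod_congs[of H A]]
  note E = lin_eqI[OF _ MD(2) A_vs A_vs]
  have sb: "bilin ?M A A (scl A)"
    using lin_scale_left[OF A_vs lin_ident] lin_scale[OF A_vs lin_ident] by (auto intro!: bilinI simp: congs)
  note hl = tlift_lin[OF MD(2) A_vs A_vs sb, folded h_def]
  have ht: "h (tens ?M A c a) = scl A c a" if "a \<in> carr A" for c a
    unfolding h_def by (rule tlift_tens[OF MD(2) A_vs A_vs sb _ that]) simp
  note lr = lin_comp[OF hl] hl bilin_lin2[OF A_mul] bilin_lin1[OF A_mul]
  have act: "h (bimod_act ?M a t) = mul A a (h t)" if a: "a \<in> carr A" and t: "t \<in> carr (?M \<otimes>\<^sub>v A)" for a t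
  proof (rule E[OF t])
    fix m c assume m: "m \<in> carr ?M" "c \<in> carr A"
    have "h (bimod_act ?M a (tens ?M A m c)) = shear A ?M (\<lambda>x. x) (\<lambda>b m c. h (tens ?M A (act ?M b m) c)) a m c"
      unfolding bimod_act_tens[OF M a m]
      by (rule lin_shear[OF hl tensor_is_vs A_vs MD(2,3) lin_ident act_tens_trilin[OF MD(2,4)] a m])
    also have "\<dots> = shear A ?M (\<lambda>x. x) (\<lambda>b m c. scl A (counit A b * m) c) a m c"
      by (rule shear_cong[OF MD(2,3) lin_ident _ a m]) (simp add: ht)
    also have "\<dots> = tlift A (\<lambda>a1 a2. mul A (scl A (counit A a1) a2) (scl A m c)) (comul A a)"
      unfolding shear_def
    proof (rule tlift_cong[OF lin_in[OF A_comul a] A_vs A_vs])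
      fix a1 a2 assume 1: "a1 \<in> carr A" "a2 \<in> carr A"
      have "tlift A (\<lambda>m' a'. scl A (counit A a1 * m') (mul A a' c)) (bra ?M a2 m) = scl A (counit A a1 * m) (mul A a2 c)"
        by (rule braid_trivial[OF A_vs _ 1(2) M], rule bilinI)
          (assumption | rule lin_scale_left lin_mult_left lin_rules 1 m)+
      also have "\<dots> = mul A (scl A (counit A a1) a2) (scl A m c)"
        by (simp add: lin_scl[OF bilin_lin1[OF A_mul lin_ident]] lin_scl[OF bilin_lin2[OF A_mul _ lin_ident]]
          vs_scl[OF A_vs] 1 m scl_scl[OF A_vs] mult.commute)
      finally show "tlift A (\<lambda>m' a'. scl A (counit A a1 * m') (mul A a' c)) (bra ?M a2 m)
        = mul A (scl A (counit A a1) a2) (scl A m c)" .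
    qed
    also have "\<dots> = mul A (tlift A (\<lambda>a1 a2. scl A (counit A a1) a2) (comul A a)) (scl A m c)"
      by (rule lin_tlift[OF bilin_lin1[OF A_mul lin_ident] A_vs A_vs A_vs A_vs lin_in[OF A_comul a], symmetric])
        (rule vs_scl[OF A_vs] m | assumption)+
    also have "\<dots> = mul A a (h (tens ?M A m c))" using A_coalg a m by (simp add: is_coalgebra_def ht)
    finally show "h (bimod_act ?M a (tens ?M A m c)) = mul A a (h (tens ?M A m c))" .
  qed (rule lr a bilin_lin2[OF bimod_act_bilin[OF M] a lin_ident])+
  have ract: "h (tmap ?M A id (\<lambda>y. mul A y b) t) = mul A (h t) b" if b: "b \<in> carr A" and t: "t \<in> carr (?M \<otimes>\<^sub>v A)" for b t
  proof (rule E[OF t])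
    fix m c assume m: "m \<in> carr ?M" "c \<in> carr A"
    then show "h (tmap ?M A id (\<lambda>y. mul A y b) (tens ?M A m c)) = mul A (h (tens ?M A m c)) b"
      by (simp add: ract_tens[OF MD(2)] b ht bilin_in[OF A_mul] lin_scl[OF bilin_lin1[OF A_mul lin_ident b]])
  qed (rule lr b bilin_lin1[OF ract_lin[OF MD(2)] lin_ident b])+
  have "lin (bimod_of ?M) (regular_bimod A) h"
    using hl by (simp add: lin_def regular_bimod_def)
  then show "bimod_hom A (bimod_of ?M) (regular_bimod A) h"
    unfolding bimod_hom_def using act ract by (simp add: regular_bimod_def)
  \<comment> \<open>The inverse is a \<mapsto> 1 \<otimes> a; on pure tensors the claim just moves
    the scalar across the tensor sign.\<close>
  have inv: "tens ?M A 1 (h t) = t" if t: "t \<in> carr (?M \<otimes>\<^sub>v A)" for t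
  proof (rule lin_eqI[OF t MD(2) A_vs tensor_is_vs])
    note tb = tens_bilin[OF MD(2) A_vs]
    show "lin (?M \<otimes>\<^sub>v A) (?M \<otimes>\<^sub>v A) (\<lambda>t. tens ?M A 1 (h t))" by (rule bilin_lin2[OF tb _ hl]) simp
    show "lin (?M \<otimes>\<^sub>v A) (?M \<otimes>\<^sub>v A) (\<lambda>t. t)" by (rule lin_ident)
    fix c a assume a: "a \<in> carr A"
    have "tens ?M A 1 (scl A c a) = scl (?M \<otimes>\<^sub>v A) c (tens ?M A 1 a)"
      by (rule lin_scl[OF bilin_lin2[OF tb _ lin_ident] a]) simp
    also have "\<dots> = tens ?M A (scl ?M c 1) a"
      by (rule lin_scl[OF bilin_lin1[OF tb lin_ident a], symmetric]) simp
    finally show "tens ?M A 1 (h (tens ?M A c a)) = tens ?M A c a" by (simp add: ht a)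
  qed
  show "bij_betw h (carr (bimod_of ?M)) (carr A)"
    by (rule bij_betw_byWitness[where f' = "\<lambda>a. tens ?M A 1 a"])
      (auto simp: inv ht scl_one[OF A_vs] lin_in[OF hl] tens_in[OF MD(2) A_vs])
qed

section \<open>The object A \<otimes> V, its generators and coordinates\<close>

lemma free_rmod_facts:
  assumes V: "is_comodule H V"
  shows "is_vs (free_rmod H A V)" "lin (free_rmod H A V) (free_rmod H A V \<otimes>\<^sub>v H) (coact (free_rmod H A V))"
    "bilin A V (free_rmod H A V) (tens A V)" "a \<in> carr A \<Longrightarrow> lin (free_rmod H A V) (free_rmod H A V) (act (free_rmod H A V) a)"
proof -
  note VD = is_comoduleD[OF V]
  show "is_vs (free_rmod H A V)" by (simp add: free_rmod_congs tensor_is_vs)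
  show "lin (free_rmod H A V) (free_rmod H A V \<otimes>\<^sub>v H) (coact (free_rmod H A V))"
    using tensor_coact_tens(2)[of "comod_of A" V H "one A"] A_vs VD H_vs H_mul A_coaction A_one vs_zero[OF VD(1)]
    by (simp add: free_rmod_congs)
  show "bilin A V (free_rmod H A V) (tens A V)"
    using tens_bilin[OF A_vs VD(1)] by (simp add: bilin_def free_rmod_congs)
  show "lin (free_rmod H A V) (free_rmod H A V) (act (free_rmod H A V) a)" if "a \<in> carr A"
    using tmap_lin[OF A_vs VD(1) A_vs VD(1) bilin_lin2[OF A_mul that lin_ident] lin_id] by (simp add: free_rmod_congs)
qed

text \<open>The instance of \<open>braid_colinear_image\<close> for the universal bilinear map: a
  crosses the factor A and then V.\<close>

lemma braid_free:
  assumes V: "is_comodule H V" and a: "a \<in> carr A" "b \<in> carr A" "v \<in> carr V" and Z: "is_vs Z"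
    and f: "bilin (free_rmod H A V) A Z f"
  shows "tlift Z f (bra (free_rmod H A V) a (tens A V b v)) = tlift Z (\<lambda>b' a'. tlift Z (\<lambda>v' a''. f (tens A V b' v') a'')
    (bra V a' v)) (bra (comod_of A) a b)"
proof (rule braid_colinear_image[OF V free_rmod_facts(1-3)[OF V] _ a Z f])
  fix b v assume "b \<in> carr A" "v \<in> carr V"
  then show "coact (free_rmod H A V) (tens A V b v) = tlift (free_rmod H A V \<otimes>\<^sub>v H) (\<lambda>b0 b1.
    tlift (free_rmod H A V \<otimes>\<^sub>v H) (\<lambda>v0 v1. tens (free_rmod H A V) H (tens A V b0 v0) (mul H b1 v1)) (coact V v)) (coaction A b)"
    using tensor_coact_tens(1)[of "comod_of A" V H b v] A_vs is_comoduleD[OF V] H_vs H_mul A_coaction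
    by (simp add: free_rmod_congs)
qed

text \<open>The mirror image of \<open>braid_one\<close>: now the right factor coacts by 1 \<otimes>
  1, and r(x, 1) = \<epsilon>(x).\<close>

lemma braid_self_one:
  assumes a: "a \<in> carr A" and Z: "is_vs Z" and f: "bilin A A Z f"
  shows "tlift Z f (bra (comod_of A) a (one A)) = f (one A) a"
proof -
  note ca = lin_in[OF A_coaction a]
  have fl: "lin A Z (f (one A))" by (rule bilin_lin2[OF f A_one lin_ident])
  have "tlift Z f (bra (comod_of A) a (one A)) = tlift Z (\<lambda>a0 a1. f (one A) (scl A (counit H a1) a0)) (coaction A a)"
    unfolding tlift_braid_self[OF a A_one Z f] coaction_one
  proof (rule tlift_cong[OF ca A_vs H_vs])
    fix a0 a1 assume 1: "a0 \<in> carr A" "a1 \<in> carr H"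
    have "tlift Z (\<lambda>b0 b1. scl Z (r a1 b1) (f b0 a0)) (tens A H (one A) (one H)) = scl Z (r a1 (one H)) (f (one A) a0)"
      by (rule tlift_tens[OF A_vs H_vs Z _ A_one H_one])
        (assumption | rule bilinI lin_rules Z 1 bilin_lin1[OF f] bilin_in[OF f])+
    then show "tlift Z (\<lambda>b0 b1. scl Z (r a1 b1) (f b0 a0)) (tens A H (one A) (one H)) = f (one A) (scl A (counit H a1) a0)"
      by (simp add: r_one 1 lin_scl[OF fl])
  qed
  also have "\<dots> = f (one A) (tlift A (\<lambda>a0 a1. scl A (counit H a1) a0) (coaction A a))"
    by (rule lin_tlift[OF fl A_vs H_vs A_vs Z ca, symmetric]) (rule vs_scl[OF A_vs])
  also have "\<dots> = f (one A) a" using A_comodule a by (simp add: is_comodule_def)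
  finally show ?thesis .
qed

text \<open>By \<open>Fl\<close> and \<open>Fr\<close>, F is a bimodule map from A \<otimes> V
  \<otimes> A with its outer actions to A \<otimes> A. Preceding it by the inverse shear and by i
  gives a map that is linear for the diagonal action on P \<otimes> A, because the inverse shear
  turns that action into left multiplication.\<close>

lemma free_coordinate_hom:
  assumes P: "is_rmod H A P" and V: "is_comodule H V" and i: "rmod_hom H A P (free_rmod H A V) i"
    and F: "trilin A V A (A \<otimes>\<^sub>v A) F"
    and Fl: "\<And>a b v c. a \<in> carr A \<Longrightarrow> b \<in> carr A \<Longrightarrow> v \<in> carr V \<Longrightarrow> c \<in> carr A \<Longrightarrow>
      F (mul A a b) v c = tmap A A (mul A a) id (F b v c)"
    and Fr: "\<And>b v c d. b \<in> carr A \<Longrightarrow> v \<in> carr V \<Longrightarrow> c \<in> carr A \<Longrightarrow> d \<in> carr A \<Longrightarrow>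
      F b v (mul A c d) = tmap A A id (\<lambda>y. mul A y d) (F b v c)"
  defines "h \<equiv> tlift (A \<otimes>\<^sub>v A) (\<lambda>p c. tlift (A \<otimes>\<^sub>v A) (\<lambda>b v. shear (A \<otimes>\<^sub>v A) V S F b v c) (i p))"
  shows "bimod_hom A (bimod_of P) (outer_bimod A) h"
    and "\<And>p c. p \<in> carr P \<Longrightarrow> c \<in> carr A \<Longrightarrow> h (tens P A p c) = tlift (A \<otimes>\<^sub>v A) (\<lambda>b v. shear (A \<otimes>\<^sub>v A) V S F b v c) (i p)"
proof -
  let ?O = "A \<otimes>\<^sub>v A" and ?F = "free_rmod H A V"
  let ?KF = "shear ?O V S F"
  note VD = is_comoduleD[OF V] and PD = is_rmodD[OF P] and iD = rmod_homD[OF i] and FD = free_rmod_facts[OF V]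
  note O = tensor_is_vs[of A A]
  have KF: "trilin A V A ?O ?KF" by (rule shear_trilin[OF VD O S_lin F])
  have il: "lin P (A \<otimes>\<^sub>v V) i" using iD(2) by (simp add: free_rmod_congs)
  note R = lin_rules VD(1) PD(2) trilin_lin1[OF KF] trilin_lin2[OF KF] trilin_lin3[OF KF] lin_comp[OF il] lin_in[OF il]
  have b: "bilin P A ?O (\<lambda>p c. tlift ?O (\<lambda>b v. ?KF b v c) (i p))"
    by (rule bilinI; (assumption | rule R)+)
  note hl = tlift_lin[OF PD(2) A_vs O b, folded h_def]
  show ht: "h (tens P A p c) = tlift ?O (\<lambda>b v. ?KF b v c) (i p)" if "p \<in> carr P" "c \<in> carr A" for p c
    unfolding h_def by (rule tlift_tens[OF PD(2) A_vs O b that])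
  note E = lin_eqI[OF _ PD(2) A_vs O]
  have ol: "lin ?O ?O (tmap A A (mul A a) id)" "lin ?O ?O (tmap A A id (\<lambda>y. mul A y a))" if "a \<in> carr A" for a
    by (rule tmap_lin[OF A_vs A_vs A_vs A_vs] bilin_lin2[OF A_mul that lin_ident] bilin_lin1[OF A_mul lin_ident that] lin_id)+
  have act: "h (bimod_act P a t) = tmap A A (mul A a) id (h t)" if a: "a \<in> carr A" and t: "t \<in> carr (P \<otimes>\<^sub>v A)" for a t
  proof (rule E[OF t])
    fix p c assume p: "p \<in> carr P" "c \<in> carr A"
    \<comment> \<open>This is the action of b on an arbitrary element x of A \<otimes> V, followed
      by the inverse shear and F. In this form \<open>shear_natural\<close> can move the computation
      from P to A \<otimes> V.\<close>
    define G where "G b x c = tlift ?O (\<lambda>b' v. ?KF (mul A b b') v c) x" for b x c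
    have G: "trilin A ?F A ?O G"
      unfolding G_def by (rule trilinI; simp add: free_rmod_congs; (assumption | rule R)+)
    have "h (bimod_act P a (tens P A p c)) = shear ?O P (\<lambda>x. x) (\<lambda>b p c. h (tens P A (act P b p) c)) a p c"
      unfolding bimod_act_tens[OF P a p]
      by (rule lin_shear[OF hl tensor_is_vs O PD(2,3) lin_ident act_tens_trilin[OF PD(2,4)] a p])
    also have "\<dots> = shear ?O P (\<lambda>x. x) (\<lambda>b p c. G b (i p) c) a p c"
    proof (rule shear_cong[OF PD(2,3) lin_ident _ a p])
      fix b p c assume 1: "b \<in> carr A" "p \<in> carr P" "c \<in> carr A"
      have bi: "bilin A V ?O (\<lambda>b v. ?KF b v c)" by (rule bilinI; (assumption | rule R 1)+)
      have "h (tens P A (act P b p) c) = tlift ?O (\<lambda>b v. ?KF b v c) (tmap A V (mul A b) id (i p))"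
        using 1 by (simp add: ht bilin_in[OF PD(4)] iD(3))
      also have "\<dots> = G b (i p) c"
        unfolding G_def
        using tlift_tmap[OF lin_in[OF il 1(2)] A_vs VD(1) A_vs VD(1) O bilin_lin2[OF A_mul 1(1) lin_ident] lin_id bi] by simp
      finally show "h (tens P A (act P b p) c) = G b (i p) c" .
    qed
    also have "\<dots> = shear ?O ?F (\<lambda>x. x) G a (i p) c"
      by (rule shear_natural[OF PD(2,3) FD(1,2) iD(1) lin_ident O G a p, symmetric])
    \<comment> \<open>The element \<open>i p\<close> need not be a pure tensor, but both sides are
      linear in it. On b \<otimes> v the left side becomes a twist, to which
      \<open>twist_shear_antipode\<close> applies.\<close>
    also have "\<dots> = tmap A A (mul A a) id (tlift ?O (\<lambda>b v. ?KF b v c) (i p))"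
    proof (rule lin_eqI[OF lin_in[OF il p(1)] A_vs VD(1) O])
      have bi: "bilin A V ?O (\<lambda>b v. ?KF b v c)" by (rule bilinI; (assumption | rule R p)+)
      show "lin (A \<otimes>\<^sub>v V) ?O (\<lambda>x. tmap A A (mul A a) id (tlift ?O (\<lambda>b v. ?KF b v c) x))"
        by (rule lin_comp[OF ol(1)[OF a] tlift_lin[OF A_vs VD(1) O bi]])
      show "lin (A \<otimes>\<^sub>v V) ?O (\<lambda>x. shear ?O ?F (\<lambda>x. x) G a x c)"
        using trilin_lin2[OF shear_trilin[OF FD(1,2) O lin_ident G] a lin_ident p(2)] by (simp add: free_rmod_congs)
      fix b v assume 1: "b \<in> carr A" "v \<in> carr V"
      have "shear ?O ?F (\<lambda>x. x) G a (tens A V b v) c = tlift ?O (\<lambda>a1 a2. tlift ?O (\<lambda>b' a'. tlift ?O (\<lambda>v' a''.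
          G a1 (tens A V b' v') (mul A a'' c)) (bra V a' v)) (bra (comod_of A) a2 b)) (comul A a)"
        unfolding shear_def
      proof (rule tlift_cong[OF lin_in[OF A_comul a] A_vs A_vs])
        fix a1 a2 assume 2: "a1 \<in> carr A" "a2 \<in> carr A"
        show "tlift ?O (\<lambda>m' a'. G a1 m' (mul A a' c)) (bra ?F a2 (tens A V b v))
          = tlift ?O (\<lambda>b' a'. tlift ?O (\<lambda>v' a''. G a1 (tens A V b' v') (mul A a'' c)) (bra V a' v)) (bra (comod_of A) a2 b)"
          by (rule braid_free[OF V 2(2) 1 O], rule bilinI)
            (assumption | rule trilin_lin2[OF G] trilin_lin3[OF G] lin_rules 2 p)+
      qed
      also have "\<dots> = twist ?O V a ?KF b v c"
        unfolding twist_def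
      proof (intro tlift_cong[OF lin_in[OF A_comul a] A_vs A_vs] tlift_cong[OF bilin_in[OF braid_self_bilin] A_vs A_vs]
          tlift_cong[OF bilin_in[OF braid_bilin[OF VD]] VD(1) A_vs])
        fix a1 a2 b' a' v' a'' assume 2: "a1 \<in> carr A" "b' \<in> carr A" "v' \<in> carr V" "a'' \<in> carr A"
        show "G a1 (tens A V b' v') (mul A a'' c) = ?KF (mul A a1 b') v' (mul A a'' c)"
          unfolding G_def
          by (rule tlift_tens[OF A_vs VD(1) O _ 2(2,3)], rule bilinI) (assumption | rule R 2 p)+
      qed (simp_all add: 1)
      also have "\<dots> = shear ?O V S (\<lambda>b. F (mul A a b)) b v c"
        by (rule twist_shear_antipode[OF V O F a 1 p(2)])
      also have "\<dots> = shear ?O V S (\<lambda>b v c. tmap A A (mul A a) id (F b v c)) b v c"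
        by (rule shear_cong[OF VD S_lin _ 1 p(2)]) (rule Fl[OF a])
      also have "\<dots> = tmap A A (mul A a) id (?KF b v c)"
        by (rule lin_shear[OF ol(1)[OF a] O O VD S_lin F 1 p(2), symmetric])
      also have "\<dots> = tmap A A (mul A a) id (tlift ?O (\<lambda>b v. ?KF b v c) (tens A V b v))"
        by (simp only: tlift_tens[OF A_vs VD(1) O bi 1])
      finally show "shear ?O ?F (\<lambda>x. x) G a (tens A V b v) c = \<dots>" .
    qed
    finally show "h (bimod_act P a (tens P A p c)) = tmap A A (mul A a) id (h (tens P A p c))" by (simp add: ht p)
  qed (rule lin_comp[OF hl] lin_comp[OF ol(1)[OF a]] hl bilin_lin2[OF bimod_act_bilin[OF P] a lin_ident])+
  have ract: "h (tmap P A id (\<lambda>y. mul A y d) t) = tmap A A id (\<lambda>y. mul A y d) (h t)"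
    if d: "d \<in> carr A" and t: "t \<in> carr (P \<otimes>\<^sub>v A)" for d t
  proof (rule E[OF t])
    fix p c assume p: "p \<in> carr P" "c \<in> carr A"
    note ip = lin_in[OF il p(1)]
    have "h (tmap P A id (\<lambda>y. mul A y d) (tens P A p c)) = tlift ?O (\<lambda>b v. ?KF b v (mul A c d)) (i p)"
      by (simp add: ract_tens[OF PD(2)] ht p d bilin_in[OF A_mul])
    also have "\<dots> = tlift ?O (\<lambda>b v. tmap A A id (\<lambda>y. mul A y d) (?KF b v c)) (i p)"
    proof (rule tlift_cong[OF ip A_vs VD(1)])
      fix b v assume 1: "b \<in> carr A" "v \<in> carr V"
      have "?KF b v (mul A c d) = shear ?O V S (\<lambda>b v c. F b v (mul A c d)) b v c"
        by (rule shear_mul_right[OF VD S_lin 1 p(2) d])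
      also have "\<dots> = shear ?O V S (\<lambda>b v c. tmap A A id (\<lambda>y. mul A y d) (F b v c)) b v c"
        by (rule shear_cong[OF VD S_lin _ 1 p(2)]) (rule Fr[OF _ _ _ d])
      also have "\<dots> = tmap A A id (\<lambda>y. mul A y d) (?KF b v c)"
        by (rule lin_shear[OF ol(2)[OF d] O O VD S_lin F 1 p(2), symmetric])
      finally show "?KF b v (mul A c d) = tmap A A id (\<lambda>y. mul A y d) (?KF b v c)" .
    qed
    also have "\<dots> = tmap A A id (\<lambda>y. mul A y d) (tlift ?O (\<lambda>b v. ?KF b v c) (i p))"
      by (rule lin_tlift[OF ol(2)[OF d] A_vs VD(1) O O ip, symmetric]) (rule trilin_in[OF KF _ _ p(2)])
    finally show "h (tmap P A id (\<lambda>y. mul A y d) (tens P A p c)) = tmap A A id (\<lambda>y. mul A y d) (h (tens P A p c))"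
      by (simp add: ht p)
  qed (rule lin_comp[OF hl] lin_comp[OF ol(2)[OF d]] hl bilin_lin1[OF ract_lin[OF PD(2)] lin_ident d])+
  have "lin (bimod_of P) (outer_bimod A) h" using hl by (simp add: lin_def)
  then show "bimod_hom A (bimod_of P) (outer_bimod A) h"
    unfolding bimod_hom_def using act ract by simp
qed

text \<open>On the images of the generators 1 \<otimes> v the bimodule action is the forward shear:
  passing the factor 1 changes nothing, and linearity of g turns the action of \<open>b1\<close> on
  1 \<otimes> v' into \<open>b1\<close> \<otimes> v'.\<close>

lemma bimod_act_generator:
  assumes P: "is_rmod H A P" and V: "is_comodule H V" and g: "rmod_hom H A (free_rmod H A V) P g"
    and b: "b \<in> carr A" "v \<in> carr V" "c \<in> carr A"
  shows "bimod_act P b (tens P A (g (tens A V (one A) v)) c)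
    = shear (P \<otimes>\<^sub>v A) V (\<lambda>x. x) (\<lambda>b v c. tens P A (g (tens A V b v)) c) b v c"
proof -
  let ?F = "free_rmod H A V" and ?T = "P \<otimes>\<^sub>v A"
  note VD = is_comoduleD[OF V] and PD = is_rmodD[OF P] and gD = rmod_homD[OF g] and FD = free_rmod_facts[OF V]
  have gin: "g (tens A V x u) \<in> carr P" for x u
    using lin_in[OF gD(2)] tens_in[OF A_vs VD(1)] by simp
  have F: "trilin A ?F A ?T (\<lambda>b x c. tens P A (act P b (g x)) c)"
    by (rule trilinI; (assumption | rule lin_rules PD(2) bilin_lin1[OF PD(4)] bilin_lin2[OF PD(4)] bilin_in[OF PD(4)]
      gD(2) lin_in[OF gD(2)])+)
  have gl: "lin (A \<otimes>\<^sub>v V) P g" using gD(2) by (simp add: free_rmod_congs)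
  note R = lin_rules VD(1) PD(2) bilin_lin1[OF PD(4)] bilin_lin2[OF PD(4)] bilin_in[OF PD(4)] lin_comp[OF gl] lin_in[OF gl]
    bilin_lin1[OF braid_bilin[OF VD]] bilin_lin2[OF braid_bilin[OF VD]] bilin_in[OF braid_bilin[OF VD]] b
  have "bimod_act P b (tens P A (g (tens A V (one A) v)) c)
    = shear ?T P (\<lambda>x. x) (\<lambda>b m c. tens P A (act P b m) c) b (g (tens A V (one A) v)) c"
    by (rule bimod_act_tens[OF P b(1) gin b(3)])
  also have "\<dots> = shear ?T ?F (\<lambda>x. x) (\<lambda>b x c. tens P A (act P b (g x)) c) b (tens A V (one A) v) c"
    by (rule shear_natural[OF FD(1,2) PD(2,3) gD(1) lin_ident tensor_is_vs act_tens_trilin[OF PD(2,4)] b(1) _ b(3)])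
      (simp add: tens_in A_vs VD(1))
  also have "\<dots> = shear ?T V (\<lambda>x. x) (\<lambda>b v c. tens P A (g (tens A V b v)) c) b v c"
    unfolding shear_def
  proof (rule tlift_cong[OF lin_in[OF A_comul b(1)] A_vs A_vs])
    fix b1 b2 assume 1: "b1 \<in> carr A" "b2 \<in> carr A"
    have "tlift ?T (\<lambda>x a'. tens P A (act P b1 (g x)) (mul A a' c)) (bra ?F b2 (tens A V (one A) v))
      = tlift ?T (\<lambda>b' a'. tlift ?T (\<lambda>v' a''. tens P A (act P b1 (g (tens A V b' v'))) (mul A a'' c)) (bra V a' v))
          (bra (comod_of A) b2 (one A))"
      by (rule braid_free[OF V 1(2) A_one b(2) tensor_is_vs], rule bilinI)
        (assumption | rule trilin_lin2[OF F] trilin_lin3[OF F] lin_rules 1 b)+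
    also have "\<dots> = tlift ?T (\<lambda>v' a''. tens P A (act P b1 (g (tens A V (one A) v'))) (mul A a'' c)) (bra V b2 v)"
      by (rule braid_self_one[OF 1(2) tensor_is_vs], rule bilinI) (assumption | rule R 1)+
    also have "\<dots> = tlift ?T (\<lambda>v' a''. tens P A (g (tens A V b1 v')) (mul A a'' c)) (bra V b2 v)"
    proof (rule tlift_cong[OF bilin_in[OF braid_bilin[OF VD] 1(2) b(2)] VD(1) A_vs])
      fix v' a'' assume 2: "v' \<in> carr V" "a'' \<in> carr A"
      have "act P b1 (g (tens A V (one A) v')) = g (tmap A V (mul A b1) id (tens A V (one A) v'))"
        using gD(3)[OF 1(1), of "tens A V (one A) v'"] tens_in[OF A_vs VD(1)] by simp
      also have "tmap A V (mul A b1) id (tens A V (one A) v') = tens A V b1 v'"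
        using tmap_tens[OF A_vs VD(1) A_vs VD(1) bilin_lin2[OF A_mul 1(1) lin_ident] lin_id A_one 2(1)]
        by (simp add: A_mul_one 1)
      finally show "tens P A (act P b1 (g (tens A V (one A) v'))) (mul A a'' c) = tens P A (g (tens A V b1 v')) (mul A a'' c)"
        by simp
    qed
    finally show "tlift ?T (\<lambda>x a'. tens P A (act P b1 (g x)) (mul A a' c)) (bra ?F b2 (tens A V (one A) v))
      = tlift ?T (\<lambda>v' a''. tens P A (g (tens A V b1 v')) (mul A a'' c)) (bra V b2 v)" .
  qed
  finally show ?thesis .
qed

text \<open>A dual basis of P \<otimes> A comes from a basis of V. The coordinates use the inverse
  shear and the reassembly from generators is the forward shear, so composing them leaves g (i p)
  \<otimes> c = p \<otimes> c.\<close>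

lemma rmod_retract_free_retract:
  assumes P: "is_rmod H A P" and V: "is_comodule H V" "finite_dim V"
    and i: "rmod_hom H A P (free_rmod H A V) i" and g: "rmod_hom H A (free_rmod H A V) P g"
    and gi: "\<And>x. x \<in> carr P \<Longrightarrow> g (i x) = x"
  shows "free_retract A (bimod_of P)"
proof -
  let ?O = "A \<otimes>\<^sub>v A" and ?T = "P \<otimes>\<^sub>v A"
  note VD = is_comoduleD[OF V(1)] and PD = is_rmodD[OF P] and gD = rmod_homD[OF g]
  note O = tensor_is_vs[of A A] and T = tensor_is_vs[of P A]
  obtain m :: nat and e where e: "\<And>j. j < m \<Longrightarrow> e j \<in> carr V"
    and expand: "\<And>x. x \<in> carr V \<Longrightarrow> (\<Sum>j<m. scl V (coord V x (e j)) (e j)) = x"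
    by (rule basis_enumeration[OF VD(1) V(2)]) blast
  \<comment> \<open>The coordinate of A \<otimes> V \<otimes> A at the basis vector
    \<open>e j\<close>.\<close>
  define F where "F j b v c = scl ?O (coord V v (e j)) (tens A A b c)" for j b v c
  have cl: "lin V base_field (\<lambda>v. coord V v (e j))" for j
    unfolding lin_def by (simp add: coord_add[OF VD(1)] coord_scl[OF VD(1)])
  have F: "trilin A V A ?O (F j)" for j
    unfolding F_def by (rule trilinI; (assumption | rule lin_scale_left[OF _ cl] lin_rules)+)
  have Fl: "F j (mul A a b) v c = tmap A A (mul A a) id (F j b v c)"
    if "a \<in> carr A" "b \<in> carr A" "v \<in> carr V" "c \<in> carr A" for j a b v c
  proof -
    note l = bilin_lin2[OF A_mul that(1) lin_ident]
    show ?thesis unfolding F_def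
      using lin_scl[OF tmap_lin[OF A_vs A_vs A_vs A_vs l lin_id] tens_in[OF A_vs A_vs]]
        tmap_tens[OF A_vs A_vs A_vs A_vs l lin_id that(2,4)] by simp
  qed
  have Fr: "F j b v (mul A c d) = tmap A A id (\<lambda>y. mul A y d) (F j b v c)"
    if "b \<in> carr A" "v \<in> carr V" "c \<in> carr A" "d \<in> carr A" for j b v c d
  proof -
    note l = bilin_lin1[OF A_mul lin_ident that(4)]
    show ?thesis unfolding F_def
      using lin_scl[OF tmap_lin[OF A_vs A_vs A_vs A_vs lin_id l] tens_in[OF A_vs A_vs]]
        tmap_tens[OF A_vs A_vs A_vs A_vs lin_id l that(1,3)] by simp
  qed
  define h where "h j = tlift ?O (\<lambda>p c. tlift ?O (\<lambda>b v. shear ?O V S (F j) b v c) (i p))" for j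
  have hom: "bimod_hom A (bimod_of P) (outer_bimod A) (h j)" for j
    unfolding h_def by (rule free_coordinate_hom(1)[OF P V(1) i F]; rule Fl Fr; assumption)
  have ht: "h j (tens P A p c) = tlift ?O (\<lambda>b v. shear ?O V S (F j) b v c) (i p)"
    if "p \<in> carr P" "c \<in> carr A" for j p c
    unfolding h_def by (rule free_coordinate_hom(2)[OF P V(1) i F _ _ that]; rule Fl Fr; assumption)
  \<comment> \<open>The image of the free generator 1 \<otimes> \<open>e j\<close>; the
    corresponding generator of the bimodule is \<open>x j\<close> \<otimes> 1.\<close>
  define x where "x j = g (tens A V (one A) (e j))" for j
  have gl: "lin (A \<otimes>\<^sub>v V) P g" and il: "lin P (A \<otimes>\<^sub>v V) i"
    using gD(2) rmod_homD(2)[OF i] by (simp_all add: free_rmod_congs)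
  have xin: "x j \<in> carr P" for j unfolding x_def by (rule lin_in[OF gl tens_in[OF A_vs VD(1)]])
  \<comment> \<open>The reassembly map a \<otimes> c \<mapsto> a (\<open>x j\<close> \<otimes> 1) c,
    with the right action already carried out.\<close>
  define L where "L j = tlift ?T (\<lambda>b c. bimod_act P b (tens P A (x j) c))" for j
  have lb: "bilin A A ?T (\<lambda>b c. bimod_act P b (tens P A (x j) c))" for j
    by (rule bilinI; (assumption | rule bilin_lin1[OF bimod_act_bilin[OF P]] bilin_lin2[OF bimod_act_bilin[OF P]]
      lin_rules PD(2) xin)+)
  have Ll: "lin ?O ?T (L j)" for j unfolding L_def by (rule tlift_lin[OF A_vs A_vs T lb])
  have LF: "L j (F j b v c) = scl ?T (coord V v (e j)) (bimod_act P b (tens P A (x j) c))"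
    if "b \<in> carr A" "c \<in> carr A" for j b v c
    unfolding F_def using lin_scl[OF Ll tens_in[OF A_vs A_vs]] tlift_tens[OF A_vs A_vs T lb that]
    by (simp add: L_def)
  have dual_tens: "(\<Sum>j<m. L j (h j (tens P A p c))) = tens P A p c" if p: "p \<in> carr P" "c \<in> carr A" for p c
  proof -
    note ip = lin_in[OF il p(1)]
    have "L j (h j (tens P A p c)) = tlift ?T (\<lambda>b v. L j (shear ?O V S (F j) b v c)) (i p)" for j
      unfolding ht[OF p]
      by (rule lin_tlift[OF Ll A_vs VD(1) O T ip]) (rule trilin_in[OF shear_trilin[OF VD O S_lin F] _ _ p(2)])
    then have "(\<Sum>j<m. L j (h j (tens P A p c))) = tlift ?T (\<lambda>b v. \<Sum>j<m. L j (shear ?O V S (F j) b v c)) (i p)"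
      by (simp add: tlift_sum[OF T])
    also have "\<dots> = tlift ?T (\<lambda>b v. tens P A (g (tens A V b v)) c) (i p)"
    proof (rule tlift_cong[OF ip A_vs VD(1)])
      fix b v assume b: "b \<in> carr A" "v \<in> carr V"
      have "(\<Sum>j<m. L j (shear ?O V S (F j) b v c)) = shear ?T V S (\<lambda>b v c. \<Sum>j<m. L j (F j b v c)) b v c"
        by (simp only: lin_shear[OF Ll O T VD S_lin F b p(2)] shear_sum[OF T])
      \<comment> \<open>The sum over j rebuilds v from its coordinates, and
        \<open>bimod_act_generator\<close> recognizes the result as a forward shear, which the shear
        with S outside it undoes.\<close>
      also have "\<dots> = shear ?T V S (shear ?T V (\<lambda>x. x) (\<lambda>b v c. tens P A (g (tens A V b v)) c)) b v c"
      proof (rule shear_cong[OF VD S_lin _ b p(2)])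
        fix b v c assume 1: "b \<in> carr A" "v \<in> carr V" "c \<in> carr A"
        let ?l = "\<lambda>v. bimod_act P b (tens P A (g (tens A V (one A) v)) c)"
        have l: "lin V ?T ?l"
          by (assumption | rule bilin_lin2[OF bimod_act_bilin[OF P]] lin_rules PD(2) VD(1) lin_comp[OF gl] 1)+
        have "(\<Sum>j<m. L j (F j b v c)) = (\<Sum>j<m. scl ?T (coord V v (e j)) (?l (e j)))"
          by (simp add: LF 1 x_def)
        also have "\<dots> = ?l (\<Sum>j<m. scl V (coord V v (e j)) (e j))"
          by (rule lin_sum(1)[OF VD(1) T l, symmetric]) (simp_all add: e)
        also have "\<dots> = shear ?T V (\<lambda>x. x) (\<lambda>b v c. tens P A (g (tens A V b v)) c) b v c"
          unfolding expand[OF 1(2)] by (rule bimod_act_generator[OF P V(1) g 1])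
        finally show "(\<Sum>j<m. L j (F j b v c)) = shear ?T V (\<lambda>x. x) (\<lambda>b v c. tens P A (g (tens A V b v)) c) b v c" .
      qed
      also have "\<dots> = tens P A (g (tens A V b v)) c"
        by (rule shear_shear[OF V(1) T S_lin lin_ident S_antipode(2) _ b p(2)])
          (assumption | rule trilinI lin_rules PD(2) VD(1) lin_comp[OF gl] lin_in[OF gl])+
      finally show "(\<Sum>j<m. L j (shear ?O V S (F j) b v c)) = tens P A (g (tens A V b v)) c" .
    qed
    also have "\<dots> = tens P A (g (tlift (A \<otimes>\<^sub>v V) (tens A V) (i p))) c"
    proof -
      have l: "lin (A \<otimes>\<^sub>v V) ?T (\<lambda>y. tens P A (g y) c)"
        by (rule bilin_lin1[OF tens_bilin[OF PD(2) A_vs] gl p(2)])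
      show ?thesis
        by (rule lin_tlift[OF l A_vs VD(1) tensor_is_vs T ip, symmetric]) (rule tens_in[OF A_vs VD(1)])
    qed
    also have "\<dots> = tens P A p c" by (simp add: tlift_tens_self[OF A_vs VD(1) ip] gi p)
    finally show ?thesis .
  qed
  show ?thesis
  proof (rule dual_basis_free_retract[OF A_alg bimod_of_is_bimod[OF P], where x = "\<lambda>j. tens P A (x j) (one A)" and p = h and m = m])
    show "tens P A (x j) (one A) \<in> carr (bimod_of P)" for j by (simp add: tens_in PD(2) A_vs)
    show "bimod_hom A (bimod_of P) (outer_bimod A) (h j)" for j by (rule hom)
    have hl: "lin ?T ?O (h j)" for j
      using bimod_homD(1)[OF hom] unfolding lin_def by simp
    fix t assume "t \<in> carr (bimod_of P)"
    then have t: "t \<in> carr ?T" by simp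
    have "(\<Sum>j<m. tlift (bimod_of P) (\<lambda>a c. lact (bimod_of P) a (ract (bimod_of P) (tens P A (x j) (one A)) c)) (h j t))
      = (\<Sum>j<m. L j (h j t))"
    proof (rule sum.cong[OF refl])
      fix j
      have "tlift (bimod_of P) (\<lambda>a c. lact (bimod_of P) a (ract (bimod_of P) (tens P A (x j) (one A)) c)) (h j t)
        = tlift ?T (\<lambda>a c. lact (bimod_of P) a (ract (bimod_of P) (tens P A (x j) (one A)) c)) (h j t)"
        by (simp add: tlift_def)
      also have "\<dots> = L j (h j t)"
        unfolding L_def
        by (rule tlift_cong[OF lin_in[OF hl t] A_vs A_vs]) (simp add: ract_tens[OF PD(2) xin A_one] A_one_mul)
      finally show "tlift (bimod_of P) (\<lambda>a c. lact (bimod_of P) a (ract (bimod_of P) (tens P A (x j) (one A)) c)) (h j t)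
        = L j (h j t)" .
    qed
    also have "\<dots> = t"
    proof (rule lin_eqI[OF t PD(2) A_vs T _ lin_ident])
      show "lin ?T ?T (\<lambda>t. \<Sum>j<m. L j (h j t))"
        using lin_comp[OF Ll hl] unfolding lin_def
        by (auto intro!: vs_sum[OF T] simp: sum.distrib scl_sum_right[OF T])
    qed (rule dual_tens)
    finally show "(\<Sum>j<m. tlift (bimod_of P) (\<lambda>a c. lact (bimod_of P) a (ract (bimod_of P) (tens P A (x j) (one A)) c)) (h j t)) = t" .
  qed
qed

section \<open>From the resolution of the trivial module to that of A\<close>

text \<open>The isomorphism from P to the summand Q, followed by the inclusion into A \<otimes> V,
  is split by the projection onto Q followed by the inverse isomorphism.\<close>

lemma finite_rel_projective_free_retract:
  assumes "finite_rel_projective v H A P"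
  shows "free_retract A (bimod_of P)"
proof -
  obtain V :: "('k, 'b, 'h) comod" and Q where P: "is_rmod H A P" and V: "is_comodule H V" "finite_dim V"
    and Q: "rmod_summand H A Q (free_rmod H A V)" and iso: "rmod_iso H A P Q"
    using assms unfolding finite_rel_projective_def by blast
  note FD = free_rmod_facts[OF V(1)]
  obtain p where p: "rmod_hom H A (free_rmod H A V) Q p" "\<And>x. x \<in> carr Q \<Longrightarrow> p x = x"
    by (rule rmod_summand_projection[OF H_vs FD(1,2) FD(4) Q]) blast+
  obtain f g where f: "rmod_hom H A P Q f" and g: "rmod_hom H A Q P g" and gf: "\<And>x. x \<in> carr P \<Longrightarrow> g (f x) = x"
    using iso unfolding rmod_iso_def by blast
  have Qr: "is_rmod H A Q" and inc: "rmod_hom H A Q (free_rmod H A V) id"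
    using Q unfolding rmod_summand_def by blast+
  note QD = is_rmodD[OF Qr] and PD = is_rmodD[OF P]
  show ?thesis
  proof (rule rmod_retract_free_retract[OF P V])
    show "rmod_hom H A P (free_rmod H A V) (\<lambda>x. id (f x))"
      by (rule rmod_hom_comp[OF H_vs PD(2,3) QD(2) FD(1) f inc])
    show "rmod_hom H A (free_rmod H A V) P (\<lambda>x. g (p x))"
      by (rule rmod_hom_comp[OF H_vs FD(1,2) QD(2) PD(2) p(1) g])
    show "g (p (id (f x))) = x" if "x \<in> carr P" for x
      using p(2)[OF lin_in[OF rmod_homD(2)[OF f] that]] gf[OF that] by simp
  qed
qed

lemma smooth_if_type_FP:
  fixes p :: "'p::ab_group_add itself"
  assumes "type_FP p v H A (trivial_rmod H A)"
  shows "smooth_algebra A"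
proof -
  let ?k = "trivial_rmod H A"
  have k: "is_rmod H A ?k" using assms by (simp add: type_FP_def)
  obtain n and P :: "nat \<Rightarrow> ('k, 'p, 'h, 'a) rmod" and d e where P': "\<forall>i\<le>n. finite_rel_projective v H A (P i)"
    and d': "\<forall>i<n. rmod_hom H A (P (Suc i)) (P i) (d i)" and e: "rmod_hom H A (P 0) ?k e"
    and ex: "exact_sequence n (\<lambda>i. carr (P i)) d e (carr ?k)"
    using assms unfolding type_FP_def by blast
  have P: "finite_rel_projective v H A (P i)" if "i \<le> n" for i using P' that by blast
  have d: "rmod_hom H A (P (Suc i)) (P i) (d i)" if "i < n" for i using d' that by blast
  have Pr: "is_rmod H A (P i)" if "i \<le> n" for i using P[OF that] by (simp add: finite_rel_projective_def)
  have Pv: "is_vs (P i)" if "i \<le> n" for i by (rule is_rmodD(2)[OF Pr[OF that]])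
  have dl: "lin (P (Suc i)) (P i) (d i)" if "i < n" for i by (rule rmod_homD(2)[OF d[OF that]])
  note el = rmod_homD(2)[OF e] and kv = is_rmodD(2)[OF k]
  let ?h = "tlift A (scl A)"
  note hh = bimod_of_trivial[OF k]
  \<comment> \<open>The tensored augmentation ends in k \<otimes> A; composing it with
    \<open>?h\<close> makes it end in the regular bimodule.\<close>
  let ?d = "\<lambda>i. tmap (P i) A (d i) id" and ?e = "\<lambda>t. ?h (tmap ?k A e id t)"
  \<comment> \<open>Since \<open>?h\<close> is injective, this composition does not change the
    kernel of the augmentation.\<close>
  have hinj: "?h t = 0 \<longleftrightarrow> t = 0" if "t \<in> carr (?k \<otimes>\<^sub>v A)" for t
  proof -
    have "?h 0 = 0" by (simp add: tlift_def)
    then show ?thesis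
      using inj_on_eq_iff[OF bij_betw_imp_inj_on[OF hh(2)], of t 0] that vs_zero[OF tensor_is_vs, of ?k A] by simp
  qed
  show ?thesis
  proof (rule smooth_algebra_if_retracts[OF A_alg, where X = "\<lambda>i. bimod_of (P i)" and n = n and d = ?d and e = ?e])
    show "free_retract A (bimod_of (P i))" if "i \<le> n" for i
      by (rule finite_rel_projective_free_retract[OF P[OF that]])
    show "bimod_hom A (bimod_of (P (Suc i))) (bimod_of (P i)) (?d i)" if "i < n" for i
      by (rule bimod_of_hom[OF Pr Pr d[OF that]]) (use that in simp_all)
    show "bimod_hom A (bimod_of (P 0)) (regular_bimod A) ?e"
      by (rule bimod_hom_comp[OF hh(1) bimod_of_hom[OF Pr[OF le0] k e]])
    show "exact_sequence n (\<lambda>i. carr (bimod_of (P i))) ?d ?e (carr A)"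
      unfolding exact_sequence_def bimod_of_simps
    proof (intro conjI allI impI)
      have "?e ` carr (P 0 \<otimes>\<^sub>v A) = ?h ` carr (?k \<otimes>\<^sub>v A)"
        using tensor_surj[OF Pv[OF le0] kv A_vs el] ex by (simp add: exact_sequence_def flip: image_image)
      then show "?e ` carr (P 0 \<otimes>\<^sub>v A) = carr A" using bij_betw_imp_surj_on[OF hh(2)] by simp
      have "{t \<in> carr (P 0 \<otimes>\<^sub>v A). ?e t = 0} = {t \<in> carr (P 0 \<otimes>\<^sub>v A). tmap ?k A e id t = 0}"
        using hinj[OF lin_in[OF tmap_lin[OF Pv[OF le0] A_vs kv A_vs el lin_id]]] by blast
      also have "\<dots> = (if n = 0 then {0} else ?d 0 ` carr (P 1 \<otimes>\<^sub>v A))"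
      proof (cases "n = 0")
        case True
        then show ?thesis using tensor_ker_zero[OF Pv[OF le0] kv A_vs el] ex by (simp add: exact_sequence_def)
      next
        case False
        then show ?thesis
          using tensor_ker[OF Pv[OF le0] kv A_vs Pv[of 1] el, of "d 0"] dl[of 0] ex by (simp add: exact_sequence_def)
      qed
      finally show "{t \<in> carr (P 0 \<otimes>\<^sub>v A). ?e t = 0} = (if n = 0 then {0} else ?d 0 ` carr (P 1 \<otimes>\<^sub>v A))" .
      fix i assume i: "i < n"
      then have v: "is_vs (P (Suc i))" "is_vs (P i)" by (simp_all add: Pv)
      have ker: "{x \<in> carr (P (Suc i)). d i x = 0} = (if Suc i = n then {0} else d (Suc i) ` carr (P (Suc (Suc i))))"
        using ex i by (simp add: exact_sequence_def)
      show "{t \<in> carr (P (Suc i) \<otimes>\<^sub>v A). ?d i t = 0} =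
        (if Suc i = n then {0} else ?d (Suc i) ` carr (P (Suc (Suc i)) \<otimes>\<^sub>v A))"
      proof (cases "Suc i = n")
        case True
        then show ?thesis using tensor_ker_zero[OF v A_vs dl[OF i]] ker by simp
      next
        case False
        then have "Suc i < n" using i by simp
        then show ?thesis
          using tensor_ker[OF v A_vs Pv[of "Suc (Suc i)"] dl[OF i] dl[of "Suc i"]] ker by simp
      qed
    qed
  qed
qed

end

theorem theorem4p3:
  fixes H :: "('k::field, 'h::ab_group_add) bialg"
    and r :: "'h \<Rightarrow> 'h \<Rightarrow> 'k"
    and A :: "('k, 'a::ab_group_add, 'h) cobialg"
  assumes "coquasitriangular H r"
    and "braided_hopf_algebra H r A"
    and "type_FP TYPE('p::ab_group_add) TYPE('v::ab_group_add) H A (trivial_rmod H A)"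
  shows "smooth_algebra A"
proof -
  obtain S where "is_antipode A S" using assms(2) by (auto simp: braided_hopf_algebra_def Let_def)
  with assms(1,2) interpret braided_hopf H r A S by unfold_locales
  show ?thesis by (rule smooth_if_type_FP[OF assms(3)])
qed

end
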